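(* Let $m,d$ be positive integers and let $\mathcal{I}=(p_1,\ldots,p_m)$ be an $m$-tuple of invariant factors over $\mathbb{F}_q$ with $\deg\mathcal{I}=md$. Then $$\sigma(m,d;\mathcal{I})=\frac{c(\mathcal{I})}{\gamma_q(m)}\,\mu_q(m,m,d;\mathcal{I}).$$
   Context: A $k$-tuple of invariant factors is $(f_1,\ldots,f_k)$ with each $f_i$ monic in $\mathbb{F}_q[x]$ and $f_i\mid f_{i+1}$; its degree is $\deg(f_1\cdots f_k)$. For positive integers $k\le n$ and $d\ge 0$, $M_q(n,k,d)$ is the set of $n\times k$ matrices over $\mathbb{F}_q[x]$ of the form $x^dI+x^{d-1}C_{d-1}+\cdots+C_0$ with $C_i\in M_{n,k}(\mathbb{F}_q)$, where $I$ is the $n\times k$ matrix with $(i,j)$ entry $1$ if $i=j$ and $0$ otherwise. Two such matrices $P,Q$ are equivalent if $APB=Q$ for some invertible $A\in M_n(\mathbb{F}_q[x])$, $B\in M_k(\mathbb{F}_q[x])$; each $P$ is equivalent to a unique $\mathrm{diag}_{n,k}(p_1,\ldots,p_k)$ with $(p_1,\ldots,p_k)$ a $k$-tuple of invariant factors (Smith normal form), called the invariant factors of $P$. $\mu_q(n,k,d;\mathcal{I})$ is the number of $P\in M_q(n,k,d)$ whose invariant factors are $\mathcal{I}$. For a linear operator $T$ on an $md$-dimensional $\mathbb{F}_q$-space $V$, an $m$-dimensional subspace $W$ is $T$-splitting if $V=W\oplus TW\oplus\cdots\oplus T^{d-1}W$; the number of these depends only on the invariant factors of $T$ (those of $xI-A$,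 $A$ a matrix of $T$). For an $m$-tuple $\mathcal{I}=(p_1,\ldots,p_m)$ with $\deg\mathcal{I}=md$, $\sigma(m,d;\mathcal{I})$ is the number of $m$-dimensional $T$-splitting subspaces for any operator $T$ on an $md$-dimensional space with invariant factors $(1,\ldots,1,p_1,\ldots,p_m)$ ($m(d-1)$ ones), and $c(\mathcal{I})$ is the order of the centralizer in $\mathrm{GL}_{md}(\mathbb{F}_q)$ of any matrix $A\in M_{md}(\mathbb{F}_q)$ such that $xI-A$ has invariant factors $(1,\ldots,1,p_1,\ldots,p_m)$. $\gamma_q(m)=\prod_{i=0}^{m-1}(q^m-q^i)=|\mathrm{GL}_m(\mathbb{F}_q)|$. *)

theory Defs
  imports "Jordan_Normal_Form.Char_Poly" "Jordan_Normal_Form.VS_Connect" "HOL-Library.Cardinality"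
begin

text \<open>The finite field with \<open>q\<close> elements is a type \<open>'a :: {field, finite}\<close> with \<open>q = CARD('a)\<close>.
  Tuples are lists, so that \<open>(f\<^sub>1, \<dots>, f\<^sub>k)\<close> has entries \<open>fs ! 0, \<dots>, fs ! (k - 1)\<close>.\<close>

definition invariant_factor_tuple :: "nat \<Rightarrow> 'a::field poly list \<Rightarrow> bool" where
  "invariant_factor_tuple k fs \<longleftrightarrow>
     length fs = k \<and>
     (\<forall>i < k. lead_coeff (fs ! i) = 1) \<and>
     (\<forall>i. Suc i < k \<longrightarrow> fs ! i dvd fs ! Suc i)"

definition tuple_degree :: "'a::field poly list \<Rightarrow> nat" where
  "tuple_degree fs = degree (prod_list fs)"

definition diag_rect :: "nat \<Rightarrow> nat \<Rightarrow> 'a::field poly list \<Rightarrow> 'a poly mat" where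
  "diag_rect n k fs = mat n k (\<lambda>(i, j). if i = j then fs ! i else 0)"

definition equivalent_mat :: "nat \<Rightarrow> nat \<Rightarrow> 'a::field poly mat \<Rightarrow> 'a poly mat \<Rightarrow> bool" where
  "equivalent_mat n k P Q \<longleftrightarrow>
     (\<exists>A \<in> carrier_mat n n. \<exists>B \<in> carrier_mat k k.
        invertible_mat A \<and> invertible_mat B \<and> A * P * B = Q)"

definition has_invariant_factors :: "nat \<Rightarrow> nat \<Rightarrow> 'a::field poly mat \<Rightarrow> 'a poly list \<Rightarrow> bool" where
  "has_invariant_factors n k P fs \<longleftrightarrow>
     P \<in> carrier_mat n k \<and> invariant_factor_tuple k fs \<and> equivalent_mat n k P (diag_rect n k fs)"

text \<open>Entry \<open>(i, j)\<close> of \<open>x\<^sup>d I + x\<^sup>d\<^sup>-\<^sup>1 C\<^sub>d\<^sub>-\<^sub>1 + \<dots> + C\<^sub>0\<close>, where \<open>I\<close> is the rectangular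
  identity.\<close>

definition monic_mat_polys :: "nat \<Rightarrow> nat \<Rightarrow> nat \<Rightarrow> 'a::field poly mat set" where
  "monic_mat_polys n k d =
     {mat n k (\<lambda>(i, j). monom (if i = j then 1 else 0) d + (\<Sum>l<d. monom (C l $$ (i, j)) l)) | C.
        \<forall>l < d. C l \<in> carrier_mat n k}"

definition mu :: "nat \<Rightarrow> nat \<Rightarrow> nat \<Rightarrow> 'a::{field, finite} poly list \<Rightarrow> nat" where
  "mu n k d fs = card {P \<in> monic_mat_polys n k d. has_invariant_factors n k P fs}"

definition is_matrix_of :: "('a::field, 'v) module \<Rightarrow> ('v \<Rightarrow> 'v) \<Rightarrow> 'v list \<Rightarrow> 'a mat \<Rightarrow> bool" where
  "is_matrix_of V T bs A \<longleftrightarrow>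
     distinct bs \<and> vectorspace.basis class_ring V (set bs) \<and>
     A \<in> carrier_mat (length bs) (length bs) \<and>
     (\<forall>j < length bs. T (bs ! j) = (\<Oplus>\<^bsub>V\<^esub> i \<in> {..<length bs}. A $$ (i, j) \<odot>\<^bsub>V\<^esub> bs ! i))"

text \<open>Here \<open>char_poly_matrix A\<close> is the matrix \<open>xI - A\<close>.  The matrices of an operator are similar, so
  the choice of basis does not matter.\<close>

definition op_has_invariant_factors ::
    "('a::field, 'v) module \<Rightarrow> ('v \<Rightarrow> 'v) \<Rightarrow> 'a poly list \<Rightarrow> bool" where
  "op_has_invariant_factors V T fs \<longleftrightarrow>
     (\<exists>bs A. is_matrix_of V T bs A \<and>
        has_invariant_factors (length bs) (length bs) (char_poly_matrix A) fs)"

definition is_direct_sum :: "('a::field, 'v) module \<Rightarrow> nat \<Rightarrow> (nat \<Rightarrow> 'v set) \<Rightarrow> bool" where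
  "is_direct_sum V d U \<longleftrightarrow>
     (\<forall>i < d. subspace class_ring (U i) V) \<and>
     (\<forall>v \<in> carrier V. \<exists>!u. u \<in> (\<Pi>\<^sub>E i \<in> {..<d}. U i) \<and> v = (\<Oplus>\<^bsub>V\<^esub> i \<in> {..<d}. u i))"

definition splitting_subspace ::
    "('a::field, 'v) module \<Rightarrow> ('v \<Rightarrow> 'v) \<Rightarrow> nat \<Rightarrow> nat \<Rightarrow> 'v set \<Rightarrow> bool" where
  "splitting_subspace V T m d W \<longleftrightarrow>
     subspace class_ring W V \<and>
     vectorspace.fin_dim class_ring (V\<lparr>carrier := W\<rparr>) \<and>
     vectorspace.dim class_ring (V\<lparr>carrier := W\<rparr>) = m \<and>
     is_direct_sum V d (\<lambda>i. (T ^^ i) ` W)"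

definition padded :: "nat \<Rightarrow> nat \<Rightarrow> 'a::field poly list \<Rightarrow> 'a poly list" where
  "padded m d ps = replicate (m * (d - 1)) 1 @ ps"

text \<open>The common value of the number of splitting subspaces over all operators with the prescribed
  invariant factors on \<open>md\<close>-dimensional spaces.  The spaces range over those whose vectors are taken
  from the type \<open>'a vec\<close>; this contains a copy of every finite-dimensional space over \<open>'a\<close>.\<close>

definition sigma :: "nat \<Rightarrow> nat \<Rightarrow> 'a::{field, finite} poly list \<Rightarrow> nat" where
  "sigma m d ps =
     (THE N. \<forall>(V :: ('a, 'a vec) module) T.
        linear_map class_ring V V T \<and>
        vectorspace.fin_dim class_ring V \<and> vectorspace.dim class_ring V = m * d \<and>
        op_has_invariant_factors V T (padded m d ps) \<longrightarrow>
        card {W. splitting_subspace V T m d W} = N)"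

definition GL_centralizer :: "nat \<Rightarrow> 'a::field mat \<Rightarrow> 'a mat set" where
  "GL_centralizer n A = {B \<in> carrier_mat n n. invertible_mat B \<and> A * B = B * A}"

definition centralizer_order :: "nat \<Rightarrow> nat \<Rightarrow> 'a::{field, finite} poly list \<Rightarrow> nat" where
  "centralizer_order m d ps =
     (THE N. \<forall>A \<in> carrier_mat (m * d) (m * d).
        has_invariant_factors (m * d) (m * d) (char_poly_matrix A) (padded m d ps) \<longrightarrow>
        card (GL_centralizer (m * d) A) = N)"

definition gamma_q :: "nat \<Rightarrow> nat \<Rightarrow> real" where
  "gamma_q q m = (\<Prod>i<m. real q ^ m - real q ^ i)"

end

theory Submission
  imports Defs "HOL-Library.Function_Algebras" "Jordan_Normal_Form.Column_Operations"
begin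

text \<open>Let \<open>A\<close> be a matrix such that \<open>x I - A\<close> has the invariant factors \<open>(1, \<dots>, 1, p\<^sub>1, \<dots>, p\<^sub>m)\<close>, and
  regard \<open>F\<^sup>m\<^sup>d\<close> as an \<open>F[x]\<close>-module on which \<open>x\<close> acts as \<open>A\<close>.  Count the ordered bases \<open>X\<close> of
  \<open>A\<close>-splitting subspaces in two ways.  Each splitting subspace has \<open>|GL\<^sub>m(F)|\<close> of them.  On the other
  hand, \<open>X\<close> generates the module, and expressing each \<open>A\<^sup>d X\<^sub>j\<close> through the basis \<open>A\<^sup>i X\<^sub>k\<close> (\<open>i < d\<close>)
  gives a unique monic matrix polynomial \<open>P\<close> of degree \<open>d\<close> whose columns span the relations among
  \<open>X\<close>.  A monic \<open>P\<close> occurs in this way iff \<open>F[x]\<^sup>m / P F[x]\<^sup>m\<close> is isomorphic to the module, that is,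
  iff \<open>P\<close> has the invariant factors \<open>p\<^sub>1, \<dots>, p\<^sub>m\<close>; and the \<open>X\<close> that belong to the same \<open>P\<close> form a
  single orbit on which the centralizer of \<open>A\<close> acts freely.\<close>

section \<open>Finite sequences and matrices acting on them\<close>

text \<open>\<open>sigma\<close> and \<open>centralizer_order\<close> are definite descriptions, so
  the double count alone is not enough: their values must be independent of the chosen operator or
  matrix, and some operator with the prescribed invariant factors must exist. Independence holds
  because operators presented by the same polynomial matrix are isomorphic.

  That the relations among X are all of P F[x]^m rests on division with remainder by a monic matrix
  polynomial: modulo P, every vector is congruent to one with entries of degree below d, and there
  are q^(md) of those, as many as elements of the space.

  That every monic P presenting the module has the factors p_1, ..., p_m needs the uniqueness of the
  Smith form. Over a finite field this is again a count: the sizes of the kernels of g(A), for all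
  polynomials g, depend only on the module and determine a divisibility chain of monic diagonal
  entries.

  All counts are identities between products of natural numbers; the division by |GL_m(F)| is left
  to the very end.\<close>

lemma sum_fun_apply: "(\<Sum>a\<in>A. f a) x = (\<Sum>a\<in>A. f a (x::'i) :: 'b::comm_monoid_add)"
  by (induction A rule: infinite_finite_induct) auto

text \<open>Tuples are total functions that vanish from \<open>n\<close> on, so that pointwise
  \<open>+\<close> and \<open>0\<close> apply and equal tuples are equal functions. \<open>B\<close>
  may vary with the index because residues modulo different f_i obey different degree
  bounds.\<close>

definition seqs :: "nat \<Rightarrow> (nat \<Rightarrow> 'b::zero set) \<Rightarrow> (nat \<Rightarrow> 'b) set" where
  "seqs n B = {f. (\<forall>i<n. f i \<in> B i) \<and> (\<forall>i\<ge>n. f i = 0)}"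

abbreviation fvec :: "nat \<Rightarrow> (nat \<Rightarrow> 'b::zero) set" where
  "fvec n \<equiv> seqs n (\<lambda>_. UNIV)"

lemma seqsD: "f \<in> seqs n B \<Longrightarrow> i < n \<Longrightarrow> f i \<in> B i" "f \<in> seqs n B \<Longrightarrow> n \<le> i \<Longrightarrow> f i = 0"
  by (auto simp: seqs_def)

lemma seqs_bij: "bij_betw (\<lambda>f. restrict f {..<n}) (seqs n B) (\<Pi>\<^sub>E i\<in>{..<n}. B i)"
proof (rule bij_betw_byWitness[where f' = "\<lambda>f i. if i < n then f i else 0"])
  show "\<forall>a\<in>seqs n B. (\<lambda>i. if i < n then restrict a {..<n} i else 0) = a"
    by (auto simp: seqs_def fun_eq_iff)
qed (auto simp: seqs_def fun_eq_iff PiE_def extensional_def)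

lemma card_seqs: "card (seqs n B) = (\<Prod>i<n. card (B i))"
  using bij_betw_same_card[OF seqs_bij, of n B] by (simp add: card_PiE)

lemma finite_seqs: "(\<And>i. i < n \<Longrightarrow> finite (B i)) \<Longrightarrow> finite (seqs n B)"
  unfolding bij_betw_finite[OF seqs_bij] by (rule finite_PiE) auto

lemma card_fvec: "card (fvec n :: (nat \<Rightarrow> 'a::{zero,finite}) set) = CARD('a) ^ n"
  by (simp add: card_seqs)

lemma finite_fvec [simp]: "finite (fvec n :: (nat \<Rightarrow> 'a::{zero,finite}) set)"
  by (rule finite_seqs) simp

lemma fvec_zero: "(0 :: nat \<Rightarrow> 'b::zero) \<in> fvec k"
  by (auto simp: seqs_def)

lemma fvec_add: "b \<in> fvec k \<Longrightarrow> c \<in> fvec k \<Longrightarrow> b + c \<in> fvec k" for b c :: "nat \<Rightarrow> 'b::monoid_add"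
  by (auto simp: seqs_def)

lemma fvec_diff: "b \<in> fvec k \<Longrightarrow> c \<in> fvec k \<Longrightarrow> b - c \<in> fvec k" for b c :: "nat \<Rightarrow> 'b::group_add"
  by (auto simp: seqs_def)

lemma fvec_scale: "c \<in> fvec k \<Longrightarrow> (\<lambda>i. a * c i) \<in> fvec k" for c :: "nat \<Rightarrow> 'b::mult_zero"
  by (auto simp: seqs_def)

text \<open>The condition \<open>degree p < d\<close> would wrongly exclude \<open>0\<close> from \<open>low 0\<close>.\<close>

definition low :: "nat \<Rightarrow> 'a::zero poly set" where
  "low d = {p. \<forall>i\<ge>d. coeff p i = 0}"

lemma low_bij: "bij_betw coeff (low d) (fvec d :: (nat \<Rightarrow> 'a::comm_monoid_add) set)"
proof (rule bij_betw_byWitness[where f' = "\<lambda>f. \<Sum>i<d. monom (f i) i"])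
  have *: "coeff (\<Sum>i<d. monom (f i) i) n = (if n < d then f n else 0)" for f :: "nat \<Rightarrow> 'a" and n
    by (simp add: coeff_sum coeff_monom)
  show "\<forall>a\<in>low d. (\<Sum>i<d. monom (coeff a i) i) = (a :: 'a poly)"
    by (auto simp: low_def poly_eq_iff * not_less)
  show "\<forall>a'\<in>fvec d. coeff (\<Sum>i<d. monom (a' i) i) = (a' :: nat \<Rightarrow> 'a)"
    by (auto simp: fun_eq_iff * seqs_def)
qed (auto simp: seqs_def low_def coeff_sum coeff_monom)

lemma card_low: "card (low d :: 'a::{comm_monoid_add,finite} poly set) = CARD('a) ^ d"
  by (simp add: bij_betw_same_card[OF low_bij] card_fvec)

lemma finite_low [simp]: "finite (low d :: 'a::{comm_monoid_add,finite} poly set)"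
  by (simp add: bij_betw_finite[OF low_bij])

lemma low_degree:
  assumes "d > 0" shows "p \<in> low d \<longleftrightarrow> degree p < d"
proof
  assume "p \<in> low d"
  then have "degree p \<le> d - 1"
    using assms by (intro degree_le) (auto simp: low_def)
  then show "degree p < d" using assms by simp
qed (auto simp: low_def coeff_eq_0)

lemma low_add: "p \<in> low d \<Longrightarrow> q \<in> low d \<Longrightarrow> p + q \<in> low d"
  and low_diff: "p \<in> low d \<Longrightarrow> q \<in> low d \<Longrightarrow> p - q \<in> low d"
  and low_zero: "0 \<in> low d" for p q :: "'a::ring poly"
  by (auto simp: low_def)

section \<open>Unit vectors and the action of matrices on tuples\<close>

definition unit_seq :: "nat \<Rightarrow> nat \<Rightarrow> 'b::zero_neq_one" where
  "unit_seq j = (\<lambda>i. if i = j then 1 else 0)"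

lemma unit_seq_fvec [simp]: "j < n \<Longrightarrow> unit_seq j \<in> fvec n"
  by (auto simp: unit_seq_def seqs_def)

text \<open>The cutoff at \<open>dim_row M\<close> keeps every value in \<open>fvec\<close>, even if
  the argument is not a tuple of matching length.\<close>

definition mat_apply :: "'r::comm_ring_1 mat \<Rightarrow> (nat \<Rightarrow> 'r) \<Rightarrow> nat \<Rightarrow> 'r" where
  "mat_apply M v = (\<lambda>i. if i < dim_row M then (\<Sum>j<dim_col M. M $$ (i,j) * v j) else 0)"

lemma mat_apply_fvec: "M \<in> carrier_mat n k \<Longrightarrow> mat_apply M v \<in> fvec n"
  by (auto simp: mat_apply_def seqs_def)

lemma mat_apply_add: "mat_apply M (v + w) = mat_apply M v + mat_apply M w"
  by (auto simp: mat_apply_def fun_eq_iff algebra_simps sum.distrib)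

lemma mat_apply_zero: "mat_apply M 0 = 0"
  by (auto simp: mat_apply_def fun_eq_iff)

lemma mat_apply_scale: "mat_apply M (\<lambda>i. c * v i) = (\<lambda>i. c * mat_apply M v i)"
  by (auto simp: mat_apply_def fun_eq_iff sum_distrib_left mult_ac)

lemma mat_apply_sum: "mat_apply M (\<Sum>a\<in>A. f a) = (\<Sum>a\<in>A. mat_apply M (f a))"
  using sum_comp_morphism[of "mat_apply M" f A, OF mat_apply_zero mat_apply_add] by (simp add: o_def)

lemma mat_apply_mult:
  assumes "A \<in> carrier_mat n k" "B \<in> carrier_mat k l"
  shows "mat_apply (A * B) v = mat_apply A (mat_apply B v)"
proof
  fix i
  have "(\<Sum>j<l. (\<Sum>h<k. A $$ (i,h) * B $$ (h,j)) * v j) = (\<Sum>h<k. A $$ (i,h) * (\<Sum>j<l. B $$ (h,j) * v j))"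
    by (simp add: sum_distrib_left sum_distrib_right mult.assoc) (rule sum.swap)
  then show "mat_apply (A * B) v i = mat_apply A (mat_apply B v) i"
    using assms by (auto simp: mat_apply_def scalar_prod_def atLeast0LessThan)
qed

lemma mat_apply_one: "v \<in> fvec n \<Longrightarrow> mat_apply (1\<^sub>m n) v = v"
  by (auto simp: mat_apply_def fun_eq_iff seqs_def if_distrib[where f = "\<lambda>x. x * _"] cong: if_cong)

lemma mat_apply_diag: "mat_apply (diag_rect n n fs) w = (\<lambda>i. if i < n then fs ! i * w i else 0)"
proof
  fix i
  have "(\<Sum>j<n. (if i = j then fs ! i else 0) * w j) = (\<Sum>j<n. if i = j then fs ! i * w i else 0)"
    by (rule sum.cong) auto
  then show "mat_apply (diag_rect n n fs) w i = (if i < n then fs ! i * w i else 0)"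
    by (simp add: mat_apply_def diag_rect_def)
qed

lemma mat_apply_unit: "M \<in> carrier_mat n k \<Longrightarrow> j < k \<Longrightarrow> mat_apply M (unit_seq j) = (\<lambda>i. if i < n then M $$ (i,j) else 0)"
  by (auto simp: mat_apply_def unit_seq_def fun_eq_iff if_distrib cong: if_cong)

lemma mat_eq_mvI:
  assumes "A \<in> carrier_mat n k" "B \<in> carrier_mat n k" "\<And>j. j < k \<Longrightarrow> mat_apply A (unit_seq j) = mat_apply B (unit_seq j)"
  shows "A = B"
proof (rule eq_matI)
  fix i j assume "i < dim_row B" "j < dim_col B"
  then show "A $$ (i,j) = B $$ (i,j)"
    using fun_cong[OF assms(3), of j i] assms(1,2) by (simp add: mat_apply_unit)
qed (use assms in auto)

lemma seq_decomp: "v \<in> fvec n \<Longrightarrow> v = (\<Sum>j<n. (\<lambda>i. v j * unit_seq j i))" for v :: "nat \<Rightarrow> 'r::comm_ring_1"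
  by (auto simp: fun_eq_iff sum_fun_apply unit_seq_def seqs_def if_distrib cong: if_cong)

text \<open>\<open>invertible_mat\<close> leaves the dimensions of the inverse open; comparing
  \<open>dim_col\<close> in the two identities determines them.\<close>

lemma invertible_mat_obtain:
  assumes "invertible_mat A" "A \<in> carrier_mat n n"
  obtains B where "B \<in> carrier_mat n n" "A * B = 1\<^sub>m n" "B * A = 1\<^sub>m n"
proof -
  obtain B where B: "A * B = 1\<^sub>m (dim_row A)" "B * A = 1\<^sub>m (dim_row B)"
    using assms unfolding invertible_mat_def inverts_mat_def by auto
  have "dim_col B = n" using arg_cong[OF B(1), of dim_col] assms by simp
  moreover have "dim_row B = n" using arg_cong[OF B(2), of dim_col] assms by simp
  ultimately show ?thesis using B assms that[of B] by auto
qed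

lemma invertible_matI:
  assumes "A \<in> carrier_mat n n" "B \<in> carrier_mat n n" "A * B = 1\<^sub>m n" "B * A = 1\<^sub>m n"
  shows "invertible_mat A"
  using assms unfolding invertible_mat_def inverts_mat_def by auto

section \<open>Presentations of an operator by polynomial matrices\<close>

text \<open>The operator is linear on the whole type, but only its restriction to the finite invariant
  subspace \<open>V\<close> matters.\<close>

locale fin_operator = vector_space s
  for s :: "'a::{field,finite} \<Rightarrow> 'v::ab_group_add \<Rightarrow> 'v" +
  fixes T :: "'v \<Rightarrow> 'v" and V :: "'v set"
  assumes T_add: "T (x + y) = T x + T y"
    and T_scale: "T (s c x) = s c (T x)"
    and V_sub: "subspace V"
    and V_T: "x \<in> V \<Longrightarrow> T x \<in> V"
    and V_fin: "finite V"
begin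

section \<open>The F[x]-module structure given by the operator\<close>

lemma T_zero [simp]: "T 0 = 0"
  using T_add[of 0 0] by simp

lemma V_0: "0 \<in> V" and V_add: "x \<in> V \<Longrightarrow> y \<in> V \<Longrightarrow> x + y \<in> V"
  and V_scale: "x \<in> V \<Longrightarrow> s c x \<in> V"
  and V_sum: "(\<And>i. i \<in> I \<Longrightarrow> f i \<in> V) \<Longrightarrow> sum f I \<in> V"
  using V_sub by (auto simp: subspace_0 subspace_add subspace_scale subspace_sum)

text \<open>p(T) v in Horner form: the action of F[x] for which x acts as \<open>T\<close>.\<close>

definition poly_act :: "'a poly \<Rightarrow> 'v \<Rightarrow> 'v" where
  "poly_act p v = fold_coeffs (\<lambda>a w. s a v + T w) p 0"

lemma poly_act_0 [simp]: "poly_act 0 v = 0"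
  by (simp add: poly_act_def)

lemma poly_act_pCons: "poly_act (pCons a p) v = s a v + T (poly_act p v)"
  \<comment> \<open>The exceptional case is \<open>pCons 0 0\<close>, whose coefficient list is
    empty.\<close>
  by (cases "p = 0 \<and> a = 0") (auto simp: poly_act_def)

lemma poly_act_1 [simp]: "poly_act 1 v = v"
  by (simp add: one_pCons poly_act_pCons)

lemma poly_act_const: "poly_act [:c:] v = s c v"
  by (simp add: poly_act_pCons)

lemma poly_act_X: "poly_act [:0,1:] v = T v"
  by (simp add: poly_act_pCons)

lemma poly_act_add: "poly_act (p + q) v = poly_act p v + poly_act q v"
proof (induction p arbitrary: q)
  case (pCons a p)
  obtain b q' where "q = pCons b q'" by (cases q)
  then show ?case
    by (simp add: poly_act_pCons pCons.IH T_add scale_left_distrib)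
qed simp

lemma poly_act_uminus: "poly_act (- p) v = - poly_act p v"
  using poly_act_add[of p "- p" v] by (simp add: eq_neg_iff_add_eq_0 add.commute)

lemma poly_act_diff: "poly_act (p - q) v = poly_act p v - poly_act q v"
  using poly_act_add[of p "- q" v] by (simp add: poly_act_uminus)

lemma poly_act_smult: "poly_act (Polynomial.smult c p) v = s c (poly_act p v)"
  by (induction p) (auto simp: poly_act_pCons scale_right_distrib T_scale)

lemma poly_act_mult: "poly_act (p * q) v = poly_act p (poly_act q v)"
  by (induction p) (auto simp: poly_act_pCons poly_act_add poly_act_smult)

lemma poly_act_monom: "poly_act (monom c i) v = s c ((T ^^ i) v)"
  by (induction i) (auto simp: monom_Suc poly_act_pCons T_scale monom_0)

lemma poly_act_sum: "poly_act (\<Sum>i\<in>I. f i) v = (\<Sum>i\<in>I. poly_act (f i) v)"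
  by (induction I rule: infinite_finite_induct) (auto simp: poly_act_add)

lemma poly_act_vadd: "poly_act p (v + w) = poly_act p v + poly_act p w"
  by (induction p) (auto simp: poly_act_pCons scale_right_distrib T_add algebra_simps)

lemma poly_act_vzero [simp]: "poly_act p 0 = 0"
  using poly_act_vadd[of p 0 0] by simp

lemma poly_act_vsum: "poly_act p (\<Sum>i\<in>I. f i) = (\<Sum>i\<in>I. poly_act p (f i))"
  by (induction I rule: infinite_finite_induct) (auto simp: poly_act_vadd)

lemma poly_act_V: "v \<in> V \<Longrightarrow> poly_act p v \<in> V"
  by (induction p) (auto simp: poly_act_pCons V_0 intro!: V_add V_scale V_T)

lemma poly_act_low: "p \<in> low d \<Longrightarrow> poly_act p v = (\<Sum>i<d. s (coeff p i) ((T ^^ i) v))"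
proof -
  assume "p \<in> low d"
  then have "p = (\<Sum>i<d. monom (coeff p i) i)"
    by (auto simp: low_def poly_eq_iff coeff_sum coeff_monom not_less)
  then show ?thesis
    by (metis (no_types, lifting) poly_act_monom poly_act_sum sum.cong)
qed

lemma Tpow_add: "(T ^^ i) (v + w) = (T ^^ i) v + (T ^^ i) w"
  by (induction i) (auto simp: T_add)

lemma Tpow_scale: "(T ^^ i) (s c v) = s c ((T ^^ i) v)"
  by (induction i) (auto simp: T_scale)

lemma Tpow_zero [simp]: "(T ^^ i) 0 = 0"
  by (induction i) auto

lemma Tpow_sum: "(T ^^ i) (\<Sum>j\<in>I. f j) = (\<Sum>j\<in>I. (T ^^ i) (f j))"
  by (induction I rule: infinite_finite_induct) (auto simp: Tpow_add)

lemma Tpow_V: "v \<in> V \<Longrightarrow> (T ^^ i) v \<in> V"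
  by (induction i) (auto intro: V_T)

text \<open>The F[x]-linear map from F[x]^m that sends the standard basis to \<open>X\<close>; its
  kernel is the module of relations among \<open>X\<close>.\<close>

definition gen_eval :: "nat \<Rightarrow> (nat \<Rightarrow> 'v) \<Rightarrow> (nat \<Rightarrow> 'a poly) \<Rightarrow> 'v" where
  "gen_eval m X u = (\<Sum>j<m. poly_act (u j) (X j))"

lemma gen_eval_add: "gen_eval m X (u + w) = gen_eval m X u + gen_eval m X w"
  by (simp add: gen_eval_def poly_act_add sum.distrib)

lemma gen_eval_diff: "gen_eval m X (u - w) = gen_eval m X u - gen_eval m X w"
  by (simp add: gen_eval_def poly_act_diff sum_subtractf)

lemma gen_eval_zero [simp]: "gen_eval m X 0 = 0"
  by (simp add: gen_eval_def)

lemma gen_eval_scale: "gen_eval m X (\<lambda>i. p * u i) = poly_act p (gen_eval m X u)"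
  by (simp add: gen_eval_def poly_act_mult poly_act_vsum)

lemma gen_eval_V: "X \<in> seqs m (\<lambda>_. V) \<Longrightarrow> gen_eval m X u \<in> V"
  by (auto simp: gen_eval_def seqs_def intro!: V_sum poly_act_V)

lemma gen_eval_unit: "j < m \<Longrightarrow> gen_eval m X (unit_seq j) = X j"
proof -
  assume "j < m"
  have "gen_eval m X (unit_seq j) = (\<Sum>i<m. if i = j then X i else 0)"
    unfolding gen_eval_def unit_seq_def by (rule sum.cong) auto
  then show ?thesis using \<open>j < m\<close> by simp
qed

text \<open>A combination of the columns of \<open>P\<close> evaluates to the same combination of
  the evaluated columns. Hence all of P F[x]^k consists of relations as soon as the columns
  do.\<close>

lemma gen_eval_mat_apply:
  assumes "P \<in> carrier_mat m k"
  shows "gen_eval m X (mat_apply P w) = gen_eval k (\<lambda>j. gen_eval m X (mat_apply P (unit_seq j))) w"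
proof -
  have "gen_eval m X (mat_apply P w) = (\<Sum>i<m. \<Sum>j<k. poly_act (P $$ (i,j) * w j) (X i))"
    using assms by (simp add: gen_eval_def mat_apply_def poly_act_sum)
  also have "\<dots> = (\<Sum>j<k. \<Sum>i<m. poly_act (w j) (poly_act (P $$ (i,j)) (X i)))"
    by (subst sum.swap) (simp add: mult.commute flip: poly_act_mult)
  also have "\<dots> = (\<Sum>j<k. poly_act (w j) (gen_eval m X (mat_apply P (unit_seq j))))"
    by (rule sum.cong) (auto simp: gen_eval_def mat_apply_unit[OF assms] poly_act_vsum)
  finally show ?thesis by (simp add: gen_eval_def[of k])
qed

text \<open>The vectors \<open>X 0, \<dots>, X (m - 1)\<close> generate \<open>V\<close> as an \<open>F[x]\<close>-module with relation module
  \<open>P F[x]\<^sup>m\<close>, so that \<open>V \<cong> F[x]\<^sup>m / P F[x]\<^sup>m\<close>.\<close>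

definition presents :: "nat \<Rightarrow> (nat \<Rightarrow> 'v) \<Rightarrow> 'a poly mat \<Rightarrow> bool" where
  "presents m X P \<longleftrightarrow> P \<in> carrier_mat m m \<and> X \<in> seqs m (\<lambda>_. V) \<and>
     (\<forall>v\<in>V. \<exists>u\<in>fvec m. gen_eval m X u = v) \<and>
     (\<forall>u\<in>fvec m. gen_eval m X u = 0 \<longleftrightarrow> (\<exists>w\<in>fvec m. u = mat_apply P w))"

lemma presents_carrier: "presents m X P \<Longrightarrow> P \<in> carrier_mat m m"
  and presents_seqs: "presents m X P \<Longrightarrow> X \<in> seqs m (\<lambda>_. V)"
  and presents_surj: "presents m X P \<Longrightarrow> v \<in> V \<Longrightarrow> \<exists>u\<in>fvec m. gen_eval m X u = v"
  and presents_ker: "presents m X P \<Longrightarrow> u \<in> fvec m \<Longrightarrow> gen_eval m X u = 0 \<longleftrightarrow> (\<exists>w\<in>fvec m. u = mat_apply P w)"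
  by (auto simp: presents_def)

text \<open>In A P B = Q the factor B only changes the basis of the relation module, while A amounts
  to a change of generators.\<close>

lemma presents_equiv:
  assumes "presents m X P" "equivalent_mat m m P Q"
  shows "\<exists>Y. presents m Y Q"
proof -
  from assms(2) obtain A B where A: "A \<in> carrier_mat m m" "invertible_mat A"
    and B: "B \<in> carrier_mat m m" "invertible_mat B" and Q: "A * P * B = Q"
    unfolding equivalent_mat_def by auto
  obtain A' where A': "A' \<in> carrier_mat m m" "A * A' = 1\<^sub>m m" "A' * A = 1\<^sub>m m"
    using invertible_mat_obtain[OF A(2,1)] .
  obtain B' where B': "B' \<in> carrier_mat m m" "B * B' = 1\<^sub>m m" "B' * B = 1\<^sub>m m"
    using invertible_mat_obtain[OF B(2,1)] .
  have P: "P \<in> carrier_mat m m" using assms(1) by (rule presents_carrier)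
  have AA': "mat_apply A (mat_apply A' u) = u" "mat_apply A' (mat_apply A u) = u" if "u \<in> fvec m" for u
    using that A A' by (simp_all add: mat_apply_one flip: mat_apply_mult[of _ m m _ m])
  have BB': "mat_apply B (mat_apply B' u) = u" if "u \<in> fvec m" for u
    using that B B' by (simp_all add: mat_apply_one flip: mat_apply_mult[of _ m m _ m])
  have Qmv: "mat_apply Q w = mat_apply A (mat_apply P (mat_apply B w))" for w
    using A B P unfolding Q[symmetric] by (simp add: mat_apply_mult[of _ m m _ m])
  \<comment> \<open>Evaluating at \<open>Y\<close> is evaluating at \<open>X\<close> after A^-1, so
    the relations among \<open>Y\<close> are A P F[x]^m = Q F[x]^m.\<close>
  define Y where "Y = (\<lambda>j. if j < m then gen_eval m X (mat_apply A' (unit_seq j)) else 0)"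
  have evY: "gen_eval m Y u = gen_eval m X (mat_apply A' u)" for u
    by (subst gen_eval_mat_apply[OF A'(1)]) (simp add: Y_def gen_eval_def[of m _ u])
  have "presents m Y Q"
    unfolding presents_def
  proof (intro conjI ballI)
    show "Q \<in> carrier_mat m m" using A B P Q by auto
    show "Y \<in> seqs m (\<lambda>_. V)"
      using gen_eval_V[OF presents_seqs[OF assms(1)]] by (auto simp: seqs_def Y_def)
    fix v assume "v \<in> V"
    then obtain u where u: "u \<in> fvec m" "gen_eval m X u = v"
      using presents_surj[OF assms(1)] by blast
    then show "\<exists>u\<in>fvec m. gen_eval m Y u = v"
      using A by (intro bexI[of _ "mat_apply A u"]) (simp_all add: evY AA' mat_apply_fvec)
  next
    fix u :: "nat \<Rightarrow> 'a poly" assume u: "u \<in> fvec m"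
    have "gen_eval m Y u = 0 \<longleftrightarrow> (\<exists>w\<in>fvec m. mat_apply A' u = mat_apply P w)"
      unfolding evY using A' by (intro presents_ker[OF assms(1)] mat_apply_fvec)
    also have "\<dots> \<longleftrightarrow> (\<exists>w\<in>fvec m. u = mat_apply Q w)"
    proof safe
      fix w :: "nat \<Rightarrow> 'a poly" assume w: "w \<in> fvec m" "mat_apply A' u = mat_apply P w"
      then show "\<exists>w\<in>fvec m. u = mat_apply Q w"
        using AA'(1)[OF u] B' by (intro bexI[of _ "mat_apply B' w"]) (auto simp: Qmv BB' mat_apply_fvec)
    next
      fix w :: "nat \<Rightarrow> 'a poly" assume w: "w \<in> fvec m" "u = mat_apply Q w"
      then show "\<exists>wa\<in>fvec m. mat_apply A' (mat_apply Q w) = mat_apply P wa"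
        using B P by (intro bexI[of _ "mat_apply B w"]) (auto simp: Qmv AA' mat_apply_fvec)
    qed
    finally show "gen_eval m Y u = 0 \<longleftrightarrow> (\<exists>w\<in>fvec m. u = mat_apply Q w)" .
  qed
  then show ?thesis by blast
qed

text \<open>A diagonal entry 1 makes a unit vector a relation, so the corresponding generator is 0
  and can be omitted. This takes the presentation of size md given by x I - A down to size
  m.\<close>

lemma presents_drop_ones:
  assumes "presents (k + m) X (diag_rect (k + m) (k + m) (replicate k 1 @ ps))"
  shows "presents m (\<lambda>j. X (k + j)) (diag_rect m m ps)"
proof -
  let ?D = "diag_rect (k + m) (k + m) (replicate k 1 @ ps)"
  have X0: "X i = 0" if "i < k" for i
  proof -
    have "unit_seq i = mat_apply ?D (unit_seq i)"
      using that by (auto simp: mat_apply_diag unit_seq_def fun_eq_iff nth_append)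
    then show ?thesis
      using presents_ker[OF assms, of "unit_seq i"] that unit_seq_fvec[of i "k + m"]
      by (auto simp: gen_eval_unit)
  qed
  have evX: "gen_eval (k + m) X u = gen_eval m (\<lambda>j. X (k + j)) (\<lambda>j. u (k + j))" for u
  proof -
    have "gen_eval (k + m) X u = (\<Sum>j<k. poly_act (u j) (X j)) + (\<Sum>j<m. poly_act (u (k + j)) (X (k + j)))"
      unfolding gen_eval_def by (induction m) (simp_all add: add.assoc)
    then show ?thesis by (simp add: X0 gen_eval_def)
  qed
  show ?thesis
    unfolding presents_def
  proof (intro conjI ballI)
    show "diag_rect m m ps \<in> carrier_mat m m" by (simp add: diag_rect_def)
    show "(\<lambda>j. X (k + j)) \<in> seqs m (\<lambda>_. V)"
      using presents_seqs[OF assms] by (auto simp: seqs_def)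
    fix v assume "v \<in> V"
    then obtain u where "u \<in> fvec (k + m)" "gen_eval (k + m) X u = v"
      using presents_surj[OF assms] by blast
    then show "\<exists>u\<in>fvec m. gen_eval m (\<lambda>j. X (k + j)) u = v"
      unfolding evX by (intro bexI[of _ "\<lambda>j. u (k + j)"]) (auto simp: seqs_def)
  next
    fix u :: "nat \<Rightarrow> 'a poly" assume u: "u \<in> fvec m"
    define U where "U = (\<lambda>i. if i < k then 0 else u (i - k))"
    have "U \<in> fvec (k + m)" using u by (auto simp: U_def seqs_def)
    then have *: "gen_eval m (\<lambda>j. X (k + j)) u = 0 \<longleftrightarrow> (\<exists>w\<in>fvec (k + m). U = mat_apply ?D w)"
      using presents_ker[OF assms, of U] by (simp add: evX U_def)
    show "gen_eval m (\<lambda>j. X (k + j)) u = 0 \<longleftrightarrow> (\<exists>w\<in>fvec m. u = mat_apply (diag_rect m m ps) w)"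
      unfolding *
    proof safe
      fix w :: "nat \<Rightarrow> 'a poly" assume w: "w \<in> fvec (k + m)" "U = mat_apply ?D w"
      have "u j = mat_apply (diag_rect m m ps) (\<lambda>j. w (k + j)) j" for j
        using fun_cong[OF w(2), of "k + j"] u by (auto simp: U_def mat_apply_diag nth_append seqs_def)
      then show "\<exists>w\<in>fvec m. u = mat_apply (diag_rect m m ps) w"
        using w(1) by (intro bexI[of _ "\<lambda>j. w (k + j)"]) (auto simp: seqs_def)
    next
      fix w :: "nat \<Rightarrow> 'a poly" assume w: "w \<in> fvec m" "u = mat_apply (diag_rect m m ps) w"
      then show "\<exists>w\<in>fvec (k + m). U = mat_apply ?D w"
        by (intro bexI[of _ "\<lambda>i. if i < k then 0 else w (i - k)"])
          (auto simp: seqs_def U_def mat_apply_diag nth_append fun_eq_iff)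
    qed
  qed
qed

end

section \<open>Counting ordered bases\<close>

context fin_operator
begin

definition scalar_comb :: "nat \<Rightarrow> (nat \<Rightarrow> 'v) \<Rightarrow> (nat \<Rightarrow> 'a) \<Rightarrow> 'v" where
  "scalar_comb k X c = (\<Sum>j<k. s (c j) (X j))"

definition gen_span :: "nat \<Rightarrow> (nat \<Rightarrow> 'v) \<Rightarrow> 'v set" where
  "gen_span k X = scalar_comb k X ` fvec k"

text \<open>Injectivity is the form of independence that yields the size q^k of the span at
  once.\<close>

definition indep :: "nat \<Rightarrow> (nat \<Rightarrow> 'v) \<Rightarrow> bool" where
  "indep k X \<longleftrightarrow> inj_on (scalar_comb k X) (fvec k)"

lemma scalar_comb_add: "scalar_comb k X (b + c) = scalar_comb k X b + scalar_comb k X c"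
  by (simp add: scalar_comb_def scale_left_distrib sum.distrib)

lemma scalar_comb_diff: "scalar_comb k X (b - c) = scalar_comb k X b - scalar_comb k X c"
  by (simp add: scalar_comb_def scale_left_diff_distrib sum_subtractf)

lemma scalar_comb_scale: "scalar_comb k X (\<lambda>i. a * c i) = s a (scalar_comb k X c)"
  by (simp add: scalar_comb_def scale_sum_right)

lemma scalar_comb_zero [simp]: "scalar_comb k X 0 = 0"
  by (simp add: scalar_comb_def)

lemma scalar_comb_unit: "j < k \<Longrightarrow> scalar_comb k X (unit_seq j) = X j"
proof -
  assume "j < k"
  have "scalar_comb k X (unit_seq j) = (\<Sum>i<k. if i = j then X i else 0)"
    unfolding scalar_comb_def unit_seq_def by (rule sum.cong) auto
  then show ?thesis using \<open>j < k\<close> by simp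
qed

lemma scalar_comb_in:
  assumes "subspace W" "X \<in> seqs k (\<lambda>_. W)"
  shows "scalar_comb k X c \<in> W"
  unfolding scalar_comb_def
  by (intro subspace_sum[OF assms(1)] subspace_scale[OF assms(1)]) (use assms(2) in \<open>auto simp: seqs_def\<close>)

lemma gen_span_subspace: "subspace (gen_span k X)"
  unfolding subspace_def
proof (intro conjI ballI allI)
  show "0 \<in> gen_span k X" unfolding gen_span_def by (rule image_eqI[of _ _ 0]) (simp_all only: scalar_comb_zero fvec_zero)
  fix x y assume "x \<in> gen_span k X" "y \<in> gen_span k X"
  then obtain b c where "b \<in> fvec k" "x = scalar_comb k X b" "c \<in> fvec k" "y = scalar_comb k X c"
    unfolding gen_span_def by blast
  then show "x + y \<in> gen_span k X"
    unfolding gen_span_def by (intro image_eqI[of _ _ "b + c"] fvec_add) (simp_all only: scalar_comb_add)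
next
  fix a x assume "x \<in> gen_span k X"
  then obtain b where "b \<in> fvec k" "x = scalar_comb k X b"
    unfolding gen_span_def by blast
  then show "s a x \<in> gen_span k X"
    unfolding gen_span_def by (intro image_eqI[of _ _ "\<lambda>i. a * b i"] fvec_scale) (simp_all only: scalar_comb_scale)
qed

lemma gen_span_unit: "j < k \<Longrightarrow> X j \<in> gen_span k X"
  unfolding gen_span_def using scalar_comb_unit unit_seq_fvec by (metis imageI)

lemma gen_span_subset: "subspace W \<Longrightarrow> X \<in> seqs k (\<lambda>_. W) \<Longrightarrow> gen_span k X \<subseteq> W"
  by (auto simp: gen_span_def scalar_comb_in)

lemma card_gen_span: "indep k X \<Longrightarrow> card (gen_span k X) = CARD('a) ^ k"
  by (simp add: gen_span_def indep_def card_image card_fvec)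

lemma indep_iff: "indep k X \<longleftrightarrow> (\<forall>c\<in>fvec k. scalar_comb k X c = 0 \<longrightarrow> c = 0)"
proof
  assume "indep k X"
  then show "\<forall>c\<in>fvec k. scalar_comb k X c = 0 \<longrightarrow> c = 0"
    using fvec_zero scalar_comb_zero unfolding indep_def inj_on_def by metis
next
  assume *: "\<forall>c\<in>fvec k. scalar_comb k X c = 0 \<longrightarrow> c = 0"
  show "indep k X"
    unfolding indep_def
  proof (rule inj_onI)
    fix b c assume "b \<in> fvec k" "c \<in> fvec k" "scalar_comb k X b = scalar_comb k X c"
    then have "scalar_comb k X (b - c) = 0" "b - c \<in> fvec k"
      using fvec_diff[of b k c] by (simp_all only: scalar_comb_diff) simp
    then have "b - c = 0" using * by blast
    then show "b = c" by (simp only: right_minus_eq)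
  qed
qed

lemma scalar_comb_Suc: "scalar_comb (Suc k) X c = scalar_comb k (X(k := 0)) c + s (c k) (X k)"
  by (simp add: scalar_comb_def)

text \<open>For a tuple of length \<open>Suc k\<close>, \<open>X(k := 0)\<close> is the tuple of its
  first \<open>k\<close> vectors in the zero-padded encoding.\<close>

lemma indep_Suc: "indep (Suc k) X \<longleftrightarrow> indep k (X(k := 0)) \<and> X k \<notin> gen_span k (X(k := 0))"
proof safe
  assume *: "indep (Suc k) X"
  show "indep k (X(k := 0))"
    unfolding indep_iff
  proof (intro ballI impI)
    fix c :: "nat \<Rightarrow> 'a" assume c: "c \<in> fvec k" "scalar_comb k (X(k := 0)) c = 0"
    then have "scalar_comb (Suc k) X c = 0" by (simp add: scalar_comb_Suc seqs_def)
    moreover have "c \<in> fvec (Suc k)" using c by (auto simp: seqs_def)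
    ultimately show "c = 0" using * by (simp only: indep_iff)
  qed
  assume "X k \<in> gen_span k (X(k := 0))"
  then obtain c where c: "c \<in> fvec k" "X k = scalar_comb k (X(k := 0)) c"
    by (auto simp: gen_span_def)
  \<comment> \<open>The coefficient -1 at \<open>k\<close> turns the expression of
    \<open>X k\<close> into a nontrivial relation; \<open>scalar_comb k\<close> does not see that
    index.\<close>
  have "scalar_comb k (X(k := 0)) (c(k := -1)) = scalar_comb k (X(k := 0)) c"
    by (simp add: scalar_comb_def)
  then have "scalar_comb (Suc k) X (c(k := -1)) = 0"
    using c by (simp add: scalar_comb_Suc)
  moreover have "c(k := -1) \<in> fvec (Suc k)" using c by (auto simp: seqs_def)
  ultimately have "c(k := -1) = 0" using * by (simp only: indep_iff)
  then have "(c(k := -1)) k = 0" by (simp only: zero_fun_apply)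
  then show False by simp
next
  assume 1: "indep k (X(k := 0))" and 2: "X k \<notin> gen_span k (X(k := 0))"
  show "indep (Suc k) X"
    unfolding indep_iff
  proof (intro ballI impI)
    fix c :: "nat \<Rightarrow> 'a" assume c: "c \<in> fvec (Suc k)" "scalar_comb (Suc k) X c = 0"
    define c0 where "c0 = c(k := 0)"
    have k: "scalar_comb k (X(k := 0)) c = scalar_comb k (X(k := 0)) c0"
      by (simp add: scalar_comb_def c0_def)
    have c': "c0 \<in> fvec k" using c(1) by (auto simp: seqs_def c0_def)
    have "c k = 0"
    proof (rule ccontr)
      assume "c k \<noteq> 0"
      have "s (c k) (X k) = - scalar_comb k (X(k := 0)) c0"
        using c(2) k by (simp add: scalar_comb_Suc eq_neg_iff_add_eq_0 add.commute)
      then have "s (inverse (c k)) (s (c k) (X k)) = s (- inverse (c k)) (scalar_comb k (X(k := 0)) c0)"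
        by simp
      then have "X k = scalar_comb k (X(k := 0)) (\<lambda>i. - inverse (c k) * c0 i)"
        using \<open>c k \<noteq> 0\<close> by (simp only: scalar_comb_scale) simp
      then show False
        using 2 fvec_scale[OF c'] unfolding gen_span_def by blast
    qed
    moreover from this have "scalar_comb k (X(k := 0)) c0 = 0"
      using c(2) k by (simp add: scalar_comb_Suc)
    with 1 c' have "c0 = 0" by (simp only: indep_iff)
    ultimately show "c = 0" by (metis c0_def fun_upd_triv)
  qed
qed

text \<open>The vector at position \<open>k\<close> has to avoid the span, of size q^k, of the
  preceding ones. Truncated subtraction is harmless: for \<open>k > N\<close> the factor with
  \<open>i = N\<close> is 0, and there are no independent tuples.\<close>

lemma count_indep:
  assumes W: "subspace W" "finite W" "card W = CARD('a) ^ N"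
  shows "card {X \<in> seqs k (\<lambda>_. W). indep k X} = (\<Prod>i<k. CARD('a) ^ N - CARD('a) ^ i)"
proof (induction k)
  case 0
  have "{X \<in> seqs 0 (\<lambda>_. W). indep 0 X} = {0}"
    by (auto simp: seqs_def indep_def inj_on_def fun_eq_iff)
  then show ?case by simp
next
  case (Suc k)
  let ?I = "\<lambda>k. {X \<in> seqs k (\<lambda>_. W). indep k X}"
  have fin: "finite (?I k)" using W by (simp add: finite_seqs)
  have "bij_betw (\<lambda>X. (X(k := 0), X k)) (?I (Suc k)) (Sigma (?I k) (\<lambda>X. W - gen_span k X))"
  proof (rule bij_betw_byWitness[where f' = "\<lambda>(X, w). X(k := w)"])
    show "(\<lambda>X. (X(k := 0), X k)) ` ?I (Suc k) \<subseteq> Sigma (?I k) (\<lambda>X. W - gen_span k X)"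
      by (auto simp: indep_Suc seqs_def less_Suc_eq)
    show "(\<lambda>(X, w). X(k := w)) ` Sigma (?I k) (\<lambda>X. W - gen_span k X) \<subseteq> ?I (Suc k)"
    proof clarsimp
      fix X w assume X: "X \<in> seqs k (\<lambda>_. W)" "indep k X" and w: "w \<in> W" "w \<notin> gen_span k X"
      have "X(k := 0) = X" using X(1) by (auto simp: seqs_def fun_eq_iff)
      then show "X(k := w) \<in> seqs (Suc k) (\<lambda>_. W) \<and> indep (Suc k) (X(k := w))"
        using X w by (auto simp: indep_Suc seqs_def less_Suc_eq)
    qed
  qed (auto simp: seqs_def fun_eq_iff)
  then have "card (?I (Suc k)) = (\<Sum>X\<in>?I k. card (W - gen_span k X))"
    using W fin by (simp add: bij_betw_same_card card_SigmaI)
  also have "\<dots> = (\<Sum>X\<in>?I k. CARD('a) ^ N - CARD('a) ^ k)"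
  proof (rule sum.cong[OF refl])
    fix X assume "X \<in> ?I k"
    then have "gen_span k X \<subseteq> W" "card (gen_span k X) = CARD('a) ^ k"
      using gen_span_subset[OF W(1)] card_gen_span by auto
    then show "card (W - gen_span k X) = CARD('a) ^ N - CARD('a) ^ k"
      using W by (simp add: card_Diff_subset finite_subset)
  qed
  also have "\<dots> = (\<Prod>i<Suc k. CARD('a) ^ N - CARD('a) ^ i)"
    using Suc.IH by simp
  finally show ?case .
qed

lemma card_field_ge_2: "CARD('a) \<ge> 2"
proof -
  have "card {0, 1 :: 'a} \<le> CARD('a)" by (rule card_mono) auto
  then show ?thesis by simp
qed

lemma gamma_pos: "(\<Prod>i<k. CARD('a) ^ k - CARD('a) ^ i) > 0"
  using card_field_ge_2 by (intro prod_pos) (auto simp: power_strict_increasing)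

text \<open>Existence by counting: the number of independent \<open>N\<close>-tuples is positive,
  and each of them spans \<open>W\<close> because its span has the size of \<open>W\<close>.\<close>

lemma exists_basis:
  assumes W: "subspace W" "finite W" "card W = CARD('a) ^ N"
  shows "\<exists>X\<in>seqs N (\<lambda>_. W). bij_betw (scalar_comb N X) (fvec N) W"
proof -
  have "{X \<in> seqs N (\<lambda>_. W). indep N X} \<noteq> {}"
    using count_indep[OF W, of N] gamma_pos[of N] by (metis card.empty less_irrefl)
  then obtain X where X: "X \<in> seqs N (\<lambda>_. W)" "indep N X" by auto
  have "gen_span N X = W"
    using W card_gen_span[OF X(2)] by (intro card_subset_eq gen_span_subset X) auto
  then show ?thesis
    using X unfolding gen_span_def indep_def bij_betw_def by auto
qed

text \<open>When \<open>card V = q\<^sup>m\<^sup>d\<close>, surjectivity forces bijectivity, so that the \<open>T\<^sup>i X\<^sub>j\<close> with \<open>i < d\<close>, \<open>j < m\<close>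
  form a basis of \<open>V\<close> and \<open>X\<close> is an ordered basis of a splitting subspace.\<close>

definition splitting_gens :: "nat \<Rightarrow> nat \<Rightarrow> (nat \<Rightarrow> 'v) \<Rightarrow> bool" where
  "splitting_gens m d X \<longleftrightarrow> X \<in> seqs m (\<lambda>_. V) \<and> (\<forall>v\<in>V. \<exists>u\<in>seqs m (\<lambda>_. low d). gen_eval m X u = v)"

lemma splitting_gens_bij:
  assumes "card V = CARD('a) ^ (m * d)" "splitting_gens m d X"
  shows "bij_betw (gen_eval m X) (seqs m (\<lambda>_. low d)) V"
proof -
  have im: "gen_eval m X ` seqs m (\<lambda>_. low d) = V"
  proof
    show "gen_eval m X ` seqs m (\<lambda>_. low d) \<subseteq> V"
      using assms(2) by (auto simp: splitting_gens_def gen_eval_V)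
    show "V \<subseteq> gen_eval m X ` seqs m (\<lambda>_. low d)"
    proof
      fix v assume "v \<in> V"
      then obtain u where "u \<in> seqs m (\<lambda>_. low d)" "gen_eval m X u = v"
        using assms(2) unfolding splitting_gens_def by blast
      then show "v \<in> gen_eval m X ` seqs m (\<lambda>_. low d)" by (intro image_eqI[of _ _ u]) auto
    qed
  qed
  moreover have "card (seqs m (\<lambda>_. low d :: 'a poly set)) = card V"
    by (simp add: card_seqs card_low assms(1) power_mult mult.commute)
  ultimately show ?thesis
    unfolding bij_betw_def using eq_card_imp_inj_on[of "seqs m (\<lambda>_. low d)" "gen_eval m X"]
    by (auto simp: finite_seqs)
qed

text \<open>Since \<open>d > 0\<close>, constant polynomials lie in \<open>low d\<close>, so
  \<open>scalar_comb\<close> is a restriction of the injective map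
  \<open>gen_eval m X\<close>.\<close>

lemma splitting_gens_indep:
  assumes "card V = CARD('a) ^ (m * d)" "splitting_gens m d X" "d > 0"
  shows "indep m X"
  unfolding indep_def
proof (rule inj_onI)
  have eq: "scalar_comb m X c = gen_eval m X (\<lambda>j. [:c j:])" for c
    by (simp add: scalar_comb_def gen_eval_def poly_act_const)
  have mem: "(\<lambda>j. [:c j:]) \<in> seqs m (\<lambda>_. low d)" if "c \<in> fvec m" for c :: "nat \<Rightarrow> 'a"
    using that \<open>d > 0\<close> by (auto simp: seqs_def low_degree)
  fix b c :: "nat \<Rightarrow> 'a" assume "b \<in> fvec m" "c \<in> fvec m" "scalar_comb m X b = scalar_comb m X c"
  then have "(\<lambda>j. [:b j:]) = (\<lambda>j. [:c j:])"
    using splitting_gens_bij[OF assms(1,2)] mem unfolding eq bij_betw_def by (auto dest: inj_onD)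
  then show "b = c" by (simp add: fun_eq_iff)
qed

text \<open>Regrouping by powers of x: the coefficients at x^i give the component in T^i W, where W
  is the span of \<open>X\<close>.\<close>

lemma gen_eval_low:
  assumes "u \<in> seqs m (\<lambda>_. low d)"
  shows "gen_eval m X u = (\<Sum>i<d. (T ^^ i) (scalar_comb m X (\<lambda>j. coeff (u j) i)))"
proof -
  have "gen_eval m X u = (\<Sum>j<m. \<Sum>i<d. s (coeff (u j) i) ((T ^^ i) (X j)))"
    unfolding gen_eval_def using assms by (intro sum.cong) (auto simp: seqs_def poly_act_low)
  also have "\<dots> = (\<Sum>i<d. \<Sum>j<m. s (coeff (u j) i) ((T ^^ i) (X j)))"
    by (rule sum.swap)
  finally show ?thesis
    by (simp add: scalar_comb_def Tpow_sum Tpow_scale)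
qed

lemma exists_low_of_gen_span:
  assumes "\<And>i. i < d \<Longrightarrow> w i \<in> gen_span m X"
  shows "\<exists>u\<in>seqs m (\<lambda>_. low d). (\<forall>i<d. scalar_comb m X (\<lambda>j. coeff (u j) i) = w i) \<and>
    gen_eval m X u = (\<Sum>i<d. (T ^^ i) (w i))"
proof -
  have "\<forall>i. \<exists>c. i < d \<longrightarrow> c \<in> fvec m \<and> w i = scalar_comb m X c" using assms unfolding gen_span_def by blast
  then obtain c where c: "\<And>i. i < d \<Longrightarrow> c i \<in> fvec m \<and> w i = scalar_comb m X (c i)" by metis
  define u where "u = (\<lambda>j. \<Sum>i<d. monom (c i j) i)"
  have u: "u \<in> seqs m (\<lambda>_. low d)"
    using c by (auto simp: u_def seqs_def low_def coeff_sum coeff_monom)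
  have "scalar_comb m X (\<lambda>j. coeff (u j) i) = w i" if "i < d" for i
    using c[OF that] that by (simp add: u_def coeff_sum coeff_monom)
  then show ?thesis using gen_eval_low[OF u] u by (intro bexI[of _ u]) auto
qed

text \<open>The right-hand side sees \<open>X\<close> only through its span, so all ordered bases of
  a subspace are splitting generators as soon as one is.\<close>

lemma splitting_gens_iff_gen_span:
  assumes "X \<in> seqs m (\<lambda>_. V)"
  shows "splitting_gens m d X \<longleftrightarrow> (\<forall>v\<in>V. \<exists>w. (\<forall>i<d. w i \<in> gen_span m X) \<and> v = (\<Sum>i<d. (T ^^ i) (w i)))"
    (is "_ \<longleftrightarrow> (\<forall>v\<in>V. ?P v)")
proof -
  have "(\<exists>u\<in>seqs m (\<lambda>_. low d). gen_eval m X u = v) \<longleftrightarrow> ?P v" for v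
  proof safe
    fix u :: "nat \<Rightarrow> 'a poly" assume u: "u \<in> seqs m (\<lambda>_. low d)"
    then show "?P (gen_eval m X u)"
      by (intro exI[of _ "\<lambda>i. scalar_comb m X (\<lambda>j. coeff (u j) i)"])
        (auto simp: gen_eval_low gen_span_def seqs_def)
  next
    fix w assume "\<forall>i<d. w i \<in> gen_span m X"
    then show "\<exists>u\<in>seqs m (\<lambda>_. low d). gen_eval m X u = (\<Sum>i<d. (T ^^ i) (w i))"
      using exists_low_of_gen_span[of d w m X] by blast
  qed
  then show ?thesis using assms by (simp add: splitting_gens_def)
qed

lemma finite_splitting_gens: "finite {X. splitting_gens m d X}"
  by (rule finite_subset[OF _ finite_seqs[of m "\<lambda>_. V"]]) (auto simp: splitting_gens_def V_fin)

text \<open>The fibre of \<open>gen_span m\<close> over a subspace consists of all its ordered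
  bases, and their number depends only on m and q.\<close>

lemma count_splitting_gens:
  assumes "card V = CARD('a) ^ (m * d)" "d > 0"
  shows "card {X. splitting_gens m d X} = (\<Prod>i<m. CARD('a) ^ m - CARD('a) ^ i) * card (gen_span m ` {X. splitting_gens m d X})"
proof -
  let ?G = "{X. splitting_gens m d X}"
  have "card {X \<in> ?G. gen_span m X = W} = (\<Prod>i<m. CARD('a) ^ m - CARD('a) ^ i)" if W: "W \<in> gen_span m ` ?G" for W
  proof -
    from W obtain X0 where X0: "splitting_gens m d X0" "W = gen_span m X0" by auto
    have WV: "W \<subseteq> V" using X0 gen_span_subset[OF V_sub] by (auto simp: splitting_gens_def)
    have sub: "subspace W" unfolding X0 by (rule gen_span_subspace)
    have card: "card W = CARD('a) ^ m" unfolding X0 by (rule card_gen_span[OF splitting_gens_indep[OF assms(1) X0(1) assms(2)]])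
    have fin: "finite W" using WV V_fin by (rule finite_subset)
    have "{X \<in> ?G. gen_span m X = W} = {X \<in> seqs m (\<lambda>_. W). indep m X}"
    proof (intro subset_antisym subsetI)
      fix X assume "X \<in> {X \<in> ?G. gen_span m X = W}"
      then have X: "splitting_gens m d X" "gen_span m X = W" by auto
      have "X \<in> seqs m (\<lambda>_. W)"
        using X gen_span_unit[of _ m X] by (auto simp: seqs_def splitting_gens_def)
      then show "X \<in> {X \<in> seqs m (\<lambda>_. W). indep m X}"
        using splitting_gens_indep[OF assms(1) X(1) assms(2)] by simp
    next
      fix X assume "X \<in> {X \<in> seqs m (\<lambda>_. W). indep m X}"
      then have X: "X \<in> seqs m (\<lambda>_. W)" "indep m X" by auto
      have gen_span: "gen_span m X = W"
        using card card_gen_span[OF X(2)] by (intro card_subset_eq gen_span_subset sub fin X) auto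
      have XV: "X \<in> seqs m (\<lambda>_. V)" using X(1) WV by (auto simp: seqs_def)
      have X0V: "X0 \<in> seqs m (\<lambda>_. V)" using X0(1) by (auto simp: splitting_gens_def)
      have "splitting_gens m d X"
        using X0(1) unfolding splitting_gens_iff_gen_span[OF XV] splitting_gens_iff_gen_span[OF X0V] gen_span X0(2) .
      with gen_span show "X \<in> {X \<in> ?G. gen_span m X = W}" by simp
    qed
    then show ?thesis using count_indep[OF sub fin card] by simp
  qed
  then show ?thesis
    using sum.image_gen[OF finite_splitting_gens, of "\<lambda>_. 1 :: nat" m d "gen_span m"] by (simp add: mult.commute)
qed

end

section \<open>Monic matrix polynomials\<close>

text \<open>With the converse that follows, this recasts membership as a condition on entries in
  which the coefficient matrices no longer occur.\<close>

lemma monic_mat_polysD: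
  assumes "P \<in> monic_mat_polys m m d"
  shows "P \<in> carrier_mat m m" "i < m \<Longrightarrow> j < m \<Longrightarrow> P $$ (i,j) - (if i = j then monom 1 d else 0) \<in> low d"
  using assms by (auto simp: monic_mat_polys_def low_def coeff_sum coeff_monom)

lemma monic_mat_polysI:
  assumes "P \<in> carrier_mat m m"
    and "\<And>i j. i < m \<Longrightarrow> j < m \<Longrightarrow> P $$ (i,j) - (if i = j then monom 1 d else 0) \<in> low d"
  shows "P \<in> monic_mat_polys m m d"
proof -
  let ?C = "\<lambda>l. mat m m (\<lambda>(i,j). coeff (P $$ (i,j)) l)"
  have "P $$ (i,j) = monom (if i = j then 1 else 0) d + (\<Sum>l<d. monom (?C l $$ (i,j)) l)"
    if ij: "i < m" "j < m" for i j
  proof (rule poly_eqI)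
    fix n
    have "coeff (P $$ (i,j) - (if i = j then monom 1 d else 0)) n = 0" if "n \<ge> d"
      using assms(2)[OF ij] that by (auto simp: low_def)
    then have "coeff (P $$ (i,j)) n = (if n = d \<and> i = j then 1 else 0)" if "n \<ge> d"
      using that by (cases "i = j") (auto simp: coeff_monom)
    then show "coeff (P $$ (i,j)) n
        = coeff (monom (if i = j then 1 else 0) d + (\<Sum>l<d. monom (?C l $$ (i,j)) l)) n"
      using ij by (cases "n < d") (auto simp: coeff_sum coeff_monom)
  qed
  then show ?thesis
    unfolding monic_mat_polys_def using assms(1)
    by (intro CollectI exI[of _ ?C]) (auto intro!: eq_matI)
qed

lemma low_const_mult: "p \<in> low d \<Longrightarrow> p * [:c:] \<in> low d" for p :: "'a::field poly"
  by (simp add: low_def mult.commute[of p])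

lemma low_sum: "(\<And>i. i \<in> I \<Longrightarrow> f i \<in> low d) \<Longrightarrow> sum f I \<in> low d" for f :: "_ \<Rightarrow> 'a::field poly"
  by (auto simp: low_def coeff_sum)

lemma zero_seqs_low: "(0 :: nat \<Rightarrow> 'a::ring poly) \<in> seqs m (\<lambda>_. low d)"
  by (auto simp: seqs_def low_zero)

text \<open>The set \<open>D\<close> of vectors that admit a division contains all vectors of low
  degree and is closed under addition and under multiplication by x. Constant multiples of unit
  vectors have low degree, so \<open>D\<close> is everything.\<close>

lemma monic_mat_division:
  fixes P :: "'a::field poly mat"
  assumes P: "P \<in> monic_mat_polys m m d" and "d > 0" and u: "u \<in> fvec m"
  shows "\<exists>w\<in>fvec m. \<exists>r\<in>seqs m (\<lambda>_. low d). u = mat_apply P w + r"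
proof -
  define D where "D = {u. \<exists>w\<in>fvec m. \<exists>r\<in>seqs m (\<lambda>_. low d). u = mat_apply P w + r}"
  have D_add: "u + u' \<in> D" if u: "u \<in> D" and u': "u' \<in> D" for u u'
  proof -
    obtain w r where 1: "w \<in> fvec m" "r \<in> seqs m (\<lambda>_. low d)" "u = mat_apply P w + r"
      using u unfolding D_def by blast
    obtain w' r' where 2: "w' \<in> fvec m" "r' \<in> seqs m (\<lambda>_. low d)" "u' = mat_apply P w' + r'"
      using u' unfolding D_def by blast
    have "w + w' \<in> fvec m" using 1 2 by (intro fvec_add)
    moreover have "r + r' \<in> seqs m (\<lambda>_. low d)" using 1 2 by (auto simp: seqs_def low_add)
    moreover have "u + u' = mat_apply P (w + w') + (r + r')"
      unfolding 1 2 mat_apply_add by (simp only: add_ac)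
    ultimately show ?thesis unfolding D_def by blast
  qed
  have D_low: "r \<in> D" if "r \<in> seqs m (\<lambda>_. low d)" for r
  proof -
    have "r = mat_apply P 0 + r" by (simp only: mat_apply_zero add_0)
    moreover have "0 \<in> fvec m" by (auto simp: seqs_def)
    ultimately show ?thesis using that unfolding D_def by blast
  qed
  have D_x: "(\<lambda>i. [:0,1:] * u i) \<in> D" if u: "u \<in> D" for u
  proof -
    obtain w r where 1: "w \<in> fvec m" "r \<in> seqs m (\<lambda>_. low d)" "u = mat_apply P w + r"
      using u unfolding D_def by blast
    \<comment> \<open>Multiplying the remainder by x can create a term of degree d; \<open>c\<close>
      is its coefficient vector. As P is x^d I plus lower terms, subtracting P c removes that term,
      and the quotient grows by c.\<close>
    define c where "c = (\<lambda>j. if j < m then coeff (r j) (d - 1) else 0)"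
    define w' where "w' = (\<lambda>i. [:0,1:] * w i) + (\<lambda>j. [:c j:])"
    have "w' \<in> fvec m" using 1 by (auto simp: seqs_def w'_def c_def)
    moreover define r' where "r' = (\<lambda>i. [:0,1:] * r i) - mat_apply P (\<lambda>j. [:c j:])"
    have "r' i \<in> low d" if "i < m" for i
    proof -
      have "mat_apply P (\<lambda>j. [:c j:]) i = (\<Sum>j<m. P $$ (i,j) * [:c j:])"
        using monic_mat_polysD(1)[OF P] \<open>i < m\<close> by (simp add: mat_apply_def)
      also have "\<dots> = (\<Sum>j<m. (P $$ (i,j) - (if i = j then monom 1 d else 0)) * [:c j:])
          + (\<Sum>j<m. (if i = j then monom 1 d * [:c j:] else 0))"
        by (subst sum.distrib[symmetric], rule sum.cong) (auto simp: algebra_simps)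
      also have "(\<Sum>j<m. (if i = j then monom 1 d * [:c j:] else 0)) = monom (c i) d"
        using \<open>i < m\<close> by (simp add: smult_monom mult.commute)
      finally have "r' i = ([:0,1:] * r i - monom (c i) d)
          - (\<Sum>j<m. (P $$ (i,j) - (if i = j then monom 1 d else 0)) * [:c j:])"
        by (simp add: r'_def)
      \<comment> \<open>In degree d the two terms cancel by the choice of \<open>c\<close>; above d
        both vanish.\<close>
      moreover have "[:0,1:] * r i - monom (c i) d \<in> low d"
      proof -
        have "coeff ([:0,1:] * r i - monom (c i) d) n = 0" if "n \<ge> d" for n
        proof (cases "n = d")
          case True
          then show ?thesis using \<open>d > 0\<close> \<open>i < m\<close>
            by (cases d) (auto simp: c_def coeff_monom coeff_pCons)
        next
          case False
          then show ?thesis using that \<open>d > 0\<close> \<open>i < m\<close> seqsD(1)[OF 1(2)]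
            by (cases n) (auto simp: coeff_monom coeff_pCons low_def)
        qed
        then show ?thesis by (simp add: low_def)
      qed
      moreover have "(\<Sum>j<m. (P $$ (i,j) - (if i = j then monom 1 d else 0)) * [:c j:]) \<in> low d"
        using \<open>i < m\<close> by (intro low_sum low_const_mult monic_mat_polysD(2)[OF P]) auto
      ultimately show ?thesis by (simp only: low_diff)
    qed
    then have "r' \<in> seqs m (\<lambda>_. low d)"
      using 1 mat_apply_fvec[OF monic_mat_polysD(1)[OF P]] by (auto simp: seqs_def r'_def)
    moreover have "(\<lambda>i. [:0,1:] * u i) = mat_apply P w' + r'"
    proof -
      have "(\<lambda>i. [:0,1:] * u i) = (\<lambda>i. [:0,1:] * mat_apply P w i) + (\<lambda>i. [:0,1:] * r i)"
        unfolding 1 by (simp add: fun_eq_iff ring_distribs)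
      also have "\<dots> = mat_apply P w' + r'"
        unfolding w'_def r'_def mat_apply_add mat_apply_scale by (simp only: algebra_simps)
      finally show ?thesis .
    qed
    ultimately show ?thesis unfolding D_def by blast
  qed
  \<comment> \<open>Induction along \<open>pCons a p\<close> = a + x p uses exactly the two closure
    properties.\<close>
  have D_unit: "(\<lambda>i. p * unit_seq j i) \<in> D" if "j < m" for p j
  proof (induction p)
    case 0
    have "(0 :: nat \<Rightarrow> 'a poly) \<in> D" by (rule D_low) (auto simp: seqs_def low_zero)
    then show ?case by (simp add: zero_fun_def)
  next
    case (pCons a p)
    have "(\<lambda>i. [:a:] * unit_seq j i) \<in> D"
      using that \<open>d > 0\<close> by (intro D_low) (auto simp: seqs_def unit_seq_def low_degree)
    then have "(\<lambda>i. [:a:] * unit_seq j i) + (\<lambda>i. [:0,1:] * (p * unit_seq j i)) \<in> D"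
      by (intro D_add D_x pCons.IH)
    also have "(\<lambda>i. [:a:] * unit_seq j i) + (\<lambda>i. [:0,1:] * (p * unit_seq j i)) = (\<lambda>i. pCons a p * unit_seq j i)"
      by (auto simp: fun_eq_iff unit_seq_def)
    finally show ?case .
  qed
  have D_sum: "(\<Sum>j\<in>J. f j) \<in> D" if "\<And>j. j \<in> J \<Longrightarrow> f j \<in> D" "finite J" for J :: "nat set" and f
    using that(2,1)
  proof (induction J)
    case empty
    show ?case unfolding sum.empty by (rule D_low) (auto simp: seqs_def low_zero)
  next
    case (insert x F)
    then have "f x + sum f F \<in> D" by (intro D_add) auto
    then show ?case using insert.hyps by (simp only: sum.insert not_False_eq_True)
  qed
  have "(\<Sum>j<m. (\<lambda>i. u j * unit_seq j i)) \<in> D"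
    by (intro D_sum D_unit) auto
  then have "u \<in> D"
    by (subst seq_decomp[OF u])
  then show ?thesis by (simp add: D_def)
qed

context fin_operator
begin

lemma presents_gen_eval_mat_apply:
  assumes "presents m X P" "w \<in> fvec m"
  shows "gen_eval m X (mat_apply P w) = 0"
  by (rule iffD2[OF presents_ker[OF assms(1) mat_apply_fvec[OF presents_carrier[OF assms(1)]]]])
    (rule bexI[OF refl assms(2)])

text \<open>A relation divided by \<open>P\<close> leaves a remainder of low degree that is again a
  relation. \<open>gen_eval\<close> is injective on such vectors, so the remainder is 0 and the
  relation lies in P F[x]^m.\<close>

lemma presents_monicI:
  assumes card: "card V = CARD('a) ^ (m * d)" and "d > 0" and splitting_gens: "splitting_gens m d X"
    and P: "P \<in> monic_mat_polys m m d"
    and 0: "\<And>j. j < m \<Longrightarrow> gen_eval m X (mat_apply P (unit_seq j)) = 0"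
  shows "presents m X P"
  unfolding presents_def
proof (intro conjI ballI)
  show "P \<in> carrier_mat m m" using P by (rule monic_mat_polysD)
  show "X \<in> seqs m (\<lambda>_. V)" using splitting_gens by (auto simp: splitting_gens_def)
  show "\<exists>u\<in>fvec m. gen_eval m X u = v" if v: "v \<in> V" for v
  proof -
    obtain u where "u \<in> seqs m (\<lambda>_. low d)" "gen_eval m X u = v"
      using splitting_gens v unfolding splitting_gens_def by blast
    then show ?thesis by (intro bexI[of _ u]) (auto simp: seqs_def)
  qed
  have evP: "gen_eval m X (mat_apply P w) = 0" for w
    by (subst gen_eval_mat_apply[OF monic_mat_polysD(1)[OF P]]) (simp add: gen_eval_def[of m _ w] 0)
  fix u :: "nat \<Rightarrow> 'a poly" assume u: "u \<in> fvec m"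
  obtain w r where w: "w \<in> fvec m" and r: "r \<in> seqs m (\<lambda>_. low d)" and eq: "u = mat_apply P w + r"
    using monic_mat_division[OF P \<open>d > 0\<close> u] by blast
  show "gen_eval m X u = 0 \<longleftrightarrow> (\<exists>w\<in>fvec m. u = mat_apply P w)"
  proof
    assume "gen_eval m X u = 0"
    then have "gen_eval m X r = gen_eval m X 0"
      unfolding eq gen_eval_add evP by simp
    then have "r = 0"
      by (rule inj_onD[OF bij_betw_imp_inj_on[OF splitting_gens_bij[OF card splitting_gens]] _ r zero_seqs_low])
    then have "u = mat_apply P w" unfolding eq by (simp only: add_0_right)
    with w show "\<exists>w\<in>fvec m. u = mat_apply P w" by blast
  qed (auto simp: evP)
qed

text \<open>Replacing a preimage by its remainder modulo \<open>P\<close> does not change its value,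
  so coefficients of low degree already reach all of \<open>V\<close>.\<close>

lemma presents_monic_splitting_gens:
  assumes "d > 0" and P: "P \<in> monic_mat_polys m m d" and presents: "presents m X P"
  shows "splitting_gens m d X"
  unfolding splitting_gens_def
proof (intro conjI ballI)
  show "X \<in> seqs m (\<lambda>_. V)" using presents by (rule presents_seqs)
  fix v assume "v \<in> V"
  then obtain u where u: "u \<in> fvec m" "gen_eval m X u = v" using presents_surj[OF presents] by blast
  obtain w r where w: "w \<in> fvec m" and r: "r \<in> seqs m (\<lambda>_. low d)" and eq: "u = mat_apply P w + r"
    using monic_mat_division[OF P \<open>d > 0\<close> u(1)] by blast
  have "gen_eval m X (mat_apply P w) = 0"
    using presents w by (rule presents_gen_eval_mat_apply)
  then show "\<exists>u\<in>seqs m (\<lambda>_. low d). gen_eval m X u = v"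
    using u r unfolding eq gen_eval_add by auto
qed

lemma splitting_gens_ex1_presents:
  assumes card: "card V = CARD('a) ^ (m * d)" and d: "d > 0" and splitting_gens: "splitting_gens m d X"
  shows "\<exists>!P. P \<in> monic_mat_polys m m d \<and> presents m X P"
proof (rule ex_ex1I)
  have XV: "X \<in> seqs m (\<lambda>_. V)" using splitting_gens by (auto simp: splitting_gens_def)
  have "\<forall>j. \<exists>r. j < m \<longrightarrow> r \<in> seqs m (\<lambda>_. low d) \<and> gen_eval m X r = (T ^^ d) (X j)"
    using splitting_gens Tpow_V seqsD(1)[OF XV] unfolding splitting_gens_def by blast
  then obtain r where r: "\<And>j. j < m \<Longrightarrow> r j \<in> seqs m (\<lambda>_. low d) \<and> gen_eval m X (r j) = (T ^^ d) (X j)"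
    by metis
  \<comment> \<open>Column j is x^d e_j - r_j. It evaluates to T^d X_j minus its own expansion,
    hence to 0.\<close>
  define P where "P = mat m m (\<lambda>(i,j). (if i = j then monom 1 d else 0) - r j i)"
  have P: "P \<in> monic_mat_polys m m d"
  proof (rule monic_mat_polysI)
    fix i j assume ij: "i < m" "j < m"
    then have "r j i \<in> low d" using r by (auto simp: seqs_def)
    then show "P $$ (i,j) - (if i = j then monom 1 d else 0) \<in> low d"
      using ij by (auto simp: P_def low_def)
  qed (simp add: P_def)
  have "gen_eval m X (mat_apply P (unit_seq j)) = 0" if "j < m" for j
  proof -
    have "mat_apply P (unit_seq j) = (\<lambda>i. monom 1 d * unit_seq j i) - r j"
      unfolding mat_apply_unit[OF monic_mat_polysD(1)[OF P] that]
      using that r[OF that] by (auto simp: fun_eq_iff seqs_def P_def unit_seq_def)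
    then show ?thesis
      using that r[OF that] by (simp only: gen_eval_diff gen_eval_scale) (simp add: gen_eval_unit poly_act_monom)
  qed
  then show "\<exists>P. P \<in> monic_mat_polys m m d \<and> presents m X P"
    using P presents_monicI[OF card d splitting_gens P] by blast
next
  fix P Q assume PQ: "P \<in> monic_mat_polys m m d \<and> presents m X P" "Q \<in> monic_mat_polys m m d \<and> presents m X Q"
  then have c: "P \<in> carrier_mat m m" "Q \<in> carrier_mat m m" by (auto dest: monic_mat_polysD)
  show "P = Q"
  proof (rule mat_eq_mvI[OF c])
    fix j assume j: "j < m"
    \<comment> \<open>The terms x^d cancel in the difference of the two columns, which is therefore
      a relation of low degree and must vanish.\<close>
    let ?z = "mat_apply P (unit_seq j) - mat_apply Q (unit_seq j)"
    have "?z \<in> seqs m (\<lambda>_. low d)"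
    proof -
      have "P $$ (i,j) - Q $$ (i,j) \<in> low d" if "i < m" for i
        using low_diff[OF monic_mat_polysD(2)[of P m d i j] monic_mat_polysD(2)[of Q m d i j]] PQ that j
        by (auto simp: low_def)
      then show ?thesis
        using j by (auto simp: seqs_def mat_apply_unit[OF c(1)] mat_apply_unit[OF c(2)])
    qed
    moreover have "gen_eval m X (mat_apply P (unit_seq j)) = 0" "gen_eval m X (mat_apply Q (unit_seq j)) = 0"
      using PQ j by (auto intro!: presents_gen_eval_mat_apply)
    then have "gen_eval m X ?z = gen_eval m X 0" by (simp only: gen_eval_diff) simp
    ultimately have "?z = 0"
      by (intro inj_onD[OF bij_betw_imp_inj_on[OF splitting_gens_bij[OF card splitting_gens]] _ _ zero_seqs_low])
    then show "mat_apply P (unit_seq j) = mat_apply Q (unit_seq j)" by (simp only: right_minus_eq)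
  qed
qed

end

section \<open>Isomorphisms between presented operators\<close>

text \<open>Linearity is assumed only on \<open>fvec n\<close>: the maps to be represented are
  defined through choice or \<open>inv_into\<close> and are arbitrary elsewhere.\<close>

lemma linear_on_fvec_mat:
  fixes f :: "(nat \<Rightarrow> 'a::field) \<Rightarrow> nat \<Rightarrow> 'a"
  assumes add: "\<And>v w. v \<in> fvec n \<Longrightarrow> w \<in> fvec n \<Longrightarrow> f (v + w) = f v + f w"
    and scale: "\<And>c v. v \<in> fvec n \<Longrightarrow> f (\<lambda>i. c * v i) = (\<lambda>i. c * f v i)"
    and into: "\<And>v. v \<in> fvec n \<Longrightarrow> f v \<in> fvec k"
  shows "\<exists>M\<in>carrier_mat k n. \<forall>v\<in>fvec n. mat_apply M v = f v"
proof -
  define M where "M = mat k n (\<lambda>(i,j). f (unit_seq j) i)"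
  have M: "M \<in> carrier_mat k n" by (simp add: M_def)
  have unit: "mat_apply M (unit_seq j) = f (unit_seq j)" if "j < n" for j
    unfolding mat_apply_unit[OF M that] using that into[OF unit_seq_fvec[OF that]]
    by (auto simp: M_def seqs_def fun_eq_iff)
  have f0: "f 0 = 0"
    using scale[of 0 0] by (auto simp: fun_eq_iff seqs_def zero_fun_def)
  have scaled: "(\<lambda>i. c * unit_seq j i) \<in> fvec n" if "j < n" for c :: 'a and j
    using that by (auto simp: seqs_def unit_seq_def)
  \<comment> \<open>Additivity holds only inside \<open>fvec n\<close>, so the induction also
    carries the membership of the partial sums.\<close>
  have partial: "(\<Sum>j\<in>J. (\<lambda>i. v j * unit_seq j i)) \<in> fvec n \<and>
      mat_apply M (\<Sum>j\<in>J. (\<lambda>i. v j * unit_seq j i)) = f (\<Sum>j\<in>J. (\<lambda>i. v j * unit_seq j i))"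
    if "finite J" "J \<subseteq> {..<n}" for J v
    using that
  proof (induction J)
    case empty
    show ?case unfolding sum.empty f0 mat_apply_zero by (auto simp: seqs_def)
  next
    case (insert x J)
    then have x: "x < n" and J: "J \<subseteq> {..<n}" by auto
    show ?case
      unfolding sum.insert[OF insert.hyps] mat_apply_add
      using insert.IH[OF J] scaled[OF x, of "v x"] fvec_add[OF scaled[OF x]]
      by (simp only: add[OF scaled[OF x]] mat_apply_scale unit[OF x] scale[OF unit_seq_fvec[OF x]])
  qed
  have "mat_apply M v = f v" if "v \<in> fvec n" for v
    using partial[of "{..<n}" v] by (simp only: seq_decomp[OF that, symmetric]) simp
  with M show ?thesis by blast
qed

lemma mat_eq_mat_apply_fvecI:
  assumes "A \<in> carrier_mat n k" "B \<in> carrier_mat n k" "\<And>v. v \<in> fvec k \<Longrightarrow> mat_apply A v = mat_apply B v"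
  shows "A = B"
  using assms by (intro mat_eq_mvI) auto

text \<open>The inverse function inherits linearity, so it is given by a matrix as well.\<close>

lemma bij_mat_apply_invertible:
  fixes M :: "'a::field mat"
  assumes M: "M \<in> carrier_mat n n" and bij: "bij_betw (mat_apply M) (fvec n) (fvec n)"
  shows "invertible_mat M"
proof -
  let ?g = "inv_into (fvec n) (mat_apply M)"
  have g: "?g v \<in> fvec n" "mat_apply M (?g v) = v" if "v \<in> fvec n" for v
    using bij that by (auto simp: bij_betw_def inv_into_into f_inv_into_f)
  have g': "?g (mat_apply M v) = v" if "v \<in> fvec n" for v
    using bij that by (auto simp: bij_betw_def)
  have "\<exists>N\<in>carrier_mat n n. \<forall>v\<in>fvec n. mat_apply N v = ?g v"
  proof (rule linear_on_fvec_mat)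
    fix v w :: "nat \<Rightarrow> 'a" assume "v \<in> fvec n" "w \<in> fvec n"
    then show "?g (v + w) = ?g v + ?g w"
      using g'[of "?g v + ?g w"] fvec_add[of "?g v" n "?g w"] g by (simp only: mat_apply_add)
  next
    fix c and v :: "nat \<Rightarrow> 'a" assume v: "v \<in> fvec n"
    have "(\<lambda>i. c * ?g v i) \<in> fvec n" using g(1)[OF v] by (auto simp: seqs_def)
    from g'[OF this] show "?g (\<lambda>i. c * v i) = (\<lambda>i. c * ?g v i)"
      unfolding mat_apply_scale g(2)[OF v] .
  qed (rule g)
  then obtain N where N: "N \<in> carrier_mat n n" "\<And>v. v \<in> fvec n \<Longrightarrow> mat_apply N v = ?g v" by blast
  have "M * N = 1\<^sub>m n"
    using M N by (intro mat_eq_mat_apply_fvecI[of _ n n]) (auto simp: mat_apply_mult[of _ n n _ n] mat_apply_one g)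
  moreover have "N * M = 1\<^sub>m n"
    using M N by (intro mat_eq_mat_apply_fvecI[of _ n n]) (auto simp: mat_apply_mult[of _ n n _ n] mat_apply_one g' mat_apply_fvec)
  ultimately show ?thesis using M N by (intro invertible_matI)
qed

lemma invertible_mat_apply_bij:
  fixes M :: "'a::field mat"
  assumes M: "M \<in> carrier_mat n n" and inv: "invertible_mat M"
  shows "bij_betw (mat_apply M) (fvec n) (fvec n)"
proof -
  obtain N where N: "N \<in> carrier_mat n n" "M * N = 1\<^sub>m n" "N * M = 1\<^sub>m n"
    using invertible_mat_obtain[OF inv M] .
  have "mat_apply M (mat_apply N v) = v" "mat_apply N (mat_apply M v) = v" if "v \<in> fvec n" for v
    using that M N by (simp_all add: mat_apply_one flip: mat_apply_mult[of _ n n _ n])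
  then show ?thesis
    using M N by (intro bij_betw_byWitness[where f' = "mat_apply N"]) (auto simp: mat_apply_fvec)
qed

text \<open>The vector types may differ: later one side consists of tuples of polynomial residues
  and the other of coordinate tuples.\<close>

locale fin_operator_pair = O1: fin_operator s1 T1 V1 + O2: fin_operator s2 T2 V2
  for s1 :: "'a::{field,finite} \<Rightarrow> 'v::ab_group_add \<Rightarrow> 'v" and T1 V1
    and s2 :: "'a \<Rightarrow> 'w::ab_group_add \<Rightarrow> 'w" and T2 V2
begin

definition iso_map :: "nat \<Rightarrow> (nat \<Rightarrow> 'v) \<Rightarrow> (nat \<Rightarrow> 'w) \<Rightarrow> 'v \<Rightarrow> 'w" where
  "iso_map m X Y v = O2.gen_eval m Y (SOME u. u \<in> fvec m \<and> O1.gen_eval m X u = v)"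

text \<open>The choice in \<open>iso_map\<close> is immaterial. Two candidates differ by a relation
  among \<open>X\<close>, and this is also a relation among \<open>Y\<close> because both relation
  modules equal P F[x]^m.\<close>

lemma iso_map_gen_eval:
  assumes "O1.presents m X P" "O2.presents m Y P" "u \<in> fvec m"
  shows "iso_map m X Y (O1.gen_eval m X u) = O2.gen_eval m Y u"
proof -
  let ?u = "SOME w. w \<in> fvec m \<and> O1.gen_eval m X w = O1.gen_eval m X u"
  have u: "?u \<in> fvec m \<and> O1.gen_eval m X ?u = O1.gen_eval m X u"
    using someI[of "\<lambda>w. w \<in> fvec m \<and> O1.gen_eval m X w = O1.gen_eval m X u" u] assms(3) by simp
  have mem: "?u - u \<in> fvec m" using u assms(3) by (auto simp: seqs_def)
  have "O1.gen_eval m X (?u - u) = 0" using u by (simp only: O1.gen_eval_diff) simp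
  then have "O2.gen_eval m Y (?u - u) = 0"
    using O1.presents_ker[OF assms(1) mem] O2.presents_ker[OF assms(2) mem] by blast
  then show ?thesis unfolding iso_map_def by (simp add: O2.gen_eval_diff)
qed

text \<open>All claims follow from the choice-free formula. Compatibility with scalars and with the
  operators are the cases of a constant and of x in F[x]-linearity.\<close>

lemma
  assumes X: "O1.presents m X P" and Y: "O2.presents m Y P"
  shows iso_map_bij: "bij_betw (iso_map m X Y) V1 V2"
    and iso_map_add: "v \<in> V1 \<Longrightarrow> w \<in> V1 \<Longrightarrow> iso_map m X Y (v + w) = iso_map m X Y v + iso_map m X Y w"
    and iso_map_scale: "v \<in> V1 \<Longrightarrow> iso_map m X Y (s1 c v) = s2 c (iso_map m X Y v)"
    and iso_map_T: "v \<in> V1 \<Longrightarrow> iso_map m X Y (T1 v) = T2 (iso_map m X Y v)"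
    and iso_map_gen: "j < m \<Longrightarrow> iso_map m X Y (X j) = Y j"
proof -
  note gen_eval = iso_map_gen_eval[OF X Y]
  have ex: "\<exists>u\<in>fvec m. v = O1.gen_eval m X u" if "v \<in> V1" for v
    using O1.presents_surj[OF X that] by blast
  have poly_act: "iso_map m X Y (O1.poly_act p v) = O2.poly_act p (iso_map m X Y v)" if v: "v \<in> V1" for p v
  proof -
    obtain u where u: "u \<in> fvec m" "v = O1.gen_eval m X u" using ex[OF v] by blast
    have "(\<lambda>i. p * u i) \<in> fvec m" using u by (auto simp: seqs_def)
    then show ?thesis unfolding u(2) using gen_eval[OF u(1)]
      by (simp add: gen_eval flip: O1.gen_eval_scale O2.gen_eval_scale)
  qed
  show "iso_map m X Y (s1 c v) = s2 c (iso_map m X Y v)" if "v \<in> V1"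
    using poly_act[OF that, of "[:c:]"] by (simp add: O1.poly_act_const O2.poly_act_const)
  show "iso_map m X Y (T1 v) = T2 (iso_map m X Y v)" if "v \<in> V1"
    using poly_act[OF that, of "[:0,1:]"] by (simp add: O1.poly_act_pCons O2.poly_act_pCons)
  show "iso_map m X Y (v + w) = iso_map m X Y v + iso_map m X Y w" if "v \<in> V1" "w \<in> V1"
  proof -
    obtain a b where "a \<in> fvec m" "v = O1.gen_eval m X a" "b \<in> fvec m" "w = O1.gen_eval m X b"
      using ex \<open>v \<in> V1\<close> \<open>w \<in> V1\<close> by metis
    then show ?thesis by (simp add: gen_eval fvec_add flip: O1.gen_eval_add O2.gen_eval_add)
  qed
  show "iso_map m X Y (X j) = Y j" if "j < m"
    using gen_eval[OF unit_seq_fvec[OF that]] that by (simp add: O1.gen_eval_unit O2.gen_eval_unit)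
  show "bij_betw (iso_map m X Y) V1 V2"
    unfolding bij_betw_def
  proof
    show "inj_on (iso_map m X Y) V1"
    proof (rule inj_onI)
      fix v w assume "v \<in> V1" "w \<in> V1" and eq: "iso_map m X Y v = iso_map m X Y w"
      then obtain a b where ab: "a \<in> fvec m" "v = O1.gen_eval m X a" "b \<in> fvec m" "w = O1.gen_eval m X b"
        using ex by metis
      have mem: "a - b \<in> fvec m" using ab by (auto simp: seqs_def)
      have "O2.gen_eval m Y (a - b) = 0" using eq ab by (simp add: gen_eval O2.gen_eval_diff)
      then have "O1.gen_eval m X (a - b) = 0"
        using O1.presents_ker[OF X mem] O2.presents_ker[OF Y mem] by blast
      then show "v = w" using ab by (simp add: O1.gen_eval_diff)
    qed
    show "iso_map m X Y ` V1 = V2"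
    proof (intro subset_antisym subsetI)
      fix v assume "v \<in> V2"
      then obtain u where u: "u \<in> fvec m" "v = O2.gen_eval m Y u" using O2.presents_surj[OF Y] by blast
      then show "v \<in> iso_map m X Y ` V1"
        using O1.gen_eval_V[OF O1.presents_seqs[OF X]] by (intro image_eqI[of _ _ "O1.gen_eval m X u"]) (auto simp: gen_eval)
    next
      fix v assume "v \<in> iso_map m X Y ` V1"
      then obtain w where "w \<in> V1" "v = iso_map m X Y w" by blast
      then show "v \<in> V2" using ex[of w] O2.gen_eval_V[OF O2.presents_seqs[OF Y]] by (auto simp: gen_eval)
    qed
  qed
qed

text \<open>Transport along a module isomorphism. It is applied to invertible matrices commuting
  with an operator and to coordinate maps.\<close>

lemma presents_transport:
  assumes bij: "bij_betw f V1 V2"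
    and add: "\<And>v w. v \<in> V1 \<Longrightarrow> w \<in> V1 \<Longrightarrow> f (v + w) = f v + f w"
    and scale: "\<And>c v. v \<in> V1 \<Longrightarrow> f (s1 c v) = s2 c (f v)"
    and T: "\<And>v. v \<in> V1 \<Longrightarrow> f (T1 v) = T2 (f v)"
    and X: "O1.presents m X P"
  shows "O2.presents m (\<lambda>j. f (X j)) P"
proof -
  have XV: "X j \<in> V1" for j
    using seqsD[OF O1.presents_seqs[OF X], of j] O1.V_0 by (cases "j < m") auto
  have f0: "f 0 = 0" using add[OF O1.V_0 O1.V_0] by simp
  have poly_act: "f (O1.poly_act p v) = O2.poly_act p (f v)" if "v \<in> V1" for p v
    using that by (induction p)
      (simp_all add: f0 O1.poly_act_pCons O2.poly_act_pCons add scale T O1.poly_act_V O1.V_scale O1.V_T)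
  have gen_eval: "f (O1.gen_eval m X u) = O2.gen_eval m (\<lambda>j. f (X j)) u" for u
    unfolding O1.gen_eval_def O2.gen_eval_def
    by (induction m) (simp_all add: f0 add poly_act XV O1.poly_act_V O1.V_sum)
  have evV: "O1.gen_eval m X u \<in> V1" for u
    using O1.gen_eval_V[OF O1.presents_seqs[OF X]] .
  show ?thesis
    unfolding O2.presents_def
  proof (intro conjI ballI)
    show "P \<in> carrier_mat m m" by (rule O1.presents_carrier[OF X])
    show "(\<lambda>j. f (X j)) \<in> seqs m (\<lambda>_. V2)"
      using bij XV seqsD(2)[OF O1.presents_seqs[OF X]] by (auto simp: seqs_def bij_betw_def f0)
    fix v assume "v \<in> V2"
    then have "v \<in> f ` V1" by (simp add: bij_betw_imp_surj_on[OF bij])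
    then obtain w where w: "w \<in> V1" "f w = v" by blast
    obtain u where "u \<in> fvec m" "O1.gen_eval m X u = w" using O1.presents_surj[OF X w(1)] by blast
    with w show "\<exists>u\<in>fvec m. O2.gen_eval m (\<lambda>j. f (X j)) u = v" unfolding gen_eval[symmetric] by blast
  next
    fix u :: "nat \<Rightarrow> 'a poly" assume u: "u \<in> fvec m"
    have "f (O1.gen_eval m X u) = 0 \<longleftrightarrow> O1.gen_eval m X u = 0"
      using inj_onD[OF bij_betw_imp_inj_on[OF bij], of "O1.gen_eval m X u" 0] evV[of u] f0 O1.V_0 by auto
    then show "O2.gen_eval m (\<lambda>j. f (X j)) u = 0 \<longleftrightarrow> (\<exists>w\<in>fvec m. u = mat_apply P w)"
      unfolding gen_eval using O1.presents_ker[OF X u] by blast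
  qed
qed

end

section \<open>Matrices as operators: intertwiners and centralizers\<close>

abbreviation (input) vscale :: "'a::times \<Rightarrow> (nat \<Rightarrow> 'a) \<Rightarrow> nat \<Rightarrow> 'a" where
  "vscale \<equiv> \<lambda>c v i. c * v i"

lemma fin_operator_mat:
  fixes A :: "'a::{field,finite} mat"
  assumes "A \<in> carrier_mat n n"
  shows "fin_operator vscale (mat_apply A) (fvec n)"
proof -
  interpret vector_space "vscale :: 'a \<Rightarrow> _"
    by standard (auto simp: fun_eq_iff algebra_simps)
  show ?thesis
    using assms
    by unfold_locales (auto simp: mat_apply_add mat_apply_scale subspace_def intro: mat_apply_fvec fvec_add fvec_scale fvec_zero)
qed

abbreviation mat_presents :: "'a::{field,finite} mat \<Rightarrow> nat \<Rightarrow> (nat \<Rightarrow> nat \<Rightarrow> 'a) \<Rightarrow> 'a poly mat \<Rightarrow> bool" where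
  "mat_presents A \<equiv> fin_operator.presents vscale (mat_apply A) (fvec (dim_row A))"

text \<open>An isomorphism of F[x]-modules between coordinate spaces is an invertible intertwiner.
  For \<open>B = A\<close> this is transitivity of the centralizer on the tuples presenting
  \<open>P\<close>; in general it makes matrices with a common presentation similar.\<close>

lemma mat_presents_similar:
  fixes A B :: "'a::{field,finite} mat"
  assumes A: "A \<in> carrier_mat n n" and B: "B \<in> carrier_mat n n"
    and X: "mat_presents A m X P" and Y: "mat_presents B m Y P"
  shows "\<exists>Z\<in>carrier_mat n n. invertible_mat Z \<and> Z * A = B * Z \<and> (\<forall>j<m. mat_apply Z (X j) = Y j)"
proof -
  interpret fin_operator_pair "vscale :: 'a \<Rightarrow> _" "mat_apply A" "fvec n" "vscale :: 'a \<Rightarrow> _" "mat_apply B" "fvec n"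
    using fin_operator_mat[OF A] fin_operator_mat[OF B] by (simp add: fin_operator_pair_def)
  have XY: "O1.presents m X P" "O2.presents m Y P" using X Y A B by auto
  let ?f = "iso_map m X Y"
  have "\<exists>Z\<in>carrier_mat n n. \<forall>v\<in>fvec n. mat_apply Z v = ?f v"
  proof (rule linear_on_fvec_mat)
    show "?f v \<in> fvec n" if "v \<in> fvec n" for v
      using iso_map_bij[OF XY] that by (auto simp: bij_betw_def)
  qed (use iso_map_add[OF XY] iso_map_scale[OF XY] in auto)
  then obtain Z where Z: "Z \<in> carrier_mat n n" "\<And>v. v \<in> fvec n \<Longrightarrow> mat_apply Z v = ?f v" by blast
  have "bij_betw (mat_apply Z) (fvec n) (fvec n)"
    using iso_map_bij[OF XY] Z(2) by (simp cong: bij_betw_cong)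
  then have "invertible_mat Z" using Z by (intro bij_mat_apply_invertible)
  moreover have "Z * A = B * Z"
  proof (rule mat_eq_mat_apply_fvecI[of _ n n])
    fix v :: "nat \<Rightarrow> 'a" assume v: "v \<in> fvec n"
    then show "mat_apply (Z * A) v = mat_apply (B * Z) v"
      using A B Z by (simp add: mat_apply_mult[of _ n n _ n] mat_apply_fvec iso_map_T[OF XY])
  qed (use A B Z in auto)
  moreover have "mat_apply Z (X j) = Y j" if "j < m" for j
    using that seqsD(1)[OF O1.presents_seqs[OF XY(1)]] by (simp add: Z iso_map_gen[OF XY])
  ultimately show ?thesis using Z(1) by blast
qed

text \<open>Intertwining the operators makes \<open>Z\<close> linear over F[x], not merely over
  F.\<close>

lemma mat_apply_poly_act:
  fixes A B Z :: "'a::{field,finite} mat"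
  assumes "A \<in> carrier_mat n n" "B \<in> carrier_mat n n" "Z \<in> carrier_mat n n" "Z * A = B * Z"
  shows "mat_apply Z (fin_operator.poly_act vscale (mat_apply A) p v) = fin_operator.poly_act vscale (mat_apply B) p (mat_apply Z v)"
proof -
  interpret OA: fin_operator vscale "mat_apply A" "fvec n" using assms by (intro fin_operator_mat)
  interpret OB: fin_operator vscale "mat_apply B" "fvec n" using assms by (intro fin_operator_mat)
  have "mat_apply Z (mat_apply A w) = mat_apply B (mat_apply Z w)" for w
    using assms by (simp flip: mat_apply_mult[of _ n n _ n])
  then show ?thesis
    by (induction p) (simp_all only: OA.poly_act_0 OB.poly_act_0 OA.poly_act_pCons OB.poly_act_pCons mat_apply_zero mat_apply_add mat_apply_scale)
qed

lemma mat_presents_transport: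
  fixes A Z :: "'a::{field,finite} mat"
  assumes A: "A \<in> carrier_mat n n" and Z: "Z \<in> GL_centralizer n A" and X: "mat_presents A m X P"
  shows "mat_presents A m (\<lambda>j. mat_apply Z (X j)) P"
proof -
  interpret fin_operator_pair "vscale :: 'a \<Rightarrow> _" "mat_apply A" "fvec n" "vscale :: 'a \<Rightarrow> _" "mat_apply A" "fvec n"
    using fin_operator_mat[OF A] by (simp add: fin_operator_pair_def)
  have Zc: "Z \<in> carrier_mat n n" "A * Z = Z * A" "invertible_mat Z" using Z by (auto simp: GL_centralizer_def)
  have "mat_apply Z (mat_apply A v) = mat_apply A (mat_apply Z v)" for v
    using A Zc(1,2) by (simp flip: mat_apply_mult[of _ n n _ n])
  then have "O1.presents m (\<lambda>j. mat_apply Z (X j)) P"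
    using X A by (intro presents_transport[OF invertible_mat_apply_bij[OF Zc(1,3)]]) (simp_all only: mat_apply_add mat_apply_scale carrier_matD)
  then show ?thesis using A by auto
qed

text \<open>The centralizer acts freely because a commuting matrix is determined by its values on
  module generators, and transitively by \<open>mat_presents_similar\<close>.\<close>

lemma card_mat_presents:
  fixes A :: "'a::{field,finite} mat"
  assumes A: "A \<in> carrier_mat n n" and X: "mat_presents A m X P"
  shows "card {Y. mat_presents A m Y P} = card (GL_centralizer n A)"
proof -
  interpret fin_operator vscale "mat_apply A" "fvec n" using A by (rule fin_operator_mat)
  have X': "presents m X P" using X A by auto
  have "bij_betw (\<lambda>Z j. mat_apply Z (X j)) (GL_centralizer n A) {Y. mat_presents A m Y P}"
    unfolding bij_betw_def
  proof
    show "inj_on (\<lambda>Z j. mat_apply Z (X j)) (GL_centralizer n A)"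
    proof (rule inj_onI)
      fix Z Z' assume Z: "Z \<in> GL_centralizer n A" and Z': "Z' \<in> GL_centralizer n A"
        and "(\<lambda>j. mat_apply Z (X j)) = (\<lambda>j. mat_apply Z' (X j))"
      then have eq: "mat_apply Z (X j) = mat_apply Z' (X j)" for j by meson
      have c: "Z \<in> carrier_mat n n" "Z' \<in> carrier_mat n n" "Z * A = A * Z" "Z' * A = A * Z'"
        using Z Z' by (auto simp: GL_centralizer_def)
      show "Z = Z'"
      proof (rule mat_eq_mat_apply_fvecI[OF c(1,2)])
        fix v :: "nat \<Rightarrow> 'a" assume "v \<in> fvec n"
        then obtain u where "v = gen_eval m X u" using presents_surj[OF X'] by blast
        then show "mat_apply Z v = mat_apply Z' v"
          by (simp only: gen_eval_def mat_apply_sum mat_apply_poly_act[OF A A c(1,3)] mat_apply_poly_act[OF A A c(2,4)] eq)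
      qed
    qed
    show "(\<lambda>Z j. mat_apply Z (X j)) ` GL_centralizer n A = {Y. mat_presents A m Y P}"
    proof (intro subset_antisym subsetI)
      fix Y assume "Y \<in> (\<lambda>Z j. mat_apply Z (X j)) ` GL_centralizer n A"
      then show "Y \<in> {Y. mat_presents A m Y P}" using mat_presents_transport[OF A _ X] by blast
    next
      fix Y assume Y: "Y \<in> {Y. mat_presents A m Y P}"
      then obtain Z where Z: "Z \<in> carrier_mat n n" "invertible_mat Z" "Z * A = A * Z" "\<forall>j<m. mat_apply Z (X j) = Y j"
        using mat_presents_similar[OF A A X] by blast
      \<comment> \<open>Tuples are compared as functions, so indices from \<open>m\<close> on matter
        too; there both sides are 0.\<close>
      have "mat_apply Z (X j) = Y j" for j
      proof (cases "j < m")
        case False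
        then have "X j = 0" "Y j = 0"
          using seqsD(2)[OF presents_seqs[OF X'], of j] Y A seqsD(2)[OF presents_seqs, of m Y P j] by auto
        then show ?thesis by (simp only: mat_apply_zero)
      qed (use Z in auto)
      then have "Y = (\<lambda>j. mat_apply Z (X j))" by (simp add: fun_eq_iff)
      then show "Y \<in> (\<lambda>Z j. mat_apply Z (X j)) ` GL_centralizer n A"
        using Z by (auto simp: GL_centralizer_def)
    qed
  qed
  then show ?thesis by (simp add: bij_betw_same_card)
qed

lemma intertwine_inverse:
  fixes A B Z N :: "'r::comm_ring_1 mat"
  assumes A: "A \<in> carrier_mat n n" and B: "B \<in> carrier_mat n n" and Z: "Z \<in> carrier_mat n n"
    and N: "N \<in> carrier_mat n n" "Z * N = 1\<^sub>m n" "N * Z = 1\<^sub>m n" and eq: "Z * A = B * Z"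
  shows "N * B = A * N"
proof -
  note assoc = assoc_mult_mat[of _ n n _ n _ n]
  have "N * B = N * B * (Z * N)" using B N by simp
  also have "\<dots> = N * (B * Z) * N" using B N(1) Z by (simp add: assoc)
  also have "\<dots> = (N * Z) * A * N" unfolding eq[symmetric] using A N(1) Z by (simp add: assoc)
  also have "\<dots> = A * N" using A N by simp
  finally show ?thesis .
qed

text \<open>Conjugation by \<open>Z\<close> carries one centralizer onto the other.\<close>

lemma card_GL_centralizer_similar:
  fixes A B Z :: "'a::{field,finite} mat"
  assumes A: "A \<in> carrier_mat n n" and B: "B \<in> carrier_mat n n" and Z: "Z \<in> carrier_mat n n" "invertible_mat Z"
    and eq: "Z * A = B * Z"
  shows "card (GL_centralizer n A) = card (GL_centralizer n B)"
proof -
  obtain N where N: "N \<in> carrier_mat n n" "Z * N = 1\<^sub>m n" "N * Z = 1\<^sub>m n"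
    using invertible_mat_obtain[OF Z(2,1)] .
  \<comment> \<open>Stated for arbitrary matrices so that it can be reused with A and B, and Z and
    its inverse, exchanged.\<close>
  have conj: "Z * C * N \<in> GL_centralizer n B \<and> N * (Z * C * N) * Z = C"
    if A: "A \<in> carrier_mat n n" and B: "B \<in> carrier_mat n n" and Z: "Z \<in> carrier_mat n n"
      and N: "N \<in> carrier_mat n n" "Z * N = 1\<^sub>m n" "N * Z = 1\<^sub>m n" and eq: "Z * A = B * Z"
      and C: "C \<in> GL_centralizer n A" for A B Z N C :: "'a mat"
  proof -
    have Cc: "C \<in> carrier_mat n n" "invertible_mat C" "A * C = C * A"
      using C by (auto simp: GL_centralizer_def)
    obtain C' where C': "C' \<in> carrier_mat n n" "C * C' = 1\<^sub>m n" "C' * C = 1\<^sub>m n"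
      using invertible_mat_obtain[OF Cc(2,1)] .
    note assoc = assoc_mult_mat[of _ n n _ n _ n]
    have NB: "N * B = A * N"
    by (rule intertwine_inverse[OF A B Z N eq])
    have mul: "(Z * D * N) * (Z * E * N) = Z * (D * E) * N"
      if "D \<in> carrier_mat n n" "E \<in> carrier_mat n n" for D E
    proof -
      have "(Z * D * N) * (Z * E * N) = Z * D * (N * Z) * E * N" using that N(1) Z by (simp add: assoc)
      also have "\<dots> = Z * (D * E) * N" using that N Z by (simp add: assoc)
      finally show ?thesis .
    qed
    have "B * (Z * C * N) = (B * Z) * C * N" using B Z Cc N(1) by (simp add: assoc)
    also have "\<dots> = Z * (A * C) * N" using A Z Cc(1) N(1) by (simp add: eq[symmetric] assoc)
    also have "\<dots> = Z * C * (A * N)" unfolding Cc(3) using A Z Cc(1) N(1) by (simp add: assoc)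
    also have "\<dots> = Z * C * N * B" unfolding NB[symmetric] using B Z Cc(1) N(1) by (simp add: assoc)
    finally have comm: "B * (Z * C * N) = Z * C * N * B" .
    have "(Z * C * N) * (Z * C' * N) = 1\<^sub>m n" "(Z * C' * N) * (Z * C * N) = 1\<^sub>m n"
      unfolding mul[OF Cc(1) C'(1)] mul[OF C'(1) Cc(1)] C' using Z N by simp_all
    moreover have "Z * C * N \<in> carrier_mat n n" "Z * C' * N \<in> carrier_mat n n"
      using Z N(1) Cc(1) C'(1) by (auto intro!: mult_carrier_mat[of _ n n])
    ultimately have "invertible_mat (Z * C * N)" by (intro invertible_matI)
    moreover have "N * (Z * C * N) * Z = (N * Z) * C * (N * Z)"
      using Z N(1) Cc(1) by (simp add: assoc)
    ultimately show ?thesis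
      using comm Z N Cc(1) by (simp add: GL_centralizer_def)
  qed
  have eq': "N * B = A * N" by (rule intertwine_inverse[OF A B Z(1) N eq])
  have "bij_betw (\<lambda>C. Z * C * N) (GL_centralizer n A) (GL_centralizer n B)"
    using conj[OF A B Z(1) N eq] conj[OF B A N(1) Z(1) N(3,2) eq']
    by (intro bij_betw_byWitness[where f' = "\<lambda>C. N * C * Z"]) auto
  then show ?thesis by (rule bij_betw_same_card)
qed

section \<open>Smith normal form\<close>

lemma invertible_mat_one: "invertible_mat (1\<^sub>m n :: 'r::comm_ring_1 mat)"
  by (rule invertible_matI[of _ n "1\<^sub>m n"]) auto

lemma invertible_mat_mult:
  fixes A B :: "'r::comm_ring_1 mat"
  assumes A: "A \<in> carrier_mat n n" "invertible_mat A" and B: "B \<in> carrier_mat n n" "invertible_mat B"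
  shows "invertible_mat (A * B)"
proof -
  obtain A' where A': "A' \<in> carrier_mat n n" "A * A' = 1\<^sub>m n" "A' * A = 1\<^sub>m n"
    using invertible_mat_obtain[OF A(2,1)] .
  obtain B' where B': "B' \<in> carrier_mat n n" "B * B' = 1\<^sub>m n" "B' * B = 1\<^sub>m n"
    using invertible_mat_obtain[OF B(2,1)] .
  have "A * B * (B' * A') = A * (B * B') * A'"
    using A(1) B(1) A'(1) B'(1) by (simp add: assoc_mult_mat[of _ n n _ n _ n])
  also have "\<dots> = 1\<^sub>m n" using A(1) A'(1,2) B'(2) by simp
  finally have 1: "A * B * (B' * A') = 1\<^sub>m n" .
  have "B' * A' * (A * B) = B' * (A' * A) * B"
    using A(1) B(1) A'(1) B'(1) by (simp add: assoc_mult_mat[of _ n n _ n _ n])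
  also have "\<dots> = 1\<^sub>m n" using B(1) B'(1,3) A'(3) by simp
  finally have 2: "B' * A' * (A * B) = 1\<^sub>m n" .
  show ?thesis
    by (rule invertible_matI[OF _ _ 1 2]) (use A(1) B(1) A'(1) B'(1) in auto)
qed

lemma equivalent_mat_refl: "P \<in> carrier_mat n n \<Longrightarrow> equivalent_mat n n P P"
  unfolding equivalent_mat_def using invertible_mat_one
  by (intro bexI[of _ "1\<^sub>m n"]) auto

lemma equivalent_mat_trans:
  assumes P: "P \<in> carrier_mat n n" and PQ: "equivalent_mat n n P Q" and QR: "equivalent_mat n n Q R"
  shows "equivalent_mat n n P R"
proof -
  obtain A B where A: "A \<in> carrier_mat n n" "invertible_mat A" and B: "B \<in> carrier_mat n n" "invertible_mat B"
    and Q: "A * P * B = Q"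
    using PQ unfolding equivalent_mat_def by blast
  obtain C D where C: "C \<in> carrier_mat n n" "invertible_mat C" and D: "D \<in> carrier_mat n n" "invertible_mat D"
    and R: "C * Q * D = R"
    using QR unfolding equivalent_mat_def by blast
  have "(C * A) * P * (B * D) = R"
    unfolding R[symmetric] Q[symmetric] using A(1) B(1) C(1) D(1) P
    by (simp add: assoc_mult_mat[of _ n n _ n _ n])
  moreover have "invertible_mat (C * A)" "invertible_mat (B * D)"
    using invertible_mat_mult A B C D by blast+
  ultimately show ?thesis
    unfolding equivalent_mat_def using A(1) B(1) C(1) D(1)
    by (intro bexI[of _ "C * A"] bexI[of _ "B * D"]) auto
qed

lemma equivalent_mat_left:
  assumes "P \<in> carrier_mat n n" "E \<in> carrier_mat n n" "invertible_mat E"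
  shows "equivalent_mat n n P (E * P)"
  unfolding equivalent_mat_def using assms invertible_mat_one
  by (intro bexI[of _ E] bexI[of _ "1\<^sub>m n"]) auto

lemma equivalent_mat_right:
  assumes "P \<in> carrier_mat n n" "E \<in> carrier_mat n n" "invertible_mat E"
  shows "equivalent_mat n n P (P * E)"
  unfolding equivalent_mat_def using assms invertible_mat_one
  by (intro bexI[of _ "1\<^sub>m n"] bexI[of _ E]) auto

section \<open>Elementary and block operations\<close>

lemma addrow_mat_invertible:
  assumes "k < n" "l < n" "k \<noteq> l"
  shows "invertible_mat (addrow_mat n (a :: 'r::comm_ring_1) k l)"
  using addrow_mat_inv[OF assms, of a] addrow_mat_inv[OF assms, of "- a"]
  by (intro invertible_matI[of _ n "addrow_mat n (- a) k l"]) auto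

lemma equivalent_addrow:
  assumes "P \<in> carrier_mat n n" "k < n" "l < n" "k \<noteq> l"
  shows "equivalent_mat n n P (addrow a k l P)"
  unfolding addrow_mat[OF assms(1,3)]
  by (intro equivalent_mat_left addrow_mat_invertible assms) simp

lemma equivalent_addcol:
  assumes "P \<in> carrier_mat n n" "k < n" "l < n" "k \<noteq> l"
  shows "equivalent_mat n n P (addcol a k l P)"
  unfolding addcol_mat[OF assms(1,3)]
  by (intro equivalent_mat_right addrow_mat_invertible assms) (use assms in auto)

lemma swaprows_mat_invertible:
  "k < n \<Longrightarrow> l < n \<Longrightarrow> invertible_mat (swaprows_mat n k l :: 'r::comm_ring_1 mat)"
  using swaprows_mat_inv[of k n l]
  by (intro invertible_matI[of _ n "swaprows_mat n k l"]) auto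

lemma equivalent_swaprows:
  assumes "P \<in> carrier_mat n n" "k < n" "l < n"
  shows "equivalent_mat n n P (swaprows k l P)"
  unfolding swaprows_mat[OF assms]
  by (intro equivalent_mat_left swaprows_mat_invertible assms) simp

lemma equivalent_swapcols:
  assumes "P \<in> carrier_mat n n" "k < n" "l < n"
  shows "equivalent_mat n n P (swapcols k l P)"
  unfolding swapcols_mat[OF assms]
  by (intro equivalent_mat_right swaprows_mat_invertible assms) simp

lemma four_block_lower_invertible:
  fixes t :: "'r::comm_ring_1 mat"
  assumes t: "t \<in> carrier_mat k 1"
  shows "invertible_mat (four_block_mat (1\<^sub>m 1) (0\<^sub>m 1 k) t (1\<^sub>m k))"
proof -
  have *: "four_block_mat (1\<^sub>m 1) (0\<^sub>m 1 k) t (1\<^sub>m k) * four_block_mat (1\<^sub>m 1) (0\<^sub>m 1 k) s (1\<^sub>m k) = 1\<^sub>m (1 + k)"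
    if "s \<in> carrier_mat k 1" "t \<in> carrier_mat k 1" "t + s = 0\<^sub>m k 1" for s t :: "'r mat"
    using that by (subst mult_four_block_mat[of _ 1 1 _ k _ k]) auto
  have "t + - t = 0\<^sub>m k 1" "- t + t = 0\<^sub>m k 1" using t by auto
  then show ?thesis
    using *[of "- t" t] *[of t "- t"] t
    by (intro invertible_matI[of _ "1 + k" "four_block_mat (1\<^sub>m 1) (0\<^sub>m 1 k) (- t) (1\<^sub>m k)"]) auto
qed

lemma four_block_upper_invertible:
  fixes t :: "'r::comm_ring_1 mat"
  assumes t: "t \<in> carrier_mat 1 k"
  shows "invertible_mat (four_block_mat (1\<^sub>m 1) t (0\<^sub>m k 1) (1\<^sub>m k))"
proof -
  have *: "four_block_mat (1\<^sub>m 1) t (0\<^sub>m k 1) (1\<^sub>m k) * four_block_mat (1\<^sub>m 1) s (0\<^sub>m k 1) (1\<^sub>m k) = 1\<^sub>m (1 + k)"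
    if "s \<in> carrier_mat 1 k" "t \<in> carrier_mat 1 k" "s + t = 0\<^sub>m 1 k" for s t :: "'r mat"
    using that by (subst mult_four_block_mat[of _ 1 1 _ k _ k]) auto
  have "t + - t = 0\<^sub>m 1 k" "- t + t = 0\<^sub>m 1 k" using t by auto
  then show ?thesis
    using *[of "- t" t] *[of t "- t"] t
    by (intro invertible_matI[of _ "1 + k" "four_block_mat (1\<^sub>m 1) (- t) (0\<^sub>m k 1) (1\<^sub>m k)"]) auto
qed

text \<open>The unit \<open>u\<close> will be the constant that makes a pivot monic, and
  \<open>U\<close> a transformation found for the remaining block.\<close>

lemma four_block_diag_invertible:
  fixes U :: "'r::comm_ring_1 mat"
  assumes U: "U \<in> carrier_mat k k" "invertible_mat U" and uv: "u * v = 1"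
  shows "invertible_mat (four_block_mat (mat 1 1 (\<lambda>_. u)) (0\<^sub>m 1 k) (0\<^sub>m k 1) U)"
proof -
  obtain W where W: "W \<in> carrier_mat k k" "U * W = 1\<^sub>m k" "W * U = 1\<^sub>m k"
    using invertible_mat_obtain[OF U(2,1)] .
  have 1: "mat 1 1 (\<lambda>_. u) * mat 1 1 (\<lambda>_. v) = 1\<^sub>m 1" "mat 1 1 (\<lambda>_. v) * mat 1 1 (\<lambda>_. u) = 1\<^sub>m 1"
    using uv by (auto simp: scalar_prod_def mult.commute)
  have "four_block_mat (mat 1 1 (\<lambda>_. u)) (0\<^sub>m 1 k) (0\<^sub>m k 1) U
      * four_block_mat (mat 1 1 (\<lambda>_. v)) (0\<^sub>m 1 k) (0\<^sub>m k 1) W = 1\<^sub>m (1 + k)"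
    using U W 1 by (subst mult_four_block_mat[of _ 1 1 _ k _ k]) auto
  moreover have "four_block_mat (mat 1 1 (\<lambda>_. v)) (0\<^sub>m 1 k) (0\<^sub>m k 1) W
      * four_block_mat (mat 1 1 (\<lambda>_. u)) (0\<^sub>m 1 k) (0\<^sub>m k 1) U = 1\<^sub>m (1 + k)"
    using U W 1 by (subst mult_four_block_mat[of _ 1 1 _ k _ k]) auto
  ultimately show ?thesis
    using U W
    by (intro invertible_matI[of _ "1 + k" "four_block_mat (mat 1 1 (\<lambda>_. v)) (0\<^sub>m 1 k) (0\<^sub>m k 1) W"]) auto
qed

text \<open>Minimality over the whole equivalence class replaces the bookkeeping of a Euclidean
  elimination: whatever would lower the degree of the corner is a contradiction.\<close>

definition minimal_pivot :: "nat \<Rightarrow> 'a::field poly mat \<Rightarrow> bool" where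
  "minimal_pivot n Q \<longleftrightarrow> Q \<in> carrier_mat n n \<and> Q $$ (0,0) \<noteq> 0 \<and>
     (\<forall>R. equivalent_mat n n Q R \<and> R $$ (0,0) \<noteq> 0 \<longrightarrow> degree (Q $$ (0,0)) \<le> degree (R $$ (0,0)))"

lemma equivalent_carrier: "equivalent_mat n n P Q \<Longrightarrow> Q \<in> carrier_mat n n"
  unfolding equivalent_mat_def by auto

lemma minimal_pivot_equiv:
  assumes "minimal_pivot n Q" "equivalent_mat n n Q R" "R $$ (0,0) = Q $$ (0,0)"
  shows "minimal_pivot n R"
  unfolding minimal_pivot_def
proof (intro conjI allI impI)
  show "R \<in> carrier_mat n n" by (rule equivalent_carrier[OF assms(2)])
  show "R $$ (0,0) \<noteq> 0" using assms(1,3) by (simp add: minimal_pivot_def)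
  fix S assume S: "equivalent_mat n n R S \<and> S $$ (0,0) \<noteq> 0"
  have "Q \<in> carrier_mat n n" using assms(1) by (simp add: minimal_pivot_def)
  then have "equivalent_mat n n Q S" using S equivalent_mat_trans[OF _ assms(2)] by simp
  then show "degree (R $$ (0,0)) \<le> degree (S $$ (0,0))"
    using assms(1,3) S by (simp add: minimal_pivot_def)
qed

text \<open>Otherwise the nonzero remainder of division by the pivot could be moved to the corner,
  where its degree is smaller.\<close>

lemma minimal_pivot_col:
  assumes min: "minimal_pivot n Q" and i: "i < n"
  shows "Q $$ (0,0) dvd Q $$ (i,0)"
proof (cases "i = 0")
  case False
  show ?thesis
  proof (rule ccontr)
    assume ndvd: "\<not> ?thesis"
    have Q: "Q \<in> carrier_mat n n" and Q0: "Q $$ (0,0) \<noteq> 0" using min by (auto simp: minimal_pivot_def)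
    define t where "t = Q $$ (i,0) div Q $$ (0,0)"
    \<comment> \<open>The row operation leaves the remainder at (i,0), and the swap brings it to the
      corner.\<close>
    define R where "R = swaprows 0 i (addrow (- t) i 0 Q)"
    have "equivalent_mat n n Q R"
      unfolding R_def using Q i False
      by (intro equivalent_mat_trans[OF _ equivalent_addrow equivalent_swaprows]) auto
    moreover have R0: "R $$ (0,0) = Q $$ (i,0) mod Q $$ (0,0)"
      unfolding R_def t_def using Q i False by (simp add: minus_div_mult_eq_mod[symmetric])
    moreover have "R $$ (0,0) \<noteq> 0" unfolding R0 using ndvd by (simp add: dvd_eq_mod_eq_0)
    moreover have "degree (R $$ (0,0)) < degree (Q $$ (0,0))"
      using degree_mod_less[OF Q0, of "Q $$ (i,0)"] \<open>R $$ (0,0) \<noteq> 0\<close> unfolding R0 by blast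
    ultimately show False using min unfolding minimal_pivot_def by (metis linorder_not_less)
  qed
qed simp

lemma minimal_pivot_row:
  assumes min: "minimal_pivot n Q" and i: "i < n"
  shows "Q $$ (0,0) dvd Q $$ (0,i)"
proof (cases "i = 0")
  case False
  show ?thesis
  proof (rule ccontr)
    assume ndvd: "\<not> ?thesis"
    have Q: "Q \<in> carrier_mat n n" and Q0: "Q $$ (0,0) \<noteq> 0" using min by (auto simp: minimal_pivot_def)
    define t where "t = Q $$ (0,i) div Q $$ (0,0)"
    define R where "R = swapcols 0 i (addcol (- t) i 0 Q)"
    have "equivalent_mat n n Q R"
      unfolding R_def using Q i False
      by (intro equivalent_mat_trans[OF _ equivalent_addcol equivalent_swapcols]) auto
    moreover have R0: "R $$ (0,0) = Q $$ (0,i) mod Q $$ (0,0)"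
      unfolding R_def t_def using Q i False by (simp add: minus_div_mult_eq_mod[symmetric])
    moreover have "R $$ (0,0) \<noteq> 0" unfolding R0 using ndvd by (simp add: dvd_eq_mod_eq_0)
    moreover have "degree (R $$ (0,0)) < degree (Q $$ (0,0))"
      using degree_mod_less[OF Q0, of "Q $$ (0,i)"] \<open>R $$ (0,0) \<noteq> 0\<close> unfolding R0 by blast
    ultimately show False using min unfolding minimal_pivot_def by (metis linorder_not_less)
  qed
qed simp

text \<open>Swaps bring a nonzero entry to the corner; among all equivalent matrices with nonzero
  corner, one of least degree is chosen.\<close>

lemma minimal_pivot_exists:
  fixes P :: "'a::field poly mat"
  assumes P: "P \<in> carrier_mat n n" and "P \<noteq> 0\<^sub>m n n"
  shows "\<exists>Q. equivalent_mat n n P Q \<and> minimal_pivot n Q"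
proof -
  obtain i j where ij: "i < n" "j < n" "P $$ (i,j) \<noteq> 0"
    using assms by (metis carrier_matD eq_matI index_zero_mat)
  let ?S = "\<lambda>Q. equivalent_mat n n P Q \<and> Q $$ (0,0) \<noteq> 0"
  have "?S (swapcols 0 j (swaprows 0 i P))"
    using P ij by (auto intro!: equivalent_mat_trans[OF _ equivalent_swaprows equivalent_swapcols])
  then obtain Q where Q: "?S Q" "\<And>R. ?S R \<Longrightarrow> degree (Q $$ (0,0)) \<le> degree (R $$ (0,0))"
    using ex_has_least_nat[of ?S _ "\<lambda>Q. degree (Q $$ (0,0))"] by blast
  then have "minimal_pivot n Q"
    unfolding minimal_pivot_def using equivalent_carrier equivalent_mat_trans[OF P] by blast
  with Q show ?thesis by blast
qed

text \<open>Divisibility of the first row and column by the pivot allows both to be cleared.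
  Minimality then also forces the pivot to divide every entry of the remaining block, which is where
  the divisibility chain originates.\<close>

lemma minimal_pivot_split:
  fixes Q :: "'a::field poly mat"
  assumes min: "minimal_pivot (1 + k) Q"
  shows "\<exists>D\<in>carrier_mat k k. equivalent_mat (1 + k) (1 + k) Q
           (four_block_mat (mat 1 1 (\<lambda>_. Q $$ (0,0))) (0\<^sub>m 1 k) (0\<^sub>m k 1) (Q $$ (0,0) \<cdot>\<^sub>m D))"
proof -
  let ?n = "1 + k"
  define a where "a = Q $$ (0,0)"
  have Q: "Q \<in> carrier_mat ?n ?n" using min by (simp add: minimal_pivot_def)
  define D where "D = mat k k (\<lambda>(i,j). Q $$ (Suc i, Suc j))"
  define t where "t = mat k 1 (\<lambda>(i,j). Q $$ (Suc i, 0) div a)"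
  define r where "r = mat 1 k (\<lambda>(i,j). Q $$ (0, Suc j) div a)"
  define A1 where "A1 = mat 1 1 (\<lambda>_ :: nat \<times> nat. a)"
  have c: "D \<in> carrier_mat k k" "t \<in> carrier_mat k 1" "r \<in> carrier_mat 1 k" "A1 \<in> carrier_mat 1 1"
    by (auto simp: D_def t_def r_def A1_def)
  have div: "Q $$ (Suc i, 0) div a * a = Q $$ (Suc i, 0)" "a * (Q $$ (0, Suc i) div a) = Q $$ (0, Suc i)"
    if "i < k" for i
    using minimal_pivot_col[OF min, of "Suc i"] minimal_pivot_row[OF min, of "Suc i"] that
    by (auto simp: a_def)
  have Q_eq: "Q = four_block_mat A1 (A1 * r) (t * A1) D"
  proof (rule eq_matI)
    fix i j assume "i < dim_row (four_block_mat A1 (A1 * r) (t * A1) D)" "j < dim_col (four_block_mat A1 (A1 * r) (t * A1) D)"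
    then have "i < Suc k" "j < Suc k" using c by auto
    then show "Q $$ (i,j) = four_block_mat A1 (A1 * r) (t * A1) D $$ (i,j)"
      using c by (cases i; cases j) (auto simp: A1_def r_def t_def D_def a_def[symmetric] scalar_prod_def div)
  qed (use Q c in auto)
  define L where "L = four_block_mat (1\<^sub>m 1) (0\<^sub>m 1 k) (- t) (1\<^sub>m k)"
  define R where "R = four_block_mat (1\<^sub>m 1) (- r) (0\<^sub>m k 1) (1\<^sub>m k)"
  define E where "E = D - t * (A1 * r)"
  have E: "E \<in> carrier_mat k k" using c by (auto simp: E_def)
  have "L * Q = four_block_mat A1 (A1 * r) (0\<^sub>m k 1) E"
    unfolding L_def Q_eq E_def using c
    by (subst mult_four_block_mat[of _ 1 1 _ k _ k])
      (auto intro!: cong_four_block_mat eq_matI simp: scalar_prod_def A1_def)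
  moreover have "four_block_mat A1 (A1 * r) (0\<^sub>m k 1) E * R = four_block_mat A1 (0\<^sub>m 1 k) (0\<^sub>m k 1) E"
    unfolding R_def using c E
    by (subst mult_four_block_mat[of _ 1 1 _ k _ k])
      (auto intro!: cong_four_block_mat eq_matI simp: scalar_prod_def A1_def)
  moreover have "equivalent_mat ?n ?n Q (L * Q)"
    unfolding L_def using c Q by (intro equivalent_mat_left four_block_lower_invertible) auto
  moreover have "equivalent_mat ?n ?n (L * Q) (L * Q * R)"
    unfolding R_def using c Q by (intro equivalent_mat_right four_block_upper_invertible) (auto simp: L_def)
  ultimately have eqv: "equivalent_mat ?n ?n Q (four_block_mat A1 (0\<^sub>m 1 k) (0\<^sub>m k 1) E)"
    using equivalent_mat_trans[OF Q] by metis
  let ?F = "four_block_mat A1 (0\<^sub>m 1 k) (0\<^sub>m k 1) E"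
  have F: "?F \<in> carrier_mat ?n ?n" using c E by auto
  have minF: "minimal_pivot ?n ?F"
    using minimal_pivot_equiv[OF min eqv] c E by (simp add: A1_def a_def)
  have dvd: "a dvd E $$ (i,j)" if ij: "i < k" "j < k" for i j
  proof -
    \<comment> \<open>Adding row i + 1 to row 0 leaves the corner alone, since the first column is
      cleared below it. The pivot stays minimal and so divides the new first row, which contains row
      i of \<open>E\<close>.\<close>
    let ?G = "addrow 1 0 (Suc i) ?F"
    have "equivalent_mat ?n ?n ?F ?G" using F ij by (intro equivalent_addrow) auto
    moreover have G0: "?G $$ (0,0) = ?F $$ (0,0)" using c E ij by simp
    ultimately have "minimal_pivot ?n ?G" by (rule minimal_pivot_equiv[OF minF])
    then have "?G $$ (0,0) dvd ?G $$ (0, Suc j)"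
      using ij by (intro minimal_pivot_row) auto
    then show ?thesis using c E ij by (simp add: A1_def)
  qed
  define D' where "D' = map_mat (\<lambda>p. p div a) E"
  have "a \<cdot>\<^sub>m D' = E"
    using E dvd by (auto simp: D'_def intro!: eq_matI)
  moreover have "D' \<in> carrier_mat k k" using E by (simp add: D'_def)
  ultimately show ?thesis using eqv unfolding A1_def a_def[symmetric] by blast
qed

lemma smith_exists:
  fixes P :: "'a::field poly mat"
  assumes "P \<in> carrier_mat n n"
  shows "\<exists>fs. length fs = n \<and> (\<forall>i. Suc i < n \<longrightarrow> fs ! i dvd fs ! Suc i) \<and>
    (\<forall>i<n. fs ! i \<noteq> 0 \<longrightarrow> lead_coeff (fs ! i) = 1) \<and> equivalent_mat n n P (diag_rect n n fs)"
  using assms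
proof (induction n arbitrary: P)
  case 0
  then have "P = diag_rect 0 0 []" by (auto simp: diag_rect_def)
  then show ?case using equivalent_mat_refl[OF 0] by (intro exI[of _ "[]"]) simp
next
  case (Suc k)
  show ?case
  proof (cases "P = 0\<^sub>m (Suc k) (Suc k)")
    case True
    have "diag_rect (Suc k) (Suc k) (replicate (Suc k) 0) = P"
      unfolding True by (auto simp: diag_rect_def simp del: replicate_Suc intro!: eq_matI)
    then show ?thesis
      using equivalent_mat_refl[OF Suc.prems]
      by (intro exI[of _ "replicate (Suc k) 0"]) (auto simp del: replicate_Suc)
  next
    case False
    obtain Q where Q: "equivalent_mat (Suc k) (Suc k) P Q" "minimal_pivot (Suc k) Q"
      using minimal_pivot_exists[OF Suc.prems False] by blast
    define a where "a = Q $$ (0,0)"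
    have a: "a \<noteq> 0" using Q(2) by (simp add: minimal_pivot_def a_def)
    obtain D where D: "D \<in> carrier_mat k k"
      and QD: "equivalent_mat (1 + k) (1 + k) Q (four_block_mat (mat 1 1 (\<lambda>_. a)) (0\<^sub>m 1 k) (0\<^sub>m k 1) (a \<cdot>\<^sub>m D))"
      using minimal_pivot_split[of k Q] Q(2) unfolding a_def by auto
    define c where "c = lead_coeff a"
    have c: "c \<noteq> 0" using a by (simp add: c_def)
    define b where "b = Polynomial.smult (inverse c) a"
    have b: "lead_coeff b = 1" using c by (simp add: b_def c_def)
    have ab: "[:inverse c:] * a = b" by (simp add: b_def)
    \<comment> \<open>With a = b c, where b is monic and c constant, the block a D equals b (c D).
      Diagonalizing c D therefore yields the remaining entries as b times monic or zero polynomials,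
      all divisible by b.\<close>
    obtain fs where fs: "length fs = k" "\<forall>i. Suc i < k \<longrightarrow> fs ! i dvd fs ! Suc i"
      "\<forall>i<k. fs ! i \<noteq> 0 \<longrightarrow> lead_coeff (fs ! i) = 1"
      and eqv: "equivalent_mat k k ([:c:] \<cdot>\<^sub>m D) (diag_rect k k fs)"
      using Suc.IH[of "[:c:] \<cdot>\<^sub>m D"] D by auto
    obtain U W where U: "U \<in> carrier_mat k k" "invertible_mat U" and W: "W \<in> carrier_mat k k" "invertible_mat W"
      and UW: "U * ([:c:] \<cdot>\<^sub>m D) * W = diag_rect k k fs"
      using eqv unfolding equivalent_mat_def by blast
    let ?L = "four_block_mat (mat 1 1 (\<lambda>_. [:inverse c:])) (0\<^sub>m 1 k) (0\<^sub>m k 1) U"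
    let ?R = "four_block_mat (mat 1 1 (\<lambda>_. 1)) (0\<^sub>m 1 k) (0\<^sub>m k 1) W"
    let ?F = "four_block_mat (mat 1 1 (\<lambda>_. a)) (0\<^sub>m 1 k) (0\<^sub>m k 1) (a \<cdot>\<^sub>m D)"
    have inv: "invertible_mat ?L" "invertible_mat ?R"
      using four_block_diag_invertible[OF U, of "[:inverse c:]" "[:c:]"] four_block_diag_invertible[OF W, of 1 1] c
      by (simp_all add: one_pCons)
    have abc: "a = b * [:c:]" using c by (simp add: b_def)
    have UDW: "U * (a \<cdot>\<^sub>m D) * W = b \<cdot>\<^sub>m diag_rect k k fs"
      unfolding UW[symmetric] abc using U(1) W(1) D
      by (auto simp: mult_smult_distrib[of _ k k _ k] mult_smult_assoc_mat[of _ k k _ k])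
    have "?L * ?F * ?R = four_block_mat (mat 1 1 (\<lambda>_. b)) (0\<^sub>m 1 k) (0\<^sub>m k 1) (U * (a \<cdot>\<^sub>m D) * W)"
    proof -
      have "?L * ?F = four_block_mat (mat 1 1 (\<lambda>_. b)) (0\<^sub>m 1 k) (0\<^sub>m k 1) (U * (a \<cdot>\<^sub>m D))"
        using U(1) D ab
        by (subst mult_four_block_mat[of _ 1 1 _ k _ k])
          (auto intro!: cong_four_block_mat eq_matI simp: scalar_prod_def)
      moreover have "four_block_mat (mat 1 1 (\<lambda>_. b)) (0\<^sub>m 1 k) (0\<^sub>m k 1) (U * (a \<cdot>\<^sub>m D)) * ?R
          = four_block_mat (mat 1 1 (\<lambda>_. b)) (0\<^sub>m 1 k) (0\<^sub>m k 1) (U * (a \<cdot>\<^sub>m D) * W)"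
        using U(1) D W(1)
        by (subst mult_four_block_mat[of _ 1 1 _ k _ k])
          (auto intro!: cong_four_block_mat eq_matI simp: scalar_prod_def)
      ultimately show ?thesis by (simp only:)
    qed
    also have "\<dots> = diag_rect (Suc k) (Suc k) (b # map ((*) b) fs)"
      unfolding UDW using fs(1) by (auto intro!: eq_matI simp: diag_rect_def nth_Cons')
    finally have "?L * ?F * ?R = diag_rect (Suc k) (Suc k) (b # map ((*) b) fs)" .
    then have "equivalent_mat (Suc k) (Suc k) ?F (diag_rect (Suc k) (Suc k) (b # map ((*) b) fs))"
      unfolding equivalent_mat_def using inv U(1) W(1)
      by (intro bexI[of _ ?L] bexI[of _ ?R]) auto
    then have "equivalent_mat (Suc k) (Suc k) P (diag_rect (Suc k) (Suc k) (b # map ((*) b) fs))"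
      using equivalent_mat_trans[OF Suc.prems Q(1)] equivalent_mat_trans[of Q "Suc k"] QD
        equivalent_carrier[OF Q(1)] by (metis plus_1_eq_Suc)
    moreover have "fs ! (i - Suc 0) dvd fs ! i" if "0 < i" "i < k" for i
      using fs(2)[rule_format, of "i - 1"] that by simp
    ultimately show ?thesis
      using fs b
      by (intro exI[of _ "b # map ((*) b) fs"])
        (auto simp: nth_Cons' lead_coeff_mult split: if_splits intro: mult_dvd_mono)
  qed
qed

section \<open>Uniqueness of invariant factors\<close>

text \<open>The number of elements of \<open>F[x] / (p)\<close> annihilated by \<open>g\<close>.  It equals \<open>q\<close> to the degree of
  \<open>gcd p g\<close>, but \<open>gcd\<close> is not available for polynomials over an arbitrary type of class \<open>field\<close>.\<close>

definition ann_count :: "'a::{field,finite} poly \<Rightarrow> 'a poly \<Rightarrow> nat" where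
  "ann_count p g = card {r \<in> low (degree p). p dvd g * r}"

lemma low_degree_iff: "r \<in> low n \<longleftrightarrow> r = 0 \<or> degree r < n"
proof (cases "n > 0")
  case False
  then show ?thesis by (auto simp: low_def poly_eq_iff)
qed (auto simp: low_degree)

text \<open>If p divides g r, then s = g r / p satisfies p s = g r, so g divides p s. The map from r
  to s is injective and takes degrees below that of p to degrees below that of g.\<close>

lemma ann_count_aux:
  fixes p g :: "'a::{field,finite} poly"
  assumes p: "p \<noteq> 0" and g: "g \<noteq> 0"
  shows "ann_count p g \<le> ann_count g p"
  unfolding ann_count_def
proof (rule card_inj_on_le[of "\<lambda>r. g * r div p"])
  have eq: "p * (g * r div p) = g * r" if "p dvd g * r" for r using that by simp
  show "inj_on (\<lambda>r. g * r div p) {r \<in> low (degree p). p dvd g * r}"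
  proof (rule inj_onI)
    fix r r' assume r: "r \<in> {r \<in> low (degree p). p dvd g * r}" "r' \<in> {r \<in> low (degree p). p dvd g * r}"
      and "g * r div p = g * r' div p"
    then have "g * r = g * r'" using eq[of r] eq[of r'] by auto
    then show "r = r'" using g by simp
  qed
  show "(\<lambda>r. g * r div p) ` {r \<in> low (degree p). p dvd g * r} \<subseteq> {r \<in> low (degree g). g dvd p * r}"
  proof clarify
    fix r assume r: "r \<in> low (degree p)" "p dvd g * r"
    show "g * r div p \<in> low (degree g) \<and> g dvd p * (g * r div p)"
    proof (cases "r = 0")
      case False
      have "degree p + degree (g * r div p) = degree g + degree r"
        using arg_cong[OF eq[OF r(2)], of degree] p g False r(2)
        by (subst (asm) degree_mult_eq) (auto simp: degree_mult_eq dvd_div_eq_0_iff)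
      then show ?thesis
        using r False eq[OF r(2)] by (auto simp: low_degree_iff)
    qed (auto simp: low_zero)
  qed
qed simp

lemma ann_count_sym: "p \<noteq> 0 \<Longrightarrow> g \<noteq> 0 \<Longrightarrow> ann_count p g = ann_count g p"
  by (intro le_antisym ann_count_aux)

lemma ann_count_le: "ann_count p g \<le> CARD('a) ^ degree p" for p :: "'a::{field,finite} poly"
  unfolding ann_count_def card_low[symmetric] by (rule card_mono) auto

lemma ann_count_pos: "ann_count p g > 0"
proof -
  have "0 \<in> {r \<in> low (degree p). p dvd g * r}" by (simp add: low_zero)
  then show ?thesis unfolding ann_count_def by (subst card_gt_0_iff) auto
qed

text \<open>If every reduced residue is annihilated by \<open>g\<close>, then so is 1, which says
  \<open>p dvd g\<close>.\<close>

lemma ann_count_eq_iff: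
  fixes p g :: "'a::{field,finite} poly"
  assumes "p \<noteq> 0"
  shows "ann_count p g = CARD('a) ^ degree p \<longleftrightarrow> p dvd g"
proof
  assume "ann_count p g = CARD('a) ^ degree p"
  then have eq: "{r \<in> low (degree p). p dvd g * r} = low (degree p)"
    unfolding ann_count_def card_low[symmetric] by (intro card_subset_eq) auto
  show "p dvd g"
  proof (cases "degree p = 0")
    case True
    then show ?thesis using assms is_unit_iff_degree[of p] unit_imp_dvd by blast
  next
    case False
    then have "1 \<in> low (degree p)" by (simp add: low_degree_iff)
    then have "1 \<in> {r \<in> low (degree p). p dvd g * r}" by (simp only: eq)
    then show ?thesis by simp
  qed
next
  assume "p dvd g"
  then have "{r \<in> low (degree p). p dvd g * r} = low (degree p)" by auto
  then show "ann_count p g = CARD('a) ^ degree p" by (simp add: ann_count_def card_low)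
qed

lemma nth_dvd_mono:
  assumes "\<forall>i. Suc i < m \<longrightarrow> fs ! i dvd (fs ! Suc i :: 'a::comm_monoid_mult)" "i \<le> j" "j < m"
  shows "fs ! i dvd fs ! j"
  using assms(2,3)
proof (induction j rule: dec_induct)
  case (step n)
  then have "fs ! i dvd fs ! n" "fs ! n dvd fs ! Suc n" using assms(1) by simp_all
  then show ?case by (rule dvd_trans)
qed simp

text \<open>Each factor \<open>ann_count (f\<^sub>i) (g\<^sub>j)\<close> with \<open>i \<ge> j\<close> is at most \<open>q\<close> to the degree of \<open>g\<^sub>j\<close>, with equality
  iff \<open>g\<^sub>j\<close> divides \<open>f\<^sub>i\<close>; equality of the products forces equality in every factor.\<close>

lemma invariant_factors_dvd:
  fixes fs gs :: "'a::{field,finite} poly list"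
  assumes gs: "\<forall>i. Suc i < m \<longrightarrow> gs ! i dvd gs ! Suc i"
    and nz: "\<And>i. i < m \<Longrightarrow> fs ! i \<noteq> 0" "\<And>i. i < m \<Longrightarrow> gs ! i \<noteq> 0"
    and count: "(\<Prod>i<m. ann_count (fs ! i) (gs ! j)) = (\<Prod>i<m. ann_count (gs ! i) (gs ! j))"
    and eq: "\<And>i. i < j \<Longrightarrow> fs ! i = gs ! i" and j: "j < m"
  shows "gs ! j dvd fs ! j"
proof -
  let ?N = "CARD('a) ^ degree (gs ! j)"
  have split: "(\<Prod>i<m. f i) = (\<Prod>i<j. f i) * (\<Prod>i\<in>{j..<m}. f i)" for f :: "nat \<Rightarrow> nat"
    using prod.atLeastLessThan_concat[of 0 j m f] j by (simp add: atLeast0LessThan)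
  have prefix_eq: "(\<Prod>i<j. ann_count (fs ! i) (gs ! j)) = (\<Prod>i<j. ann_count (gs ! i) (gs ! j))"
    by (rule prod.cong) (auto simp: eq)
  have prefix_pos: "(\<Prod>i<j. ann_count (gs ! i) (gs ! j)) > 0"
    by (intro prod_pos) (simp add: ann_count_pos)
  have "(\<Prod>i\<in>{j..<m}. ann_count (fs ! i) (gs ! j)) = (\<Prod>i\<in>{j..<m}. ann_count (gs ! i) (gs ! j))"
    using count by (simp only: split prefix_eq nat_mult_eq_cancel1[OF prefix_pos])
  also have "\<dots> = (\<Prod>i\<in>{j..<m}. ?N)"
  proof (rule prod.cong[OF refl])
    fix i assume i: "i \<in> {j..<m}"
    then have "gs ! j dvd gs ! i" using nth_dvd_mono[OF gs, of j i] by auto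
    then have "ann_count (gs ! j) (gs ! i) = ?N" using ann_count_eq_iff nz(2)[OF j] by blast
    then show "ann_count (gs ! i) (gs ! j) = ?N"
      using ann_count_sym[of "gs ! i" "gs ! j"] nz i j by auto
  qed
  finally have prod: "(\<Prod>i\<in>{j..<m}. ann_count (fs ! i) (gs ! j)) = (\<Prod>i\<in>{j..<m}. ?N)" .
  have le: "ann_count (fs ! i) (gs ! j) \<le> ?N" if "i < m" for i
    using ann_count_le[of "gs ! j" "fs ! i"] ann_count_sym[of "fs ! i" "gs ! j"] nz that j by simp
  have "ann_count (fs ! j) (gs ! j) = ?N"
  proof (rule ccontr)
    assume "ann_count (fs ! j) (gs ! j) \<noteq> ?N"
    then have "ann_count (fs ! j) (gs ! j) < ?N" using le[OF j] by simp
    then have "(\<Prod>i\<in>{j..<m}. ann_count (fs ! i) (gs ! j)) < (\<Prod>i\<in>{j..<m}. ?N)"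
      using j le by (intro prod_mono_strict[of j]) auto
    then show False using prod by simp
  qed
  then show ?thesis
    using ann_count_sym[of "fs ! j" "gs ! j"] ann_count_eq_iff[of "gs ! j" "fs ! j"] nz j by auto
qed

text \<open>Strong induction on the index: once the earlier factors agree,
  \<open>invariant_factors_dvd\<close> applies in both directions, and monic polynomials dividing
  each other are equal.\<close>

lemma invariant_factors_unique:
  fixes fs gs :: "'a::{field,finite} poly list"
  assumes fs: "length fs = m" "\<forall>i. Suc i < m \<longrightarrow> fs ! i dvd fs ! Suc i" "\<And>i. i < m \<Longrightarrow> lead_coeff (fs ! i) = 1"
    and gs: "length gs = m" "\<forall>i. Suc i < m \<longrightarrow> gs ! i dvd gs ! Suc i" "\<And>i. i < m \<Longrightarrow> lead_coeff (gs ! i) = 1"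
    and count: "\<And>g. (\<Prod>i<m. ann_count (fs ! i) g) = (\<Prod>i<m. ann_count (gs ! i) g)"
  shows "fs = gs"
proof -
  have nz: "i < m \<Longrightarrow> fs ! i \<noteq> 0" "i < m \<Longrightarrow> gs ! i \<noteq> 0" for i
    using fs(3)[of i] gs(3)[of i] by auto
  have "fs ! j = gs ! j" if "j < m" for j
    using that
  proof (induction j rule: less_induct)
    case (less j)
    then have eq: "fs ! i = gs ! i" if "i < j" for i using that by auto
    have "gs ! j dvd fs ! j"
      by (rule invariant_factors_dvd[OF gs(2) nz count _ less.prems]) (simp_all add: eq)
    moreover have "fs ! j dvd gs ! j"
      by (rule invariant_factors_dvd[OF fs(2) nz(2) nz(1) count[symmetric] _ less.prems]) (simp_all add: eq)
    ultimately show ?case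
      using fs(3) gs(3) less.prems by (intro poly_dvd_antisym) auto
  qed
  then show ?thesis using fs(1) gs(1) by (intro nth_equalityI) auto
qed

section \<open>Kernel sizes as invariants of the module\<close>

context fin_operator
begin

text \<open>A zero on the diagonal would make its generator free, and the vectors x^n X_i would be
  infinitely many elements of the finite set \<open>V\<close>.\<close>

lemma presents_diag_nonzero:
  assumes presents: "presents m X (diag_rect m m fs)" and i: "i < m"
  shows "fs ! i \<noteq> 0"
proof
  assume 0: "fs ! i = 0"
  have "inj (\<lambda>n :: nat. poly_act (monom 1 n) (X i))"
  proof (rule injI)
    fix n n' :: nat assume eq: "poly_act (monom 1 n) (X i) = poly_act (monom 1 n') (X i)"
    let ?u = "\<lambda>k. (monom 1 n - monom 1 n') * unit_seq i k :: 'a poly"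
    have u: "?u \<in> fvec m" using i by (intro fvec_scale unit_seq_fvec)
    have "gen_eval m X ?u = 0" unfolding gen_eval_scale gen_eval_unit[OF i] poly_act_diff using eq by simp
    then obtain w where "?u = mat_apply (diag_rect m m fs) w"
      using presents_ker[OF presents u] by blast
    from fun_cong[OF this, of i] have "monom 1 n = (monom 1 n' :: 'a poly)"
      using i 0 by (simp add: mat_apply_diag unit_seq_def)
    then have "degree (monom 1 n :: 'a poly) = degree (monom 1 n' :: 'a poly)" by simp
    then show "n = n'" by (simp add: degree_monom_eq)
  qed
  moreover have "range (\<lambda>n :: nat. poly_act (monom 1 n) (X i)) \<subseteq> V"
    using poly_act_V seqsD(1)[OF presents_seqs[OF presents] i] by auto
  ultimately show False
    using finite_imageD[OF finite_subset[OF _ V_fin]] infinite_UNIV_nat by blast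
qed

text \<open>\<open>V\<close> is the direct sum of the F[x] / (f_i), and g acts on each summand. The
  left-hand side does not involve the presentation, so the product is an invariant of the
  operator.\<close>

lemma card_ker_diag:
  assumes presents: "presents m X (diag_rect m m fs)"
  shows "card {v\<in>V. poly_act g v = 0} = (\<Prod>i<m. ann_count (fs ! i) g)"
proof -
  note nz = presents_diag_nonzero[OF presents]
  let ?R = "seqs m (\<lambda>i. low (degree (fs ! i)))"
  let ?K = "seqs m (\<lambda>i. {r \<in> low (degree (fs ! i)). fs ! i dvd g * r})"
  have ker: "gen_eval m X u = 0 \<longleftrightarrow> (\<forall>i<m. fs ! i dvd u i)" if u: "u \<in> fvec m" for u
    unfolding presents_ker[OF presents u] mat_apply_diag
  proof
    assume dvd: "\<forall>i<m. fs ! i dvd u i"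
    have "u = (\<lambda>i. if i < m then fs ! i * (if i < m then u i div fs ! i else 0) else 0)"
      using dvd u by (auto simp: fun_eq_iff seqs_def)
    then show "\<exists>w\<in>fvec m. u = (\<lambda>i. if i < m then fs ! i * w i else 0)"
      by (intro bexI[of _ "\<lambda>i. if i < m then u i div fs ! i else 0"]) (auto simp: seqs_def)
  qed auto
  have RU: "u \<in> fvec m" if "u \<in> seqs m B" for u :: "nat \<Rightarrow> 'a poly" and B using that by (auto simp: seqs_def)
  have inj: "inj_on (gen_eval m X) ?R"
  proof (rule inj_onI)
    fix u w assume u: "u \<in> ?R" and w: "w \<in> ?R" and eq: "gen_eval m X u = gen_eval m X w"
    have "u - w \<in> fvec m" using RU[OF u] RU[OF w] by (rule fvec_diff)
    moreover have "gen_eval m X (u - w) = 0" using eq by (simp only: gen_eval_diff) simp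
    ultimately have dvd: "\<forall>i<m. fs ! i dvd (u - w) i" by (simp only: ker)
    have "u i = w i" for i
    proof (cases "i < m")
      case True
      then have "u i - w i \<in> low (degree (fs ! i))" using u w by (intro low_diff) (auto simp: seqs_def)
      \<comment> \<open>A multiple of f_i of smaller degree than f_i is 0.\<close>
      moreover have "fs ! i dvd u i - w i" using dvd True by simp
      ultimately have "u i - w i = 0"
        using dvd_imp_degree_le[of "fs ! i" "u i - w i"]
        by (cases "u i - w i = 0") (auto simp: low_degree_iff)
      then show ?thesis by simp
    qed (use u w in \<open>auto simp: seqs_def\<close>)
    then show "u = w" by blast
  qed
  have surj: "\<exists>r\<in>?R. gen_eval m X r = v" if v: "v \<in> V" for v
  proof -
    obtain u where u: "u \<in> fvec m" "gen_eval m X u = v" using presents_surj[OF presents v] by blast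
    define r where "r = (\<lambda>i. if i < m then u i mod fs ! i else 0)"
    have r: "r \<in> ?R"
      using nz degree_mod_less by (auto simp: r_def seqs_def low_degree_iff)
    have "gen_eval m X (u - r) = 0"
      using u(1) r by (subst ker) (auto simp: r_def fvec_diff RU minus_mod_eq_mult_div)
    then have "gen_eval m X r = v" using u by (simp add: gen_eval_diff)
    with r show ?thesis by blast
  qed
  have "{v\<in>V. poly_act g v = 0} = gen_eval m X ` ?K"
  proof (intro subset_antisym subsetI)
    fix v assume v: "v \<in> {v\<in>V. poly_act g v = 0}"
    then obtain r where r: "r \<in> ?R" "gen_eval m X r = v" using surj by blast
    have "gen_eval m X (\<lambda>i. g * r i) = 0" unfolding gen_eval_scale r(2) using v by simp
    then have "\<forall>i<m. fs ! i dvd g * r i" using ker[OF fvec_scale[OF RU[OF r(1)]]] by blast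
    then have "r \<in> ?K" using r(1) by (auto simp: seqs_def)
    with r(2) show "v \<in> gen_eval m X ` ?K" by blast
  next
    fix v assume "v \<in> gen_eval m X ` ?K"
    then obtain r where r: "r \<in> ?K" "v = gen_eval m X r" by blast
    then have "\<forall>i<m. fs ! i dvd g * r i" by (auto simp: seqs_def)
    then have "gen_eval m X (\<lambda>i. g * r i) = 0" using ker[OF fvec_scale[OF RU[OF r(1)]]] by blast
    then show "v \<in> {v\<in>V. poly_act g v = 0}"
      using r gen_eval_V[OF presents_seqs[OF presents]] by (simp add: gen_eval_scale)
  qed
  moreover have "?K \<subseteq> ?R" by (auto simp: seqs_def)
  ultimately have "card {v\<in>V. poly_act g v = 0} = card ?K"
    using inj by (simp add: card_image inj_on_subset)
  then show ?thesis by (simp add: card_seqs ann_count_def)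
qed

text \<open>A Smith form of \<open>P\<close> presents the same module as \<open>ps\<close>, so the
  kernel sizes agree for every g and the two diagonals coincide.\<close>

lemma presents_imp_equivalent:
  assumes P: "presents m X P" and D: "presents m Y (diag_rect m m ps)" and ps: "invariant_factor_tuple m ps"
  shows "equivalent_mat m m P (diag_rect m m ps)"
proof -
  obtain fs where fs: "length fs = m" "\<forall>i. Suc i < m \<longrightarrow> fs ! i dvd fs ! Suc i"
    "\<forall>i<m. fs ! i \<noteq> 0 \<longrightarrow> lead_coeff (fs ! i) = 1" and eqv: "equivalent_mat m m P (diag_rect m m fs)"
    using smith_exists[OF presents_carrier[OF P]] by blast
  obtain Z where Z: "presents m Z (diag_rect m m fs)" using presents_equiv[OF P eqv] by blast
  have "fs = ps"
  proof (rule invariant_factors_unique[of _ m])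
    show "\<And>g. (\<Prod>i<m. ann_count (fs ! i) g) = (\<Prod>i<m. ann_count (ps ! i) g)"
      by (simp flip: card_ker_diag[OF Z] card_ker_diag[OF D])
    show "\<And>i. i < m \<Longrightarrow> lead_coeff (fs ! i) = 1" using fs(3) presents_diag_nonzero[OF Z] by blast
  qed (use fs ps in \<open>auto simp: invariant_factor_tuple_def\<close>)
  with eqv show ?thesis by simp
qed

end

section \<open>Centralizers and splitting generators of a matrix\<close>

lemma equivalent_mat_sym:
  assumes P: "P \<in> carrier_mat n n" and eqv: "equivalent_mat n n P Q"
  shows "equivalent_mat n n Q P"
proof -
  obtain A B where A: "A \<in> carrier_mat n n" "invertible_mat A" and B: "B \<in> carrier_mat n n" "invertible_mat B"
    and Q: "A * P * B = Q"
    using eqv unfolding equivalent_mat_def by blast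
  obtain A' where A': "A' \<in> carrier_mat n n" "A * A' = 1\<^sub>m n" "A' * A = 1\<^sub>m n"
    using invertible_mat_obtain[OF A(2,1)] .
  obtain B' where B': "B' \<in> carrier_mat n n" "B * B' = 1\<^sub>m n" "B' * B = 1\<^sub>m n"
    using invertible_mat_obtain[OF B(2,1)] .
  have "A' * Q * B' = (A' * A) * P * (B * B')"
    unfolding Q[symmetric] using A(1) A'(1) B(1) B'(1) P by (simp add: assoc_mult_mat[of _ n n _ n _ n])
  also have "\<dots> = P" using P A'(3) B'(2) by simp
  finally have "A' * Q * B' = P" .
  moreover have "invertible_mat A'" "invertible_mat B'"
    using invertible_matI[OF A'(1) A(1) A'(3,2)] invertible_matI[OF B'(1) B(1) B'(3,2)] by auto
  ultimately show ?thesis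
    unfolding equivalent_mat_def using A'(1) B'(1) by blast
qed

context fin_operator
begin

text \<open>Sending a splitting tuple to its monic relation matrix maps onto the matrices counted by
  \<open>mu\<close>. The fibre size \<open>c\<close> is kept abstract here; for a matrix it is the
  order of the centralizer.\<close>

lemma card_splitting_gens_eq_mu:
  assumes card: "card V = CARD('a) ^ (m * d)" and d: "d > 0" and ps: "invariant_factor_tuple m ps"
    and X0: "presents m X0 (diag_rect m m ps)"
    and c: "\<And>P X. presents m X P \<Longrightarrow> card {Y. presents m Y P} = c"
  shows "card {X. splitting_gens m d X} = c * mu m m d ps"
proof -
  let ?S = "{P \<in> monic_mat_polys m m d. has_invariant_factors m m P ps}"
  define g where "g X = (THE P. P \<in> monic_mat_polys m m d \<and> presents m X P)" for X
  have g: "g X \<in> monic_mat_polys m m d \<and> presents m X (g X)" if "splitting_gens m d X" for X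
    unfolding g_def by (rule theI'[OF splitting_gens_ex1_presents[OF card d that]])
  have g_eq: "g X = P" if "P \<in> monic_mat_polys m m d" "presents m X P" for X P
    unfolding g_def using that by (intro the1_equality splitting_gens_ex1_presents[OF card d presents_monic_splitting_gens[OF d that]]) simp
  have fiber: "{X \<in> {X. splitting_gens m d X}. g X = P} = {X. presents m X P}" if "P \<in> monic_mat_polys m m d" for P
  proof (intro subset_antisym subsetI)
    fix X assume "X \<in> {X \<in> {X. splitting_gens m d X}. g X = P}"
    then show "X \<in> {X. presents m X P}" using g[of X] by auto
  next
    fix X assume "X \<in> {X. presents m X P}"
    then show "X \<in> {X \<in> {X. splitting_gens m d X}. g X = P}"
      using presents_monic_splitting_gens[OF d that] g_eq[OF that] by simp
  qed
  have S: "g ` {X. splitting_gens m d X} = ?S"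
  proof (intro subset_antisym subsetI)
    fix P assume "P \<in> g ` {X. splitting_gens m d X}"
    then obtain X where "splitting_gens m d X" "P = g X" by auto
    then have "P \<in> monic_mat_polys m m d" "presents m X P" using g[of X] by simp_all
    then show "P \<in> ?S"
      using presents_imp_equivalent[OF \<open>presents m X P\<close> X0 ps] ps presents_carrier[OF \<open>presents m X P\<close>]
      by (simp add: has_invariant_factors_def)
  next
    fix P assume P: "P \<in> ?S"
    \<comment> \<open>Read from the diagonal form towards \<open>P\<close>, the equivalence changes
      the generators \<open>X0\<close> into generators presenting \<open>P\<close>.\<close>
    then have "equivalent_mat m m (diag_rect m m ps) P"
      using equivalent_mat_sym[of P m "diag_rect m m ps"] by (auto simp: has_invariant_factors_def)
    then obtain X where X: "presents m X P" using presents_equiv[OF X0] by auto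
    have P': "P \<in> monic_mat_polys m m d" using P by simp
    show "P \<in> g ` {X. splitting_gens m d X}"
      using g_eq[OF P' X] presents_monic_splitting_gens[OF d P' X] by (intro image_eqI[of _ _ X]) auto
  qed
  have "card {X. splitting_gens m d X} = (\<Sum>P\<in>?S. card {X \<in> {X. splitting_gens m d X}. g X = P})"
    using sum.image_gen[OF finite_splitting_gens, of "\<lambda>_. 1 :: nat" m d g] by (simp add: S)
  also have "\<dots> = (\<Sum>P\<in>?S. c)"
  proof (rule sum.cong[OF refl])
    fix P assume P: "P \<in> ?S"
    then have "P \<in> g ` {X. splitting_gens m d X}" using S by simp
    then obtain X where "splitting_gens m d X" "P = g X" by auto
    then have "presents m X P" using g[of X] by simp
    then have "card {Y. presents m Y P} = c" by (rule c)
    then show "card {X \<in> {X. splitting_gens m d X}. g X = P} = c" using P fiber[of P] by simp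
  qed
  finally show ?thesis by (simp add: mu_def mult.commute)
qed

end

section \<open>Presenting a matrix by x I - A\<close>

lemma char_poly_matrix_monic: "A \<in> carrier_mat n n \<Longrightarrow> char_poly_matrix A \<in> monic_mat_polys n n 1"
  by (rule monic_mat_polysI) (auto simp: char_poly_matrix_def low_def coeff_pCons monom_Suc monom_0 one_pCons split: nat.splits)

text \<open>This is the case d = 1 of the theory of monic matrix polynomials: the standard basis
  generates with constant coefficients, and x I - A is monic of degree 1.\<close>

lemma mat_presents_char_poly_matrix:
  fixes A :: "'a::{field,finite} mat"
  assumes A: "A \<in> carrier_mat n n"
  shows "mat_presents A n (\<lambda>j. if j < n then unit_seq j else 0) (char_poly_matrix A)"
proof -
  interpret fin_operator vscale "mat_apply A" "fvec n" using A by (rule fin_operator_mat)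
  let ?X = "\<lambda>j. if j < n then unit_seq j else 0 :: nat \<Rightarrow> 'a"
  have evc: "gen_eval n ?X (\<lambda>j. [:v j:]) = v" if "v \<in> fvec n" for v
  proof -
    have "gen_eval n ?X (\<lambda>j. [:v j:]) = (\<Sum>j<n. (\<lambda>i. v j * unit_seq j i))"
      by (simp add: gen_eval_def poly_act_const)
    then show ?thesis using seq_decomp[OF that] by simp
  qed
  have "splitting_gens n 1 ?X"
    unfolding splitting_gens_def
  proof (intro conjI ballI)
    show "?X \<in> seqs n (\<lambda>_. fvec n)" by (simp add: seqs_def[of n "\<lambda>_. fvec n"])
    fix v :: "nat \<Rightarrow> 'a" assume v: "v \<in> fvec n"
    then have "(\<lambda>j. [:v j:]) \<in> seqs n (\<lambda>_. low 1)" by (auto simp: seqs_def low_degree)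
    with evc[OF v] show "\<exists>u\<in>seqs n (\<lambda>_. low 1). gen_eval n ?X u = v" by blast
  qed
  moreover have "gen_eval n ?X (mat_apply (char_poly_matrix A) (unit_seq j)) = 0" if j: "j < n" for j
  proof -
    \<comment> \<open>Column j is x e_j minus the constant vector A e_j; x acts as A, so its value
      is 0.\<close>
    have "mat_apply (char_poly_matrix A) (unit_seq j)
        = (\<lambda>i. [:0,1:] * unit_seq j i) - (\<lambda>i. [:mat_apply A (unit_seq j) i:])"
      unfolding mat_apply_unit[OF monic_mat_polysD(1)[OF char_poly_matrix_monic[OF A]] j] mat_apply_unit[OF A j]
      using A j by (auto simp: char_poly_matrix_def fun_eq_iff unit_seq_def)
    then have "gen_eval n ?X (mat_apply (char_poly_matrix A) (unit_seq j)) = poly_act [:0,1:] (gen_eval n ?X (unit_seq j)) - mat_apply A (unit_seq j)"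
      by (simp only: gen_eval_diff gen_eval_scale evc[OF mat_apply_fvec[OF A]])
    also have "\<dots> = 0"
      using j by (simp add: gen_eval_unit poly_act_X)
    finally show ?thesis .
  qed
  ultimately have "presents n ?X (char_poly_matrix A)"
    by (intro presents_monicI[of n 1] char_poly_matrix_monic[OF A]) (auto simp: card_fvec)
  then show ?thesis using A by auto
qed

lemma mat_presents_of_padded:
  fixes A :: "'a::{field,finite} mat"
  assumes A: "A \<in> carrier_mat (m * d) (m * d)" and d: "d > 0"
    and inv: "has_invariant_factors (m * d) (m * d) (char_poly_matrix A) (padded m d ps)"
  shows "\<exists>X. mat_presents A m X (diag_rect m m ps)"
proof -
  let ?n = "m * d" and ?k = "m * (d - 1)"
  interpret fin_operator vscale "mat_apply A" "fvec ?n" using A by (rule fin_operator_mat)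
  have n: "?n = ?k + m" using d by (cases d) auto
  obtain Y where "presents ?n Y (diag_rect ?n ?n (padded m d ps))"
    using presents_equiv[of ?n _ "char_poly_matrix A"] mat_presents_char_poly_matrix[OF A] A inv
    unfolding has_invariant_factors_def by auto
  then have "presents m (\<lambda>j. Y (?k + j)) (diag_rect m m ps)"
    unfolding padded_def by (intro presents_drop_ones) (simp only: n[symmetric])
  then show ?thesis using A by auto
qed

text \<open>Reduced residues as fixed points of \<open>mod\<close>, so that closure properties
  reduce to the algebra of \<open>mod\<close>.\<close>

lemma low_iff_mod:
  fixes p :: "'a::field poly"
  assumes "p \<noteq> 0" shows "r \<in> low (degree p) \<longleftrightarrow> r mod p = r"
proof
  assume "r \<in> low (degree p)"
  then show "r mod p = r" by (auto simp: low_degree_iff mod_poly_less)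
next
  assume "r mod p = r"
  then show "r \<in> low (degree p)"
    using degree_mod_less[OF assms, of r] by (simp add: low_degree_iff)
qed

text \<open>The witness is the matrix of multiplication by \<open>x\<close> on \<open>\<Oplus>\<^sub>i F[x] / (f\<^sub>i)\<close>, realized on reduced
  residues.\<close>

lemma exists_matrix_with_invariant_factors:
  fixes fs :: "'a::{field,finite} poly list"
  assumes fs: "invariant_factor_tuple n fs" and deg: "tuple_degree fs = n"
  shows "\<exists>A\<in>carrier_mat n n. has_invariant_factors n n (char_poly_matrix A) fs"
proof -
  \<comment> \<open>The value 1 outside the range makes residues vanish there, so membership in
    \<open>V\<close> becomes one condition for all indices.\<close>
  define F where "F i = (if i < n then fs ! i else 1)" for i
  have len: "length fs = n" using fs by (simp add: invariant_factor_tuple_def)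
  have F0: "F i \<noteq> 0" for i
    using fs by (auto simp: F_def invariant_factor_tuple_def)
  define V :: "(nat \<Rightarrow> 'a poly) set" where "V = seqs n (\<lambda>i. low (degree (F i)))"
  have V_iff: "r \<in> V \<longleftrightarrow> (\<forall>i. r i mod F i = r i)" for r
  proof -
    have "r \<in> V \<longleftrightarrow> (\<forall>i<n. r i mod F i = r i) \<and> (\<forall>i\<ge>n. r i mod F i = r i)"
      unfolding V_def seqs_def mem_Collect_eq by (auto simp: low_iff_mod[OF F0]) (auto simp: F_def)
    also have "\<dots> \<longleftrightarrow> (\<forall>i. r i mod F i = r i)" by (metis linorder_not_less)
    finally show ?thesis .
  qed
  have "(\<Sum>i<n. degree (fs ! i)) = degree (prod_list fs)"
  proof -
    have "degree (\<Prod>i<n. fs ! i) = (\<Sum>i<n. degree (fs ! i))"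
      using F0 by (intro degree_prod_eq_sum_degree) (metis F_def lessThan_iff)
    moreover have "prod_list fs = (\<Prod>i<n. fs ! i)"
      by (simp add: prod.list_conv_set_nth len atLeast0LessThan)
    ultimately show ?thesis by simp
  qed
  then have card_V: "card V = CARD('a) ^ n"
    using deg by (simp add: V_def card_seqs card_low F_def power_sum[symmetric] tuple_degree_def)
  define s :: "'a \<Rightarrow> (nat \<Rightarrow> 'a poly) \<Rightarrow> nat \<Rightarrow> 'a poly" where "s c r = (\<lambda>i. Polynomial.smult c (r i))" for c r
  define T where "T r = (\<lambda>i. ([:0,1:] * r i) mod F i)" for r
  interpret vs: vector_space s
    by standard (auto simp: s_def fun_eq_iff smult_add_left smult_add_right)
  interpret F: fin_operator s T V
  proof unfold_locales
    show "T (x + y) = T x + T y" for x y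
      by (rule ext) (simp only: T_def plus_fun_apply distrib_left poly_mod_add_left)
    show "T (s c x) = s c (T x)" for c x
      by (rule ext) (simp only: T_def s_def mult_smult_right mod_smult_left)
    show "vs.subspace V"
      by (auto simp: vs.subspace_def V_iff s_def poly_mod_add_left mod_smult_left)
    show "T x \<in> V" if "x \<in> V" for x using that by (auto simp: V_iff T_def)
    show "finite V" unfolding V_def by (rule finite_seqs) simp
  qed
  \<comment> \<open>Reduction of 1 matters for f_j = 1, where the residue ring is trivial and the
    generator must be 0.\<close>
  define X where "X j = (\<lambda>i. if i = j then 1 mod F i else 0)" for j
  have poly_act: "F.poly_act p r = (\<lambda>i. (p * r i) mod F i)" if r: "r \<in> V" for p r
  proof (induction p)
    case (pCons a p)
    have "Polynomial.smult a (r i) + [:0,1:] * (p * r i mod F i) mod F i = pCons a p * r i mod F i" for i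
    proof -
      have "pCons a p * r i mod F i = (Polynomial.smult a (r i) + [:0,1:] * (p * r i)) mod F i"
        by simp
      also have "\<dots> = Polynomial.smult a (r i mod F i) + ([:0,1:] * (p * r i)) mod F i"
        by (simp only: poly_mod_add_left mod_smult_left)
      also have "\<dots> = Polynomial.smult a (r i) + [:0,1:] * (p * r i mod F i) mod F i"
        using r by (simp only: V_iff mod_mult_right_eq)
      finally show ?thesis by simp
    qed
    then show ?case
      unfolding F.poly_act_pCons pCons.IH by (intro ext) (simp only: plus_fun_apply s_def T_def)
  qed (simp add: fun_eq_iff)
  have XV: "X j \<in> V" for j by (auto simp: V_iff X_def)
  have gen_eval: "F.gen_eval n X u = (\<lambda>i. u i mod F i)" if u: "u \<in> fvec n" for u
  proof
    fix i
    have "F.gen_eval n X u i = (\<Sum>j<n. if i = j then u i mod F i else 0)"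
      unfolding F.gen_eval_def sum_fun_apply poly_act[OF XV]
      by (rule sum.cong) (auto simp: X_def mod_mult_right_eq)
    also have "\<dots> = u i mod F i" using u by (auto simp: seqs_def)
    finally show "F.gen_eval n X u i = u i mod F i" .
  qed
  have presX: "F.presents n X (diag_rect n n fs)"
    unfolding F.presents_def
  proof (intro conjI ballI)
    show "diag_rect n n fs \<in> carrier_mat n n" by (simp add: diag_rect_def)
    show "X \<in> seqs n (\<lambda>_. V)"
      unfolding seqs_def using XV by (auto simp: X_def F_def fun_eq_iff)
    show "\<exists>u\<in>fvec n. F.gen_eval n X u = v" if v: "v \<in> V" for v
    proof -
      have "v \<in> fvec n" using v by (auto simp: V_def seqs_def)
      then show ?thesis using gen_eval v by (intro bexI[of _ v]) (auto simp: V_iff)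
    qed
    fix u :: "nat \<Rightarrow> 'a poly" assume u: "u \<in> fvec n"
    show "F.gen_eval n X u = 0 \<longleftrightarrow> (\<exists>w\<in>fvec n. u = mat_apply (diag_rect n n fs) w)"
      unfolding gen_eval[OF u] mat_apply_diag
    proof
      assume *: "(\<lambda>i. u i mod F i) = 0"
      have eq: "F i * (u i div F i) = u i" for i
        using fun_cong[OF *, of i] by (simp add: mod_eq_0_iff_dvd)
      have "u = (\<lambda>i. if i < n then fs ! i * (u i div F i) else 0)"
      proof
        fix i
        show "u i = (if i < n then fs ! i * (u i div F i) else 0)"
          using eq[of i] u by (cases "i < n") (auto simp: F_def seqs_def)
      qed
      then show "\<exists>w\<in>fvec n. u = (\<lambda>i. if i < n then fs ! i * w i else 0)"
        using u by (intro bexI[of _ "\<lambda>i. u i div F i"]) (auto simp: seqs_def)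
    next
      assume "\<exists>w\<in>fvec n. u = (\<lambda>i. if i < n then fs ! i * w i else 0)"
      then obtain w where "u = (\<lambda>i. if i < n then fs ! i * w i else 0)" by blast
      then show "(\<lambda>i. u i mod F i) = 0" by (simp add: fun_eq_iff F_def)
    qed
  qed
  \<comment> \<open>\<open>V\<close> has q^n elements, so it has a basis of n vectors over F; in the
    coordinates \<open>h\<close> the operator becomes the desired matrix.\<close>
  obtain B where B: "B \<in> seqs n (\<lambda>_. V)" and bij: "bij_betw (F.scalar_comb n B) (fvec n) V"
    using F.exists_basis[OF F.V_sub F.V_fin card_V] by blast
  define h where "h = inv_into (fvec n) (F.scalar_comb n B)"
  have h: "h v \<in> fvec n" "F.scalar_comb n B (h v) = v" if "v \<in> V" for v
    using that bij_betw_imp_surj_on[OF bij] unfolding h_def by (auto simp: inv_into_into f_inv_into_f)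
  have h': "h (F.scalar_comb n B c) = c" if "c \<in> fvec n" for c
    using that bij_betw_imp_inj_on[OF bij] unfolding h_def by simp
  have combV: "F.scalar_comb n B c \<in> V" for c using F.scalar_comb_in[OF F.V_sub B] .
  have h_add: "h (v + w) = h v + h w" if "v \<in> V" "w \<in> V" for v w
    using h'[OF fvec_add[OF h(1)[OF that(1)] h(1)[OF that(2)]]]
    by (simp only: F.scalar_comb_add h(2)[OF that(1)] h(2)[OF that(2)])
  have h_scale: "h (s a v) = (\<lambda>i. a * h v i)" if "v \<in> V" for v a
    using h'[OF fvec_scale[OF h(1)[OF that], of a]] by (simp only: F.scalar_comb_scale h(2)[OF that])
  have "\<exists>A\<in>carrier_mat n n. \<forall>c\<in>fvec n. mat_apply A c = h (T (F.scalar_comb n B c))"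
  proof (rule linear_on_fvec_mat)
    show "h (T (F.scalar_comb n B (v + w))) = h (T (F.scalar_comb n B v)) + h (T (F.scalar_comb n B w))" for v w
      by (simp only: F.scalar_comb_add F.T_add h_add F.V_T combV)
    show "h (T (F.scalar_comb n B (\<lambda>i. c * v i))) = (\<lambda>i. c * h (T (F.scalar_comb n B v)) i)" for c v
      by (simp only: F.scalar_comb_scale F.T_scale h_scale F.V_T combV)
    show "h (T (F.scalar_comb n B v)) \<in> fvec n" for v by (intro h F.V_T combV)
  qed
  then obtain A where A: "A \<in> carrier_mat n n" and A_eq: "\<And>c. c \<in> fvec n \<Longrightarrow> mat_apply A c = h (T (F.scalar_comb n B c))"
    by blast
  interpret fin_operator_pair s T V vscale "mat_apply A" "fvec n"
    using F.fin_operator_axioms fin_operator_mat[OF A] by (simp add: fin_operator_pair_def)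
  have D: "O2.presents n (\<lambda>j. h (X j)) (diag_rect n n fs)"
  proof (rule presents_transport)
    show "bij_betw h V (fvec n)" unfolding h_def by (rule bij_betw_inv_into[OF bij])
    show "h (T v) = mat_apply A (h v)" if "v \<in> V" for v using that by (simp add: A_eq h)
    show "h (v + w) = h v + h w" if "v \<in> V" "w \<in> V" for v w using that by (rule h_add)
    show "h (s c v) = (\<lambda>i. c * h v i)" if "v \<in> V" for c v using that by (rule h_scale)
  qed (rule presX)
  have "O2.presents n (\<lambda>j. if j < n then unit_seq j else 0) (char_poly_matrix A)"
    using mat_presents_char_poly_matrix[OF A] A by auto
  then have "equivalent_mat n n (char_poly_matrix A) (diag_rect n n fs)"
    by (rule O2.presents_imp_equivalent[OF _ D fs])
  then show ?thesis
    using A fs by (intro bexI[of _ A]) (auto simp: has_invariant_factors_def char_poly_matrix_def)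
qed

lemma invariant_factor_tuple_pad:
  "invariant_factor_tuple m ps \<Longrightarrow> invariant_factor_tuple (k + m) (replicate k 1 @ ps)"
  unfolding invariant_factor_tuple_def
proof (elim conjE, intro conjI allI impI, goal_cases)
  case (3 i)
  show ?case
  proof (cases "i < k")
    case False
    then have "Suc i - k = Suc (i - k)" by simp
    then show ?thesis using 3 False by (auto simp: nth_append)
  qed (simp add: nth_append)
qed (auto simp: nth_append)

lemma padded_invariant_factor_tuple:
  assumes "invariant_factor_tuple m ps" "d > 0"
  shows "invariant_factor_tuple (m * d) (padded m d ps)"
proof -
  have "m * (d - 1) + m = m * d" using assms(2) by (cases d) auto
  then show ?thesis
    using invariant_factor_tuple_pad[OF assms(1), of "m * (d - 1)"] unfolding padded_def by metis
qed

lemma padded_degree: "tuple_degree (padded m d ps) = tuple_degree ps"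
  by (simp add: padded_def tuple_degree_def)

text \<open>The description is well defined: matrices with these invariant factors share a
  presentation, hence are similar and have conjugate centralizers.\<close>

lemma centralizer_order_eq:
  fixes A :: "'a::{field,finite} mat"
  assumes A: "A \<in> carrier_mat (m * d) (m * d)" and d: "d > 0"
    and inv: "has_invariant_factors (m * d) (m * d) (char_poly_matrix A) (padded m d ps)"
  shows "centralizer_order m d ps = card (GL_centralizer (m * d) A)"
  unfolding centralizer_order_def
proof (rule the_equality)
  show "\<forall>B\<in>carrier_mat (m * d) (m * d).
      has_invariant_factors (m * d) (m * d) (char_poly_matrix B) (padded m d ps) \<longrightarrow>
      card (GL_centralizer (m * d) B) = card (GL_centralizer (m * d) A)"
  proof (intro ballI impI)
    fix B :: "'a mat"
    assume B: "B \<in> carrier_mat (m * d) (m * d)"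
      and invB: "has_invariant_factors (m * d) (m * d) (char_poly_matrix B) (padded m d ps)"
    obtain X where X: "mat_presents A m X (diag_rect m m ps)" using mat_presents_of_padded[OF A d inv] by blast
    obtain Y where Y: "mat_presents B m Y (diag_rect m m ps)" using mat_presents_of_padded[OF B d invB] by blast
    obtain Z where "Z \<in> carrier_mat (m * d) (m * d)" "invertible_mat Z" "Z * A = B * Z"
      using mat_presents_similar[OF A B X Y] by blast
    then show "card (GL_centralizer (m * d) B) = card (GL_centralizer (m * d) A)"
      using card_GL_centralizer_similar[OF A B] by simp
  qed
  fix N
  assume "\<forall>B\<in>carrier_mat (m * d) (m * d).
      has_invariant_factors (m * d) (m * d) (char_poly_matrix B) (padded m d ps) \<longrightarrow>
      card (GL_centralizer (m * d) B) = N"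
  from bspec[OF this A] inv show "N = card (GL_centralizer (m * d) A)" by simp
qed

text \<open>The double count for a matrix: both sides are the number of splitting tuples, grouped by
  span on the left and by relation matrix on the right.\<close>

lemma card_splitting_gens_matrix:
  fixes A :: "'a::{field,finite} mat"
  assumes A: "A \<in> carrier_mat (m * d) (m * d)" and d: "d > 0" and ps: "invariant_factor_tuple m ps"
    and inv: "has_invariant_factors (m * d) (m * d) (char_poly_matrix A) (padded m d ps)"
  shows "(\<Prod>i<m. CARD('a) ^ m - CARD('a) ^ i)
      * card (fin_operator.gen_span vscale m ` {X. fin_operator.splitting_gens vscale (mat_apply A) (fvec (m * d)) m d X})
    = centralizer_order m d ps * mu m m d ps"
proof -
  let ?n = "m * d"
  interpret fin_operator vscale "mat_apply A" "fvec ?n" using A by (rule fin_operator_mat)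
  have card: "card (fvec ?n :: (nat \<Rightarrow> 'a) set) = CARD('a) ^ ?n" by (rule card_fvec)
  obtain X where X: "presents m X (diag_rect m m ps)" using mat_presents_of_padded[OF A d inv] A by auto
  have "card {X. splitting_gens m d X} = card (GL_centralizer ?n A) * mu m m d ps"
    using card_mat_presents[OF A] A by (intro card_splitting_gens_eq_mu[OF card d ps X]) auto
  then show ?thesis
    using count_splitting_gens[OF card d] centralizer_order_eq[OF A d inv] by simp
qed

section \<open>Splitting subspaces of abstract vector spaces\<close>

context fin_operator
begin

text \<open>Directness of the sum. Both decompositions come from polynomial vectors of low degree,
  and \<open>gen_eval\<close> is injective on these.\<close>

lemma splitting_gens_sum_unique:
  assumes card: "card V = CARD('a) ^ (m * d)" and splitting_gens: "splitting_gens m d X"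
    and w: "\<And>i. i < d \<Longrightarrow> w i \<in> gen_span m X" "\<And>i. i < d \<Longrightarrow> w' i \<in> gen_span m X"
    and eq: "(\<Sum>i<d. (T ^^ i) (w i)) = (\<Sum>i<d. (T ^^ i) (w' i))" and i: "i < d"
  shows "w i = w' i"
proof -
  obtain u where u: "u \<in> seqs m (\<lambda>_. low d)" "\<forall>i<d. scalar_comb m X (\<lambda>j. coeff (u j) i) = w i"
    "gen_eval m X u = (\<Sum>i<d. (T ^^ i) (w i))" using exists_low_of_gen_span[of d w m X] w by blast
  obtain u' where u': "u' \<in> seqs m (\<lambda>_. low d)" "\<forall>i<d. scalar_comb m X (\<lambda>j. coeff (u' j) i) = w' i"
    "gen_eval m X u' = (\<Sum>i<d. (T ^^ i) (w' i))" using exists_low_of_gen_span[of d w' m X] w by blast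
  have "gen_eval m X u = gen_eval m X u'" unfolding u(3) u'(3) by (rule eq)
  then have "u = u'"
    by (rule inj_onD[OF bij_betw_imp_inj_on[OF splitting_gens_bij[OF card splitting_gens]] _ u(1) u'(1)])
  then show ?thesis using u(2) u'(2) i by metis
qed

lemma Tpow_subspace: "subspace S \<Longrightarrow> subspace ((T ^^ i) ` S)"
  unfolding subspace_def
proof (intro conjI ballI allI, goal_cases)
  case 1
  then show ?case using Tpow_zero[of i] by (metis imageI)
next
  case (2 x y)
  then obtain a b where "a \<in> S" "b \<in> S" "x = (T ^^ i) a" "y = (T ^^ i) b" by blast
  then show ?case using 2(1) by (intro image_eqI[of _ _ "a + b"]) (auto simp: Tpow_add)
next
  case (3 c x)
  then obtain a where "a \<in> S" "x = (T ^^ i) a" by blast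
  then show ?case using 3(1) by (intro image_eqI[of _ _ "s c a"]) (auto simp: Tpow_scale)
qed

end

text \<open>Translates the unique-existence form of the basis criterion into a bijection that can be
  composed and counted.\<close>

lemma bij_betw_iff_ex1:
  assumes "f ` A \<subseteq> B"
  shows "bij_betw f A B \<longleftrightarrow> (\<forall>v\<in>B. \<exists>!a. a \<in> A \<and> f a = v)"
proof
  assume bij: "bij_betw f A B"
  show "\<forall>v\<in>B. \<exists>!a. a \<in> A \<and> f a = v"
  proof
    fix v assume "v \<in> B"
    then obtain a where "a \<in> A" "f a = v" using bij by (auto simp: bij_betw_def)
    then show "\<exists>!a. a \<in> A \<and> f a = v"
      using bij by (intro ex1I[of _ a]) (auto simp: bij_betw_def dest: inj_onD)
  qed
next
  assume *: "\<forall>v\<in>B. \<exists>!a. a \<in> A \<and> f a = v"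
  show "bij_betw f A B"
  proof (rule bij_betw_imageI)
    show "inj_on f A"
    proof (rule inj_onI)
      fix a b assume ab: "a \<in> A" "b \<in> A" "f a = f b"
      then have "\<exists>!c. c \<in> A \<and> f c = f b" using assms by (intro bspec[OF *]) blast
      then show "a = b" using ab by blast
    qed
    show "f ` A = B" using * assms by blast
  qed
qed

section \<open>Abstract vector spaces over F and their coordinate maps\<close>

locale class_vs = vectorspace class_ring V for V :: "('a::{field,finite}, 'v) module"
begin

definition lin_comb :: "nat \<Rightarrow> (nat \<Rightarrow> 'v) \<Rightarrow> (nat \<Rightarrow> 'a) \<Rightarrow> 'v" where
  "lin_comb k x c = (\<Oplus>\<^bsub>V\<^esub> i \<in> {..<k}. c i \<odot>\<^bsub>V\<^esub> x i)"

lemma sc_closed [simp]: "v \<in> carrier V \<Longrightarrow> a \<odot>\<^bsub>V\<^esub> v \<in> carrier V" for a :: 'a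
  using smult_closed[of a v] by simp

lemma sc_add: "v \<in> carrier V \<Longrightarrow> (a + b) \<odot>\<^bsub>V\<^esub> v = a \<odot>\<^bsub>V\<^esub> v \<oplus>\<^bsub>V\<^esub> b \<odot>\<^bsub>V\<^esub> v" for a b :: 'a
  using smult_l_distr[of a b v] by simp

lemma sc_dist: "v \<in> carrier V \<Longrightarrow> w \<in> carrier V \<Longrightarrow> a \<odot>\<^bsub>V\<^esub> (v \<oplus>\<^bsub>V\<^esub> w) = a \<odot>\<^bsub>V\<^esub> v \<oplus>\<^bsub>V\<^esub> a \<odot>\<^bsub>V\<^esub> w" for a :: 'a
  using smult_r_distr[of a v w] by simp

lemma sc_mult: "v \<in> carrier V \<Longrightarrow> (a * b) \<odot>\<^bsub>V\<^esub> v = a \<odot>\<^bsub>V\<^esub> (b \<odot>\<^bsub>V\<^esub> v)" for a b :: 'a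
  using smult_assoc1[of a b v] by simp

lemma sc_one: "v \<in> carrier V \<Longrightarrow> (1 :: 'a) \<odot>\<^bsub>V\<^esub> v = v"
  using smult_one[of v] by simp

lemma sc_zero: "v \<in> carrier V \<Longrightarrow> (0 :: 'a) \<odot>\<^bsub>V\<^esub> v = \<zero>\<^bsub>V\<^esub>"
  using smult_l_null[of v] by simp

lemma sc_null: "(a :: 'a) \<odot>\<^bsub>V\<^esub> \<zero>\<^bsub>V\<^esub> = \<zero>\<^bsub>V\<^esub>"
  using smult_r_null[of a] by simp

lemma lin_comb_closed: "(\<And>i. i < k \<Longrightarrow> x i \<in> carrier V) \<Longrightarrow> lin_comb k x c \<in> carrier V"
  unfolding lin_comb_def by (rule finsum_closed) auto

lemma lin_comb_0: "lin_comb 0 x c = \<zero>\<^bsub>V\<^esub>"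
  by (simp add: lin_comb_def)

lemma lin_comb_Suc: "(\<And>i. i < Suc k \<Longrightarrow> x i \<in> carrier V) \<Longrightarrow> lin_comb (Suc k) x c = c k \<odot>\<^bsub>V\<^esub> x k \<oplus>\<^bsub>V\<^esub> lin_comb k x c"
  unfolding lin_comb_def lessThan_Suc by (subst finsum_insert) auto

lemma lin_comb_add:
  "(\<And>i. i < k \<Longrightarrow> x i \<in> carrier V) \<Longrightarrow> lin_comb k x (b + c) = lin_comb k x b \<oplus>\<^bsub>V\<^esub> lin_comb k x c"
proof (induction k)
  case (Suc k)
  have "x k \<in> carrier V" "lin_comb k x b \<in> carrier V" "lin_comb k x c \<in> carrier V"
    using Suc.prems by (auto intro: lin_comb_closed)
  then show ?case using Suc by (simp add: lin_comb_Suc sc_add a_ac)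
qed (simp add: lin_comb_0)

lemma lin_comb_scale:
  "(\<And>i. i < k \<Longrightarrow> x i \<in> carrier V) \<Longrightarrow> lin_comb k x (\<lambda>i. a * c i) = a \<odot>\<^bsub>V\<^esub> lin_comb k x c"
proof (induction k)
  case (Suc k)
  have "x k \<in> carrier V" "lin_comb k x c \<in> carrier V"
    using Suc.prems by (auto intro: lin_comb_closed)
  then show ?case using Suc by (simp add: lin_comb_Suc sc_mult sc_dist)
qed (simp add: lin_comb_0 sc_null)

lemma lin_comb_cong:
  "(\<And>i. i < k \<Longrightarrow> x i \<in> carrier V) \<Longrightarrow> (\<And>i. i < k \<Longrightarrow> x i = y i) \<Longrightarrow> (\<And>i. i < k \<Longrightarrow> b i = c i) \<Longrightarrow> lin_comb k x b = lin_comb k y c"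
  by (induction k) (simp_all add: lin_comb_0 lin_comb_Suc)

lemma lin_comb_unit: "(\<And>i. i < k \<Longrightarrow> x i \<in> carrier V) \<Longrightarrow> lin_comb k x (unit_seq j) = (if j < k then x j else \<zero>\<^bsub>V\<^esub>)"
proof (induction k)
  case (Suc k)
  have IH: "lin_comb k x (unit_seq j) = (if j < k then x j else \<zero>\<^bsub>V\<^esub>)"
    by (rule Suc.IH) (rule Suc.prems, simp)
  have u: "unit_seq j k = (if k = j then 1 else 0 :: 'a)" by (simp add: unit_seq_def)
  have x: "x k \<in> carrier V" "j < k \<Longrightarrow> x j \<in> carrier V" using Suc.prems by auto
  have "lin_comb (Suc k) x (unit_seq j) = unit_seq j k \<odot>\<^bsub>V\<^esub> x k \<oplus>\<^bsub>V\<^esub> (if j < k then x j else \<zero>\<^bsub>V\<^esub>)"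
    using lin_comb_Suc[OF Suc.prems, where c = "unit_seq j"] IH by simp
  then show ?case using x unfolding u by (auto simp: sc_one sc_zero less_Suc_eq)
qed (simp add: lin_comb_0)

lemma lincomb_eq_lin_comb:
  assumes "inj_on x {..<k}" "x ` {..<k} \<subseteq> carrier V"
  shows "lincomb a (x ` {..<k}) = lin_comb k x (\<lambda>i. if i < k then a (x i) else 0)"
proof -
  have "lincomb a (x ` {..<k}) = (\<Oplus>\<^bsub>V\<^esub> i \<in> {..<k}. a (x i) \<odot>\<^bsub>V\<^esub> x i)"
    unfolding lincomb_def using assms by (intro finsum_reindex) auto
  also have "\<dots> = lin_comb k x (\<lambda>i. if i < k then a (x i) else 0)"
    unfolding lin_comb_def using assms by (intro finsum_cong') auto
  finally show ?thesis .
qed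

text \<open>Coefficient functions on the set of basis vectors correspond to coefficient tuples
  through the injective enumeration \<open>x\<close>.\<close>

lemma basis_iff_bij:
  assumes inj: "inj_on x {..<k}" and x: "x ` {..<k} \<subseteq> carrier V"
  shows "basis (x ` {..<k}) \<longleftrightarrow> bij_betw (lin_comb k x) (fvec k) (carrier V)"
proof -
  let ?B = "x ` {..<k}"
  let ?r = "\<lambda>a i. if i < k then a (x i) else 0 :: 'a"
  have xc: "\<And>i. i < k \<Longrightarrow> x i \<in> carrier V" using x by auto
  have r: "bij_betw ?r (?B \<rightarrow>\<^sub>E UNIV) (fvec k)"
  proof (rule bij_betw_byWitness[where f' = "\<lambda>c. restrict (\<lambda>w. c (inv_into {..<k} x w)) ?B"])
    show "\<forall>a\<in>?B \<rightarrow>\<^sub>E UNIV. restrict (\<lambda>w. ?r a (inv_into {..<k} x w)) ?B = a"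
      using inj by (auto simp: fun_eq_iff restrict_def PiE_def extensional_def inv_into_f_f)
    show "\<forall>c\<in>fvec k. ?r (restrict (\<lambda>w. c (inv_into {..<k} x w)) ?B) = c"
      using inj by (auto simp: fun_eq_iff inv_into_f_f seqs_def)
  qed (auto simp: seqs_def)
  have "basis ?B \<longleftrightarrow> (\<forall>v\<in>carrier V. \<exists>!a. a \<in> ?B \<rightarrow>\<^sub>E UNIV \<and> (lin_comb k x \<circ> ?r) a = v)"
    using basis_criterion[of ?B] x by (simp add: lincomb_eq_lin_comb[OF inj x] Ball_def)
  also have "\<dots> \<longleftrightarrow> bij_betw (lin_comb k x \<circ> ?r) (?B \<rightarrow>\<^sub>E UNIV) (carrier V)"
    by (rule bij_betw_iff_ex1[symmetric]) (auto intro: lin_comb_closed xc)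
  also have "\<dots> \<longleftrightarrow> bij_betw (lin_comb k x) (fvec k) (carrier V)"
    by (rule bij_betw_comp_iff[OF r, symmetric])
  finally show ?thesis .
qed

lemma bij_lin_comb_dim:
  assumes x: "x ` {..<k} \<subseteq> carrier V" and bij: "bij_betw (lin_comb k x) (fvec k) (carrier V)"
  shows "fin_dim" "dim = k"
proof -
  \<comment> \<open>A repetition among the x i would give two unit tuples the same image.\<close>
  have inj: "inj_on x {..<k}"
  proof (rule inj_onI)
    fix i j assume ij: "i \<in> {..<k}" "j \<in> {..<k}" "x i = x j"
    then have "lin_comb k x (unit_seq i) = lin_comb k x (unit_seq j)" using x by (subst (1 2) lin_comb_unit) auto
    then have "unit_seq i = (unit_seq j :: nat \<Rightarrow> 'a)"
      by (rule inj_onD[OF bij_betw_imp_inj_on[OF bij]]) (use ij in \<open>simp_all add: unit_seq_fvec\<close>)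
    from fun_cong[OF this, of i] show "i = j" by (auto simp: unit_seq_def split: if_splits)
  qed
  have basis: "basis (x ` {..<k})" using basis_iff_bij[OF inj x] bij by simp
  then show "fin_dim"
    unfolding fin_dim_def basis_def by (intro exI[of _ "x ` {..<k}"]) simp
  show "dim = k" using dim_basis[OF _ basis] card_image[OF inj] by simp
qed

lemma dim_bij_lin_comb:
  assumes "fin_dim" "dim = k"
  shows "\<exists>x. x ` {..<k} \<subseteq> carrier V \<and> bij_betw (lin_comb k x) (fvec k) (carrier V)"
proof -
  obtain B where B: "finite B" "basis B" using finite_basis_exists[OF assms(1)] by blast
  then have "card B = k" using dim_basis assms(2) by simp
  then obtain x where x: "bij_betw x {..<k} B"
    using ex_bij_betw_nat_finite[OF B(1)] by (auto simp: atLeast0LessThan)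
  then have "x ` {..<k} = B" "inj_on x {..<k}" by (auto simp: bij_betw_def)
  then show ?thesis using basis_iff_bij[of x k] B(2) by (auto simp: basis_def)
qed

end

text \<open>The coordinate map of the basis \<open>b\<close> identifies the abstract space with
  \<open>fvec n\<close> and \<open>T\<close> with \<open>A\<close>, so that counts made for matrices
  carry over.\<close>

locale class_vs_coords = class_vs V for V :: "('a::{field,finite}, 'v) module" +
  fixes T :: "'v \<Rightarrow> 'v" and A :: "'a mat" and b :: "nat \<Rightarrow> 'v" and n :: nat
  assumes b: "i < n \<Longrightarrow> b i \<in> carrier V" and bij: "bij_betw (lin_comb n b) (fvec n) (carrier V)"
    and A: "A \<in> carrier_mat n n" and T: "c \<in> fvec n \<Longrightarrow> T (lin_comb n b c) = lin_comb n b (mat_apply A c)"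
begin

sublocale M: fin_operator vscale "mat_apply A" "fvec n" using A by (rule fin_operator_mat)

abbreviation (input) "\<Phi> \<equiv> lin_comb n b"

lemma Phi_closed: "\<Phi> c \<in> carrier V"
  by (rule lin_comb_closed) (rule b)

lemma Phi_add: "\<Phi> (c + e) = \<Phi> c \<oplus>\<^bsub>V\<^esub> \<Phi> e"
  by (rule lin_comb_add) (rule b)

lemma Phi_scale: "\<Phi> (\<lambda>i. a * c i) = a \<odot>\<^bsub>V\<^esub> \<Phi> c"
  by (rule lin_comb_scale) (rule b)

lemma Phi_zero: "\<Phi> 0 = \<zero>\<^bsub>V\<^esub>"
  using Phi_scale[of 0 0] by (simp add: sc_zero Phi_closed zero_fun_def)

lemma Phi_inj: "c \<in> fvec n \<Longrightarrow> e \<in> fvec n \<Longrightarrow> \<Phi> c = \<Phi> e \<Longrightarrow> c = e"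
  using inj_onD[OF bij_betw_imp_inj_on[OF bij]] by blast

lemma Phi_surj: "v \<in> carrier V \<Longrightarrow> \<exists>c\<in>fvec n. v = \<Phi> c"
  using bij_betw_imp_surj_on[OF bij] by blast

lemma Phi_sum: "finite I \<Longrightarrow> \<Phi> (\<Sum>i\<in>I. f i) = (\<Oplus>\<^bsub>V\<^esub> i\<in>I. \<Phi> (f i))"
proof (induction I rule: finite_induct)
  case empty
  then show ?case by (simp only: sum.empty Phi_zero finsum_empty)
next
  case (insert x F)
  then show ?case
    by (simp only: sum.insert[OF insert.hyps] Phi_add) (simp add: finsum_insert Phi_closed)
qed

lemma Phi_scalar_comb: "lin_comb k (\<lambda>j. \<Phi> (X j)) c = \<Phi> (M.scalar_comb k X c)"
proof (induction k)
  case 0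
  then show ?case by (simp only: lin_comb_0 M.scalar_comb_def lessThan_0 sum.empty Phi_zero)
next
  case (Suc k)
  have "M.scalar_comb (Suc k) X c = (\<lambda>i. c k * X k i) + M.scalar_comb k X c"
    unfolding M.scalar_comb_def sum.lessThan_Suc by (rule add.commute)
  then have "\<Phi> (M.scalar_comb (Suc k) X c) = c k \<odot>\<^bsub>V\<^esub> \<Phi> (X k) \<oplus>\<^bsub>V\<^esub> \<Phi> (M.scalar_comb k X c)"
    by (simp only: Phi_add Phi_scale)
  moreover have "lin_comb (Suc k) (\<lambda>j. \<Phi> (X j)) c = c k \<odot>\<^bsub>V\<^esub> \<Phi> (X k) \<oplus>\<^bsub>V\<^esub> lin_comb k (\<lambda>j. \<Phi> (X j)) c"
    by (rule lin_comb_Suc) (rule Phi_closed)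
  ultimately show ?case by (simp only: Suc.IH)
qed

lemma Phi_Tpow: "c \<in> fvec n \<Longrightarrow> (T ^^ i) (\<Phi> c) = \<Phi> ((mat_apply A ^^ i) c)"
  by (induction i) (simp_all add: T M.Tpow_V)

lemma Phi_subspace:
  assumes S: "M.subspace S"
  shows "subspace class_ring (\<Phi> ` S) V"
proof -
  have "submodule class_ring (\<Phi> ` S) V"
  proof
    show "\<Phi> ` S \<subseteq> carrier V" using Phi_closed by blast
    show "\<zero>\<^bsub>V\<^esub> \<in> \<Phi> ` S" using Phi_zero M.subspace_0[OF S] by (metis imageI)
    fix v w assume "v \<in> \<Phi> ` S" "w \<in> \<Phi> ` S"
    then obtain c e where "c \<in> S" "e \<in> S" "v = \<Phi> c" "w = \<Phi> e" by blast
    then show "v \<oplus>\<^bsub>V\<^esub> w \<in> \<Phi> ` S"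
      using M.subspace_add[OF S] by (intro image_eqI[of _ _ "c + e"]) (simp_all add: Phi_add)
  next
    fix a :: 'a and v assume "v \<in> \<Phi> ` S"
    then obtain c where "c \<in> S" "v = \<Phi> c" by blast
    then show "a \<odot>\<^bsub>V\<^esub> v \<in> \<Phi> ` S"
      using M.subspace_scale[OF S, of c a] by (intro image_eqI[of _ _ "\<lambda>i. a * c i"]) (simp_all add: Phi_scale)
  qed (unfold_locales)
  then show ?thesis
    unfolding subspace_def using vectorspace_axioms by simp
qed

lemma sub_class_vs: "subspace class_ring W V \<Longrightarrow> class_vs (V\<lparr>carrier := W\<rparr>)"
  unfolding class_vs_def by (rule subspace_is_vs)

text \<open>A subspace inherits the operations and changes only the carrier, so combinations of its
  vectors are the same in both spaces.\<close>

lemma sub_lin_comb: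
  assumes W: "subspace class_ring W V" and x: "\<And>i. i < k \<Longrightarrow> x i \<in> W"
  shows "class_vs.lin_comb (V\<lparr>carrier := W\<rparr>) k x c = lin_comb k x c"
proof -
  interpret W: class_vs "V\<lparr>carrier := W\<rparr>" using W by (rule sub_class_vs)
  have "W \<subseteq> carrier V" using is_module[OF W] by (rule submodule.subset)
  then show ?thesis using x
    by (induction k) (simp_all add: lin_comb_0 W.lin_comb_0 lin_comb_Suc W.lin_comb_Suc subset_iff)
qed

text \<open>Independence of \<open>X\<close> gives dimension m. Spanning and
  \<open>splitting_gens_sum_unique\<close> give existence and uniqueness of the
  decompositions.\<close>

lemma splitting_of_splitting_gens:
  assumes n: "n = m * d" and d: "d > 0" and splitting_gens: "M.splitting_gens m d X"
  shows "splitting_subspace V T m d (\<Phi> ` M.gen_span m X)"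
proof -
  let ?S = "M.gen_span m X" and ?W = "\<Phi> ` M.gen_span m X"
  have card: "card (fvec n :: (nat \<Rightarrow> 'a) set) = CARD('a) ^ (m * d)" by (simp add: card_fvec n)
  have XV: "X \<in> seqs m (\<lambda>_. fvec n)" using splitting_gens by (auto simp: M.splitting_gens_def)
  have S: "?S \<subseteq> fvec n" using M.gen_span_subset[OF M.V_sub XV] .
  have sub: "subspace class_ring ?W V" by (intro Phi_subspace M.gen_span_subspace)
  interpret W: class_vs "V\<lparr>carrier := ?W\<rparr>" using sub by (rule sub_class_vs)
  have gen: "\<Phi> (X j) \<in> ?W" if "j < m" for j using M.gen_span_unit[OF that] by blast
  have lcW: "W.lin_comb m (\<lambda>j. \<Phi> (X j)) c = \<Phi> (M.scalar_comb m X c)" for c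
    by (subst sub_lin_comb[OF sub]) (simp_all add: gen Phi_scalar_comb)
  have "bij_betw (\<lambda>c. \<Phi> (M.scalar_comb m X c)) (fvec m) ?W"
  proof (rule bij_betw_imageI)
    show "inj_on (\<lambda>c. \<Phi> (M.scalar_comb m X c)) (fvec m)"
    proof (rule inj_onI)
      fix c e :: "nat \<Rightarrow> 'a" assume ce: "c \<in> fvec m" "e \<in> fvec m" "\<Phi> (M.scalar_comb m X c) = \<Phi> (M.scalar_comb m X e)"
      then have "M.scalar_comb m X c = M.scalar_comb m X e"
        using M.scalar_comb_in[OF M.V_sub XV] by (intro Phi_inj)
      then show "c = e"
        using inj_onD[OF M.splitting_gens_indep[OF card splitting_gens d, unfolded M.indep_def]] ce by blast
    qed
    show "(\<lambda>c. \<Phi> (M.scalar_comb m X c)) ` fvec m = ?W" unfolding M.gen_span_def by (simp only: image_image)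
  qed
  then have bijW: "bij_betw (W.lin_comb m (\<lambda>j. \<Phi> (X j))) (fvec m) (carrier (V\<lparr>carrier := ?W\<rparr>))"
    by (simp add: lcW[abs_def])
  have gen': "(\<lambda>j. \<Phi> (X j)) ` {..<m} \<subseteq> carrier (V\<lparr>carrier := ?W\<rparr>)" using gen by auto
  note dims = W.bij_lin_comb_dim[OF gen' bijW]
  have TW: "(T ^^ i) ` ?W = \<Phi> ` (mat_apply A ^^ i) ` ?S" for i
    unfolding image_image using S by (intro image_cong) (auto simp: Phi_Tpow)
  have "is_direct_sum V d (\<lambda>i. (T ^^ i) ` ?W)"
    unfolding is_direct_sum_def
  proof (intro conjI allI impI ballI)
    show "subspace class_ring ((T ^^ i) ` ?W) V" for i
      unfolding TW by (intro Phi_subspace M.Tpow_subspace M.gen_span_subspace)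
    fix v assume "v \<in> carrier V"
    then obtain y where y: "y \<in> fvec n" "v = \<Phi> y" using Phi_surj by blast
    obtain w where w: "\<forall>i<d. w i \<in> ?S" "y = (\<Sum>i<d. (mat_apply A ^^ i) (w i))"
      using splitting_gens y(1) unfolding M.splitting_gens_iff_gen_span[OF XV] by blast
    \<comment> \<open>The restriction is essential: the extensional product contains only functions
      that are \<open>undefined\<close> from d on, as unique existence requires.\<close>
    define u where "u = restrict (\<lambda>i. \<Phi> ((mat_apply A ^^ i) (w i))) {..<d}"
    show "\<exists>!u. u \<in> (\<Pi>\<^sub>E i\<in>{..<d}. (T ^^ i) ` ?W) \<and> v = (\<Oplus>\<^bsub>V\<^esub> i\<in>{..<d}. u i)"
    proof (rule ex1I[of _ u])
      have "(\<Oplus>\<^bsub>V\<^esub> i\<in>{..<d}. u i) = (\<Oplus>\<^bsub>V\<^esub> i\<in>{..<d}. \<Phi> ((mat_apply A ^^ i) (w i)))"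
        by (intro finsum_cong') (auto simp: u_def Phi_closed)
      also have "\<dots> = v" unfolding y(2) w(2) by (rule Phi_sum[symmetric]) simp
      finally show "u \<in> (\<Pi>\<^sub>E i\<in>{..<d}. (T ^^ i) ` ?W) \<and> v = (\<Oplus>\<^bsub>V\<^esub> i\<in>{..<d}. u i)"
        using w(1) unfolding TW by (auto simp: u_def)
    next
      fix u' assume u': "u' \<in> (\<Pi>\<^sub>E i\<in>{..<d}. (T ^^ i) ` ?W) \<and> v = (\<Oplus>\<^bsub>V\<^esub> i\<in>{..<d}. u' i)"
      have "\<forall>i. \<exists>z. i < d \<longrightarrow> z \<in> ?S \<and> u' i = \<Phi> ((mat_apply A ^^ i) z)"
      proof (intro allI)
        fix i
        show "\<exists>z. i < d \<longrightarrow> z \<in> ?S \<and> u' i = \<Phi> ((mat_apply A ^^ i) z)"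
        proof (cases "i < d")
          case True
          then have "u' i \<in> \<Phi> ` (mat_apply A ^^ i) ` ?S" using u' unfolding TW by auto
          then show ?thesis by blast
        qed auto
      qed
      then obtain w' where w': "\<And>i. i < d \<Longrightarrow> w' i \<in> ?S \<and> u' i = \<Phi> ((mat_apply A ^^ i) (w' i))" by metis
      have "\<Phi> (\<Sum>i<d. (mat_apply A ^^ i) (w' i)) = (\<Oplus>\<^bsub>V\<^esub> i\<in>{..<d}. \<Phi> ((mat_apply A ^^ i) (w' i)))"
        by (rule Phi_sum) simp
      also have "\<dots> = (\<Oplus>\<^bsub>V\<^esub> i\<in>{..<d}. u' i)"
        using w' by (intro finsum_cong') (auto simp: Phi_closed)
      also have "\<dots> = \<Phi> (\<Sum>i<d. (mat_apply A ^^ i) (w i))" using u' y(2) w(2) by simp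
      finally have "(\<Sum>i<d. (mat_apply A ^^ i) (w' i)) = (\<Sum>i<d. (mat_apply A ^^ i) (w i))"
        using w w' S by (intro Phi_inj M.V_sum M.Tpow_V) auto
      then have "w' i = w i" if "i < d" for i
        using M.splitting_gens_sum_unique[OF card splitting_gens] w(1) w' that by blast
      then have "u' i = u i" for i
        using w' u' by (cases "i < d") (auto simp: u_def PiE_def extensional_def)
      then show "u' = u" by blast
    qed
  qed
  with sub dims show ?thesis unfolding splitting_subspace_def by simp
qed

text \<open>The coordinates of a basis of \<open>W\<close> serve as \<open>X\<close>; decompositions
  along the T^i W are then low-degree expressions in \<open>X\<close>.\<close>

lemma splitting_gens_of_splitting:
  assumes n: "n = m * d" and split: "splitting_subspace V T m d W"
  shows "\<exists>X. M.splitting_gens m d X \<and> W = \<Phi> ` M.gen_span m X"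
proof -
  have sub: "subspace class_ring W V" using split by (simp add: splitting_subspace_def)
  interpret W: class_vs "V\<lparr>carrier := W\<rparr>" using sub by (rule sub_class_vs)
  have WV: "W \<subseteq> carrier V" using is_module[OF sub] by (rule submodule.subset)
  obtain x where x: "x ` {..<m} \<subseteq> W" and bijx: "bij_betw (W.lin_comb m x) (fvec m) W"
    using W.dim_bij_lin_comb[of m] split by (auto simp: splitting_subspace_def)
  have "\<forall>j. \<exists>c. j < m \<longrightarrow> c \<in> fvec n \<and> x j = \<Phi> c"
    using x WV Phi_surj by blast
  then obtain Y where Y: "\<And>j. j < m \<Longrightarrow> Y j \<in> fvec n \<and> x j = \<Phi> (Y j)" by metis
  \<comment> \<open>The chosen coordinate vectors are arbitrary from \<open>m\<close> on and have to
    be reset to 0 there.\<close>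
  define X where "X j = (if j < m then Y j else 0)" for j
  have XV: "X \<in> seqs m (\<lambda>_. fvec n)" using Y by (simp add: X_def seqs_def[of m "\<lambda>_. fvec n"])
  have lcW: "W.lin_comb m x c = \<Phi> (M.scalar_comb m X c)" for c
  proof -
    have "W.lin_comb m x c = lin_comb m x c" using x by (intro sub_lin_comb[OF sub]) auto
    also have "\<dots> = lin_comb m (\<lambda>j. \<Phi> (X j)) c"
      using x WV Y by (intro lin_comb_cong) (auto simp: X_def)
    finally show ?thesis by (simp only: Phi_scalar_comb)
  qed
  have "W = (\<lambda>c. W.lin_comb m x c) ` fvec m" using bij_betw_imp_surj_on[OF bijx] by simp
  then have W_eq: "W = \<Phi> ` M.gen_span m X"
    unfolding M.gen_span_def image_image lcW .
  have "M.splitting_gens m d X"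
    unfolding M.splitting_gens_iff_gen_span[OF XV]
  proof
    fix y :: "nat \<Rightarrow> 'a" assume y: "y \<in> fvec n"
    then obtain u where u: "u \<in> (\<Pi>\<^sub>E i\<in>{..<d}. (T ^^ i) ` W)" "\<Phi> y = (\<Oplus>\<^bsub>V\<^esub> i\<in>{..<d}. u i)"
      using split Phi_closed[of y] unfolding splitting_subspace_def is_direct_sum_def by metis
    have S: "M.gen_span m X \<subseteq> fvec n" using M.gen_span_subset[OF M.V_sub XV] .
    have "\<forall>i. \<exists>z. i < d \<longrightarrow> z \<in> M.gen_span m X \<and> u i = \<Phi> ((mat_apply A ^^ i) z)"
    proof (intro allI)
      fix i
      show "\<exists>z. i < d \<longrightarrow> z \<in> M.gen_span m X \<and> u i = \<Phi> ((mat_apply A ^^ i) z)"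
      proof (cases "i < d")
        case True
        then have "u i \<in> (T ^^ i) ` \<Phi> ` M.gen_span m X" using u(1) unfolding W_eq by auto
        then obtain z where z: "z \<in> M.gen_span m X" "u i = (T ^^ i) (\<Phi> z)" by blast
        have "u i = \<Phi> ((mat_apply A ^^ i) z)"
          unfolding z(2) by (rule Phi_Tpow) (rule subsetD[OF S z(1)])
        with z(1) show ?thesis by (intro exI[of _ z]) simp
      qed auto
    qed
    then obtain w where w: "\<And>i. i < d \<Longrightarrow> w i \<in> M.gen_span m X \<and> u i = \<Phi> ((mat_apply A ^^ i) (w i))" by metis
    have "\<Phi> (\<Sum>i<d. (mat_apply A ^^ i) (w i)) = (\<Oplus>\<^bsub>V\<^esub> i\<in>{..<d}. \<Phi> ((mat_apply A ^^ i) (w i)))"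
      by (rule Phi_sum) simp
    also have "\<dots> = (\<Oplus>\<^bsub>V\<^esub> i\<in>{..<d}. u i)"
      using w by (intro finsum_cong') (auto simp: Phi_closed)
    finally have "\<Phi> y = \<Phi> (\<Sum>i<d. (mat_apply A ^^ i) (w i))" using u(2) by simp
    then have "y = (\<Sum>i<d. (mat_apply A ^^ i) (w i))"
      using y w S by (intro Phi_inj M.V_sum M.Tpow_V) auto
    then show "\<exists>w. (\<forall>i<d. w i \<in> M.gen_span m X) \<and> y = (\<Sum>i<d. (mat_apply A ^^ i) (w i))"
      using w by blast
  qed
  with W_eq show ?thesis by blast
qed

lemma card_splitting:
  assumes n: "n = m * d" and d: "d > 0"
  shows "card {W. splitting_subspace V T m d W} = card (M.gen_span m ` {X. M.splitting_gens m d X})"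
proof -
  have "{W. splitting_subspace V T m d W} = (`) \<Phi> ` M.gen_span m ` {X. M.splitting_gens m d X}"
  proof (intro subset_antisym subsetI)
    fix W assume "W \<in> {W. splitting_subspace V T m d W}"
    then obtain X where "M.splitting_gens m d X" "W = \<Phi> ` M.gen_span m X" using splitting_gens_of_splitting[OF n, of W] by auto
    then show "W \<in> (`) \<Phi> ` M.gen_span m ` {X. M.splitting_gens m d X}" by (intro image_eqI[OF _ image_eqI]) auto
  next
    fix W assume "W \<in> (`) \<Phi> ` M.gen_span m ` {X. M.splitting_gens m d X}"
    then obtain X where "M.splitting_gens m d X" "W = \<Phi> ` M.gen_span m X" by auto
    then show "W \<in> {W. splitting_subspace V T m d W}" using splitting_of_splitting_gens[OF n d] by simp
  qed
  moreover have "inj_on ((`) \<Phi>) (M.gen_span m ` {X. M.splitting_gens m d X})"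
  proof (rule inj_on_subset[OF inj_on_image_Pow[OF bij_betw_imp_inj_on[OF bij]]])
    show "M.gen_span m ` {X. M.splitting_gens m d X} \<subseteq> Pow (fvec n)"
      using M.gen_span_subset[OF M.V_sub] by (auto simp: M.splitting_gens_def)
  qed
  ultimately show ?thesis by (simp add: card_image)
qed

end

text \<open>\<open>is_matrix_of\<close> describes \<open>T\<close> on the basis vectors only;
  linearity extends the description to all combinations.\<close>

lemma class_vs_coords_of_matrix:
  fixes V :: "('a::{field,finite}, 'v) module"
  assumes lin: "linear_map class_ring V V T" and mat: "is_matrix_of V T bs A"
  shows "class_vs_coords V T A ((!) bs) (length bs)"
proof -
  interpret linear_map class_ring V V T by (rule lin)
  interpret class_vs V by unfold_locales
  let ?n = "length bs" and ?b = "(!) bs"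
  have dist: "distinct bs" and basis: "basis (set bs)" and A: "A \<in> carrier_mat ?n ?n"
    and T: "\<And>j. j < ?n \<Longrightarrow> T (bs ! j) = lin_comb ?n ?b (\<lambda>i. A $$ (i,j))"
    using mat unfolding is_matrix_of_def lin_comb_def by auto
  have set: "?b ` {..<?n} = set bs" by (auto simp: set_conv_nth)
  have b: "?b i \<in> carrier V" if "i < ?n" for i
    using basis that unfolding basis_def by auto
  have bij: "bij_betw (lin_comb ?n ?b) (fvec ?n) (carrier V)"
  proof -
    have "inj_on ?b {..<?n}" using dist by (auto simp: inj_on_def nth_eq_iff_index_eq)
    then show ?thesis
      using basis_iff_bij[of ?b ?n] basis unfolding set by (simp add: basis_def)
  qed
  have T_lin_comb: "T (lin_comb k x c) = lin_comb k (\<lambda>i. T (x i)) c" if "\<And>i. i < k \<Longrightarrow> x i \<in> carrier V" for k x and c :: "nat \<Rightarrow> 'a"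
    using that
  proof (induction k)
    case 0
    then show ?case by (simp add: lin_comb_0)
  next
    case (Suc k)
    have x: "x k \<in> carrier V" and lcx: "lin_comb k x c \<in> carrier V"
      using Suc.prems by (auto intro: lin_comb_closed)
    have "T (lin_comb (Suc k) x c) = T (c k \<odot>\<^bsub>V\<^esub> x k) \<oplus>\<^bsub>V\<^esub> T (lin_comb k x c)"
      using Suc.prems x lcx by (subst lin_comb_Suc) (auto intro: f_add)
    also have "T (c k \<odot>\<^bsub>V\<^esub> x k) = c k \<odot>\<^bsub>V\<^esub> T (x k)"
      using f_smult[of "c k" "x k"] x by simp
    also have "T (lin_comb k x c) = lin_comb k (\<lambda>i. T (x i)) c"
      using Suc by simp
    also have "c k \<odot>\<^bsub>V\<^esub> T (x k) \<oplus>\<^bsub>V\<^esub> lin_comb k (\<lambda>i. T (x i)) c = lin_comb (Suc k) (\<lambda>i. T (x i)) c"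
      using Suc.prems by (subst lin_comb_Suc) auto
    finally show ?case .
  qed
  show ?thesis
  proof unfold_locales
    fix c :: "nat \<Rightarrow> 'a" assume c: "c \<in> fvec ?n"
    \<comment> \<open>A combination of the images of the basis vectors has as coordinates the same
      combination of the columns of \<open>A\<close>.\<close>
    have scalar_comb: "lin_comb k (\<lambda>j. lin_comb ?n ?b (mat_apply A (unit_seq j))) e = lin_comb ?n ?b (\<Sum>j<k. (\<lambda>i. e j * mat_apply A (unit_seq j) i))"
      for k and e :: "nat \<Rightarrow> 'a"
    proof (induction k)
      case 0
      have "lin_comb ?n ?b (\<lambda>i. 0 * (0::nat \<Rightarrow> 'a) i) = \<zero>\<^bsub>V\<^esub>"
        using b by (subst lin_comb_scale) (auto intro!: sc_zero lin_comb_closed)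
      then show ?case by (simp add: lin_comb_0 zero_fun_def)
    next
      case (Suc k)
      have "lin_comb (Suc k) (\<lambda>j. lin_comb ?n ?b (mat_apply A (unit_seq j))) e
          = e k \<odot>\<^bsub>V\<^esub> lin_comb ?n ?b (mat_apply A (unit_seq k)) \<oplus>\<^bsub>V\<^esub> lin_comb k (\<lambda>j. lin_comb ?n ?b (mat_apply A (unit_seq j))) e"
        by (rule lin_comb_Suc) (rule lin_comb_closed, rule b)
      also have "\<dots> = lin_comb ?n ?b ((\<lambda>i. e k * mat_apply A (unit_seq k) i) + (\<Sum>j<k. (\<lambda>i. e j * mat_apply A (unit_seq j) i)))"
        unfolding Suc.IH using b by (simp only: lin_comb_add lin_comb_scale)
      finally show ?case by (simp only: sum.lessThan_Suc add.commute)
    qed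
    have "T (lin_comb ?n ?b c) = lin_comb ?n (\<lambda>j. T (bs ! j)) c" using b by (rule T_lin_comb)
    also have "\<dots> = lin_comb ?n (\<lambda>j. lin_comb ?n ?b (mat_apply A (unit_seq j))) c"
    proof (rule lin_comb_cong)
      fix j assume j: "j < ?n"
      show "T (bs ! j) \<in> carrier V" using b[OF j] by simp
      show "T (bs ! j) = lin_comb ?n ?b (mat_apply A (unit_seq j))"
        unfolding T[OF j] using b by (rule lin_comb_cong) (simp_all add: mat_apply_unit[OF A j])
    qed simp
    also have "\<dots> = lin_comb ?n ?b (\<Sum>j<?n. (\<lambda>i. c j * mat_apply A (unit_seq j) i))" by (rule scalar_comb)
    also have "(\<Sum>j<?n. (\<lambda>i. c j * mat_apply A (unit_seq j) i)) = mat_apply A (\<Sum>j<?n. (\<lambda>i. c j * unit_seq j i))"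
      by (simp only: mat_apply_sum mat_apply_scale)
    also have "(\<Sum>j<?n. (\<lambda>i. c j * unit_seq j i)) = c" by (rule seq_decomp[OF c, symmetric])
    finally show "T (lin_comb ?n ?b c) = lin_comb ?n ?b (mat_apply A c)" .
  qed (fact b bij A)+
qed

section \<open>The standard operator of a matrix\<close>

lemma linear_map_mult_mat_vec:
  fixes A :: "'a::field mat"
  assumes A: "A \<in> carrier_mat n n"
  shows "linear_map class_ring (module_vec TYPE('a) n) (module_vec TYPE('a) n) ((*\<^sub>v) A)"
proof -
  interpret vectorspace class_ring "module_vec TYPE('a) n" by (rule vec_vs)
  show ?thesis
    using A by unfold_locales
      (auto simp: module_hom_def module_vec_simps mult_add_distrib_mat_vec[of _ n n] mult_mat_vec[of _ n n])
qed

text \<open>Turns a matrix with the prescribed invariant factors into an operator to which the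
  description in \<open>sigma\<close> applies.\<close>

lemma is_matrix_of_unit_vecs:
  fixes A :: "'a::{field,finite} mat"
  assumes A: "A \<in> carrier_mat n n"
  shows "is_matrix_of (module_vec TYPE('a) n) ((*\<^sub>v) A) (unit_vecs n) A"
proof -
  interpret vec_space "TYPE('a)" n .
  interpret class_vs "module_vec TYPE('a) n" by unfold_locales
  have nth: "unit_vecs n ! i = unit_vec n i" if "i < n" for i using that by (simp add: unit_vecs_def)
  \<comment> \<open>Only k = n is wanted; the induction needs the first k unit vectors, with zeros
    in the other positions.\<close>
  have coord: "lin_comb k (unit_vec n) c = vec n (\<lambda>i. if i < k then c i else 0)" if "k \<le> n" for k and c :: "nat \<Rightarrow> 'a"
    using that
  proof (induction k)
    case 0
    then show ?case by (auto simp: lin_comb_0 module_vec_simps)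
  next
    case (Suc k)
    have eq: "lin_comb (Suc k) (unit_vec n) c = c k \<cdot>\<^sub>v unit_vec n k + lin_comb k (unit_vec n) c"
      using lin_comb_Suc[of k "unit_vec n" c] by (simp add: module_vec_simps)
    have "lin_comb k (unit_vec n) c = vec n (\<lambda>i. if i < k then c i else 0)"
      using Suc by simp
    then show ?case
      unfolding eq using Suc.prems by (auto intro!: eq_vecI simp: less_Suc_eq unit_vec_def)
  qed
  have "A *\<^sub>v (unit_vecs n ! j) = (\<Oplus>\<^bsub>module_vec TYPE('a) n\<^esub> i \<in> {..<n}. A $$ (i,j) \<odot>\<^bsub>module_vec TYPE('a) n\<^esub> unit_vecs n ! i)"
    if j: "j < n" for j
  proof -
    have "lin_comb n ((!) (unit_vecs n)) (\<lambda>i. A $$ (i,j)) = lin_comb n (unit_vec n) (\<lambda>i. A $$ (i,j))"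
      by (rule lin_comb_cong) (auto simp: nth module_vec_simps)
    also have "\<dots> = vec n (\<lambda>i. A $$ (i,j))"
      by (subst coord) auto
    also have "\<dots> = A *\<^sub>v (unit_vecs n ! j)"
      using A j by (auto simp: nth intro!: eq_vecI)
    finally show ?thesis by (simp add: lin_comb_def)
  qed
  then show ?thesis
    unfolding is_matrix_of_def using A unit_vecs_distinct unit_vecs_basis by simp
qed

text \<open>The right-hand side does not mention \<open>V\<close> or \<open>T\<close>, so the number
  of splitting subspaces is the same for all operators with these invariant factors.\<close>

lemma card_splitting_eq:
  fixes V :: "('a::{field,finite}, 'v) module"
  assumes d: "d > 0" and ps: "invariant_factor_tuple m ps"
    and lin: "linear_map class_ring V V T" and inv: "op_has_invariant_factors V T (padded m d ps)"
  shows "(\<Prod>i<m. CARD('a) ^ m - CARD('a) ^ i) * card {W. splitting_subspace V T m d W}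
    = centralizer_order m d ps * mu m m d ps"
proof -
  obtain bs A where mat: "is_matrix_of V T bs A"
    and A_inv: "has_invariant_factors (length bs) (length bs) (char_poly_matrix A) (padded m d ps)"
    using inv unfolding op_has_invariant_factors_def by blast
  \<comment> \<open>The dimension is read off from the number of invariant factors.\<close>
  have "length (padded m d ps) = m * d"
    using padded_invariant_factor_tuple[OF ps d] by (simp add: invariant_factor_tuple_def)
  then have n: "length bs = m * d"
    using A_inv by (simp add: has_invariant_factors_def invariant_factor_tuple_def)
  interpret class_vs_coords V T A "(!) bs" "length bs"
    by (rule class_vs_coords_of_matrix[OF lin mat])
  show ?thesis
    using card_splitting_gens_matrix[OF A[unfolded n] d ps A_inv[unfolded n]] card_splitting[OF n d]
    by (simp add: n)
qed

theorem theorem3p2: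
  fixes m d :: nat and ps :: "'a::{field, finite} poly list"
  assumes "m > 0" and "d > 0"
    and "invariant_factor_tuple m ps"
    and "tuple_degree ps = m * d"
  shows "real (sigma m d ps) =
    real (centralizer_order m d ps) / gamma_q CARD('a) m * real (mu m m d ps)"
proof -
  let ?g = "\<Prod>i<m. CARD('a) ^ m - CARD('a) ^ i" and ?n = "m * d"
  \<comment> \<open>Without a witness the descriptions in \<open>sigma\<close> and
    \<open>centralizer_order\<close> would not determine a value.\<close>
  obtain A :: "'a mat" where A: "A \<in> carrier_mat ?n ?n"
    and A_inv: "has_invariant_factors ?n ?n (char_poly_matrix A) (padded m d ps)"
    using exists_matrix_with_invariant_factors[OF padded_invariant_factor_tuple[OF assms(3,2)]]
      padded_degree[of m d ps] assms(4) by auto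
  interpret M: fin_operator vscale "mat_apply A" "fvec ?n" by (rule fin_operator_mat[OF A])
  have g: "?g > 0" by (rule M.gamma_pos)
  interpret vec_space "TYPE('a)" ?n .
  let ?V = "module_vec TYPE('a) ?n"
  have "op_has_invariant_factors ?V ((*\<^sub>v) A) (padded m d ps)"
    unfolding op_has_invariant_factors_def
    using is_matrix_of_unit_vecs[OF A] A_inv by (intro exI[of _ "unit_vecs ?n"] exI[of _ A]) simp
  note V0 = linear_map_mult_mat_vec[OF A] fin_dim dim_is_n this
  have "sigma m d ps = card {W. splitting_subspace ?V ((*\<^sub>v) A) m d W}"
    unfolding sigma_def
  proof (rule the_equality)
    show "\<forall>(V :: ('a, 'a vec) module) T.
        linear_map class_ring V V T \<and>
        vectorspace.fin_dim class_ring V \<and> vectorspace.dim class_ring V = m * d \<and>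
        op_has_invariant_factors V T (padded m d ps) \<longrightarrow>
        card {W. splitting_subspace V T m d W} = card {W. splitting_subspace ?V ((*\<^sub>v) A) m d W}"
    proof (intro allI impI, elim conjE)
      fix V :: "('a, 'a vec) module" and T
      assume "linear_map class_ring V V T" "op_has_invariant_factors V T (padded m d ps)"
      \<comment> \<open>Both products equal the same number, and the positive factor
        \<open>?g\<close> cancels.\<close>
      then have "?g * card {W. splitting_subspace V T m d W}
          = ?g * card {W. splitting_subspace ?V ((*\<^sub>v) A) m d W}"
        using card_splitting_eq[OF assms(2,3)] V0(1,4) by metis
      then show "card {W. splitting_subspace V T m d W} = card {W. splitting_subspace ?V ((*\<^sub>v) A) m d W}"
        using nat_mult_eq_cancel1[OF g] by blast
    qed
  qed (use V0 in blast)
  then have "?g * sigma m d ps = centralizer_order m d ps * mu m m d ps"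
    using card_splitting_eq[OF assms(2,3) V0(1,4)] by simp
  then have "real ?g * real (sigma m d ps) = real (centralizer_order m d ps) * real (mu m m d ps)"
    by (simp only: flip: of_nat_mult)
  \<comment> \<open>Truncated and real subtraction agree here because q^i is at most q^m for i <
    m.\<close>
  moreover have "real ?g = gamma_q CARD('a) m"
    unfolding gamma_q_def of_nat_prod
    by (rule prod.cong) (auto simp: of_nat_diff power_increasing)
  moreover have "real ?g > 0" using g by (rule of_nat_0_less_iff[THEN iffD2])
  ultimately have "gamma_q CARD('a) m * real (sigma m d ps) = real (centralizer_order m d ps) * real (mu m m d ps)"
    and "gamma_q CARD('a) m > 0" by (simp_all only:)
  then show ?thesis by (simp add: field_simps)
qed

end
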